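(* Let $P$ be the Nambu-determinant Poisson bivector on $\mathbb{R}^4$ with Casimirs $a^1,a^2$, and let $\mathcal{W}^-_{4D}$ be the real span of the skew-symmetrized vector fields $\phi^-(\Gamma)$, where $\Gamma$ runs over the four-dimensional descendants of the two graphs $\Gamma^{2D}_{11}=[0,1;1,3;1,2]$ and $\Gamma^{2D}_{12}=[0,3;1,3;1,2]$. Let $(\vec{X}^{\gamma_3}_{4D})^-\in\mathcal{W}^-_{4D}$ be a trivializing vector field for the tetrahedral flow, i.e. $Q^{\gamma_3}(P)=[\![P,(\vec{X}^{\gamma_3}_{4D})^-]\!]$. Then it is unique modulo skew-symmetric Hamiltonian vector fields: for every $\vec{X}\in\mathcal{W}^-_{4D}$ with $Q^{\gamma_3}(P)=[\![P,\vec{X}]\!]$ there is $H\in\mathcal{H}^+_{4D}$ such that $\vec{X}-(\vec{X}^{\gamma_3}_{4D})^-=[\![P,H]\!]$.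
   Context: $[\![\cdot,\cdot]\!]$ is the Schouten bracket of multivector fields. The Nambu-determinant Poisson bivector on $\mathbb{R}^4$ is $P=\tfrac12P^{ij}\partial_i\wedge\partial_j$ with $P^{ij}=\sum_{k,l}\varrho\,\varepsilon^{ijkl}\,\partial_k a^1\,\partial_l a^2$, for smooth functions $\varrho,a^1,a^2$. (Skew-)symmetry is always with respect to the swap $a^1\leftrightarrow a^2$. Tetrahedral flow: let $\gamma_3$ be the complete graph on vertices $1,2,3,4$ with its six edges ordered $12\prec13\prec14\prec23\prec24\prec34$. Write $P=\tfrac12P^{ij}\xi_i\xi_j$ with anticommuting $\xi_i=\partial/\partial x^i$. Up to a nonzero normalization constant, $Q^{\gamma_3}(P)$ is the bivector obtained by applying to $P\otimes P\otimes P\otimes P$, for the edges $(a,b)$ in this order, the operators $\sum_\mu\big(\tfrac{\partial}{\partial\xi_\mu^{(a)}}\tfrac{\partial}{\partial x^\mu_{(b)}}+\tfrac{\partial}{\partial\xi_\mu^{(b)}}\tfrac{\partial}{\partial x^\mu_{(a)}}\big)$ (the label $(a)$ denotes the tensor factor acted on), and then multiplying the four factors. A trivializing vector field in $\mathcal{W}^-_{4D}$ is known to exist by earlier work. A four-dimensional Nambu micro-graph on $n$ copies of $P$ and at most one sink $0$ is a weakly connected directed graph with Levi-Civita vertices $1,\dots,n$, $a^1$-Casimir vertices $n+1,\dots,2n$ and $a^2$-Casimir vertices $2n+1,\dots,3n$, the vertices $n+k$ and $2n+k$ belonging to $k$. Each Levi-Civita vertex $k$ issues four ordered edges to four distinct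 targets, two of which are $n+k$ and $2n+k$; the other two targets are arbitrary vertices (self-loops allowed). Casimir vertices and the sink issue no edges; the sink, if present, receives exactly one edge. The encoding lists, for each Levi-Civita vertex, the targets of its ordered edges, vertices being separated by semicolons. The evaluation $\phi$: decorate the four ordered edges of vertex $k$ with indices $i_{k1},\dots,i_{k4}\in\{1,2,3,4\}$; form $\prod_k\varepsilon^{i_{k1}i_{k2}i_{k3}i_{k4}}$ times the product of $\varrho$ over Levi-Civita vertices, of $a^1$ over $a^1$-Casimir vertices and of $a^2$ over $a^2$-Casimir vertices, each differentiated with respect to $x^i$ for every incoming edge with index $i$, times $\partial_{x^i}$ if the edge with index $i$ enters the sink; sum over all indices. Put $\phi^{\pm}(\Gamma)=\tfrac12\big(\phi(\Gamma)(a^1,a^2)\pm\phi(\Gamma)(a^2,a^1)\big)$. Descendants: a two-dimensional graph $[t_{11},t_{12};t_{21},t_{22};t_{31},t_{32}]$ has sink $0$ and Levi-Civita vertices $1,2,3$ each issuing two ordered edges to the listed targets. Its four-dimensional descendants are all micro-graphs $[t'_{11},t'_{12},4,7;t'_{21},t'_{22},5,8;t'_{31},t'_{32},6,9]$ in which, independently for each edge, $t'=0$ if $t=0$ and $t'\in\{t,t+3,t+6\}$ if $t\in\{1,2,3\}$. Here $4,5,6$ are the $a^1$-Casimir vertices and $7,8,9$ the $a^2$-Casimir vertices of $1,2,3$. $\mathcal{H}^+_{4D}$ is the real span of $\phi^+(\Gamma)$ over four-dimensional Nambu micro-graphs on $2$ copies of $P$ with no sink; for $H\in\mathcal{H}^+_{4D}$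 the vector field $[\![P,H]\!]$ is a skew-symmetric Hamiltonian vector field. The functions $\varrho,a^1,a^2$ are treated as arbitrary (generic): all expressions are differential polynomials with constant coefficients, and equalities are required to hold identically for all smooth $\varrho,a^1,a^2$. *)

theory Defs
  imports "HOL-Analysis.Analysis"
begin

text \<open>
  Coordinates on \<open>\<real>\<^sup>4\<close> are indexed by the numeral type \<^typ>\<open>4\<close>, whose elements are
  \<open>1, 2, 3, 4\<close> with \<open>4 = 0\<close>.
\<close>

section \<open>Smooth functions\<close>

definition dir_deriv :: "'p::real_normed_vector \<Rightarrow> ('p \<Rightarrow> real) \<Rightarrow> 'p \<Rightarrow> real" where
  "dir_deriv v f x = frechet_derivative f (at x) v"

definition pd :: "4 \<Rightarrow> (real^4 \<Rightarrow> real) \<Rightarrow> real^4 \<Rightarrow> real" where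
  "pd i = dir_deriv (axis i 1)"

definition smooth :: "(real^4 \<Rightarrow> real) \<Rightarrow> bool" where
  "smooth f \<longleftrightarrow> (\<forall>is. foldr pd is f differentiable_on UNIV)"


section \<open>Multivector fields as superfunctions\<close>

text \<open>
  A superfunction in anticommuting \<open>\<xi>\<^sub>i = \<partial>/\<partial>x\<^sup>i\<close> is given by its coefficients:
  \<open>F I\<close> is the coefficient of the product of the \<open>\<xi>\<^sub>i\<close> with \<open>i \<in> I\<close>, taken in increasing order
  of the type \<^typ>\<open>4\<close>. The powers of \<open>-1\<close> below are the signs of the reorderings needed to restore
  this order, so that the algebra does not depend on its choice.
\<close>

type_synonym 'p superfun = "4 set \<Rightarrow> 'p \<Rightarrow> real"
type_synonym multivector = "(real^4) superfun"

definition sf_monomial :: "4 set \<Rightarrow> 'p superfun" where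
  "sf_monomial J = (\<lambda>I x. if I = J then 1 else 0)"

abbreviation xi :: "4 \<Rightarrow> 'p superfun" where
  "xi i \<equiv> sf_monomial {i}"

definition sf_mult :: "'p superfun \<Rightarrow> 'p superfun \<Rightarrow> 'p superfun" where
  "sf_mult F G = (\<lambda>I x. \<Sum>J\<in>Pow I.
     (-1) ^ card {(j, k). j \<in> J \<and> k \<in> I - J \<and> k < j} * F J x * G (I - J) x)"

definition sf_prod_list :: "'p superfun list \<Rightarrow> 'p superfun" where
  "sf_prod_list Fs = foldr sf_mult Fs (sf_monomial {})"

definition xi_deriv :: "4 \<Rightarrow> 'p superfun \<Rightarrow> 'p superfun" where
  "xi_deriv i F = (\<lambda>I x. if i \<in> I then 0 else (-1) ^ card {j \<in> I. j < i} * F (insert i I) x)"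

text \<open>The right derivative, which removes \<open>\<xi>\<^sub>i\<close> from the right end of a monomial.\<close>

definition xi_rderiv :: "4 \<Rightarrow> 'p superfun \<Rightarrow> 'p superfun" where
  "xi_rderiv i F = (\<lambda>I x. if i \<in> I then 0 else (-1) ^ card {j \<in> I. i < j} * F (insert i I) x)"

definition x_deriv :: "4 \<Rightarrow> multivector \<Rightarrow> multivector" where
  "x_deriv i F = (\<lambda>I. pd i (F I))"

text \<open>On vector fields this is the Lie bracket.\<close>

definition schouten :: "multivector \<Rightarrow> multivector \<Rightarrow> multivector" where
  "schouten F G = (\<lambda>I x. \<Sum>i\<in>UNIV.
     sf_mult (xi_rderiv i F) (x_deriv i G) I x
     - sf_mult (x_deriv i F) (xi_deriv i G) I x)"


section \<open>The Nambu-determinant Poisson bivector\<close>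

definition levi_civita :: "4 \<Rightarrow> 4 \<Rightarrow> 4 \<Rightarrow> 4 \<Rightarrow> real" where
  "levi_civita i j k l =
     (let q = (\<lambda>p::4. if p = 1 then i else if p = 2 then j else if p = 3 then k else l)
      in if bij q then of_int (sign q) else 0)"

definition nambu_coeff ::
  "(real^4 \<Rightarrow> real) \<Rightarrow> (real^4 \<Rightarrow> real) \<Rightarrow> (real^4 \<Rightarrow> real) \<Rightarrow> 4 \<Rightarrow> 4 \<Rightarrow> real^4 \<Rightarrow> real" where
  "nambu_coeff \<rho> a1 a2 i j x =
     (\<Sum>k\<in>UNIV. \<Sum>l\<in>UNIV. \<rho> x * levi_civita i j k l * pd k a1 x * pd l a2 x)"

definition nambu ::
  "(real^4 \<Rightarrow> real) \<Rightarrow> (real^4 \<Rightarrow> real) \<Rightarrow> (real^4 \<Rightarrow> real) \<Rightarrow> multivector" where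
  "nambu \<rho> a1 a2 = (\<lambda>I x. 1 / 2 *
     (\<Sum>i\<in>UNIV. \<Sum>j\<in>UNIV. nambu_coeff \<rho> a1 a2 i j x * sf_mult (xi i) (xi j) I x))"


section \<open>The tetrahedral flow\<close>

text \<open>
  In the fourfold tensor power of the algebra of multivector fields, \<open>T K\<close> is the coefficient of the
  tensor product of the monomials with index sets \<open>K 1\<close>, \<open>K 2\<close>, \<open>K 3\<close>, \<open>K 4\<close>, in this order;
  \<open>y $ a\<close> is the point at which the factor \<open>a\<close> is evaluated.
\<close>

type_synonym tensor4 = "(4 \<Rightarrow> 4 set) \<Rightarrow> real^4^4 \<Rightarrow> real"

definition tensor_power4 :: "multivector \<Rightarrow> tensor4" where
  "tensor_power4 F = (\<lambda>K y. \<Prod>a\<in>UNIV. F (K a) (y $ a))"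

text \<open>The first sign comes from moving the odd operator past the factors to the left of \<open>a\<close>.\<close>

definition factor_xi_deriv :: "4 \<Rightarrow> 4 \<Rightarrow> tensor4 \<Rightarrow> tensor4" where
  "factor_xi_deriv a i T = (\<lambda>K y.
     (-1) ^ (\<Sum>b\<in>set (takeWhile (\<lambda>b. b \<noteq> a) [1, 2, 3, 4]). card (K b))
     * xi_deriv i (\<lambda>I. T (K(a := I))) (K a) y)"

definition factor_x_deriv :: "4 \<Rightarrow> 4 \<Rightarrow> tensor4 \<Rightarrow> tensor4" where
  "factor_x_deriv a i T = (\<lambda>K. dir_deriv (axis a (axis i 1)) (T K))"

definition edge_operator :: "4 \<times> 4 \<Rightarrow> tensor4 \<Rightarrow> tensor4" where
  "edge_operator = (\<lambda>(a, b) T K y. \<Sum>i\<in>UNIV.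
     factor_xi_deriv a i (factor_x_deriv b i T) K y
     + factor_xi_deriv b i (factor_x_deriv a i T) K y)"

definition multiply_factors :: "tensor4 \<Rightarrow> multivector" where
  "multiply_factors T = (\<lambda>I x. \<Sum>K\<in>UNIV.
     T K (\<chi> a. x) * sf_prod_list (map (\<lambda>a. sf_monomial (K a)) [1, 2, 3, 4]) I x)"

definition tetrahedral_flow :: "multivector \<Rightarrow> multivector" where
  "tetrahedral_flow P = multiply_factors
     (fold edge_operator [(1, 2), (1, 3), (1, 4), (2, 3), (2, 4), (3, 4)] (tensor_power4 P))"


section \<open>Nambu micro-graphs\<close>

text \<open>
  A graph is encoded by the list, over its Levi-Civita vertices \<open>1, \<dots>, n\<close>, of the lists of
  targets of their ordered edges; vertices and the edges issued by a vertex are counted from \<open>1\<close>,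
  and vertex \<open>0\<close> is the sink.
\<close>

type_synonym graph_code = "nat list list"

definition target :: "graph_code \<Rightarrow> nat \<Rightarrow> nat \<Rightarrow> nat" where
  "target \<Gamma> k p = \<Gamma> ! (k - 1) ! (p - 1)"

definition edges_into :: "graph_code \<Rightarrow> nat \<Rightarrow> (nat \<times> nat) list" where
  "edges_into \<Gamma> v =
     filter (\<lambda>(k, p). target \<Gamma> k p = v) (List.product [1..<length \<Gamma> + 1] [1..<5])"

definition weakly_connected :: "nat set \<Rightarrow> (nat \<times> nat) set \<Rightarrow> bool" where
  "weakly_connected V E \<longleftrightarrow> (\<forall>u\<in>V. \<forall>v\<in>V. (u, v) \<in> (E \<union> E\<inverse>)\<^sup>*)"

definition nambu_micrograph :: "nat \<Rightarrow> graph_code \<Rightarrow> bool" where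
  "nambu_micrograph n \<Gamma> \<longleftrightarrow>
     length \<Gamma> = n \<and>
     (\<forall>k\<in>{1..n}. length (\<Gamma> ! (k - 1)) = 4 \<and> distinct (\<Gamma> ! (k - 1)) \<and>
        {n + k, 2 * n + k} \<subseteq> set (\<Gamma> ! (k - 1)) \<and> set (\<Gamma> ! (k - 1)) \<subseteq> {0..3 * n}) \<and>
     length (edges_into \<Gamma> 0) \<le> 1 \<and>
     weakly_connected ({1..3 * n} \<union> (if edges_into \<Gamma> 0 = [] then {} else {0}))
       {(k, target \<Gamma> k p) |k p. k \<in> {1..n} \<and> p \<in> {1..4}}"

text \<open>
  Differential-polynomial expressions in \<open>\<rho>, a\<^sup>1, a\<^sup>2\<close>, viewed as operators. They are relevant on
  smooth arguments only, where the order of the partial derivatives below does not matter.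
\<close>

type_synonym nambu_operator =
  "(real^4 \<Rightarrow> real) \<Rightarrow> (real^4 \<Rightarrow> real) \<Rightarrow> (real^4 \<Rightarrow> real) \<Rightarrow> multivector"

definition vertex_content ::
  "nat \<Rightarrow> (real^4 \<Rightarrow> real) \<Rightarrow> (real^4 \<Rightarrow> real) \<Rightarrow> (real^4 \<Rightarrow> real) \<Rightarrow> nat \<Rightarrow> real^4 \<Rightarrow> real" where
  "vertex_content n \<rho> a1 a2 v = (if v \<le> n then \<rho> else if v \<le> 2 * n then a1 else a2)"

definition phi :: "graph_code \<Rightarrow> nambu_operator" where
  "phi \<Gamma> \<rho> a1 a2 = (let n = length \<Gamma> in (\<lambda>I x.
     \<Sum>\<iota> \<in> ({1..n} \<times> {1..4}) \<rightarrow>\<^sub>E (UNIV :: 4 set).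
       (\<Prod>k=1..n. levi_civita (\<iota> (k, 1)) (\<iota> (k, 2)) (\<iota> (k, 3)) (\<iota> (k, 4)))
       * (\<Prod>v=1..3 * n. foldr pd (map \<iota> (edges_into \<Gamma> v)) (vertex_content n \<rho> a1 a2 v) x)
       * sf_prod_list (map (\<lambda>e. xi (\<iota> e)) (edges_into \<Gamma> 0)) I x))"

definition phi_plus :: "graph_code \<Rightarrow> nambu_operator" where
  "phi_plus \<Gamma> \<rho> a1 a2 = (\<lambda>I x. 1 / 2 * (phi \<Gamma> \<rho> a1 a2 I x + phi \<Gamma> \<rho> a2 a1 I x))"

definition phi_minus :: "graph_code \<Rightarrow> nambu_operator" where
  "phi_minus \<Gamma> \<rho> a1 a2 = (\<lambda>I x. 1 / 2 * (phi \<Gamma> \<rho> a1 a2 I x - phi \<Gamma> \<rho> a2 a1 I x))"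

text \<open>The coefficients are constants: they do not depend on \<open>\<rho>, a\<^sup>1, a\<^sup>2\<close>.\<close>

definition real_span :: "(graph_code \<Rightarrow> nambu_operator) \<Rightarrow> graph_code set \<Rightarrow> nambu_operator set" where
  "real_span \<Phi> S = {X. \<exists>T c. finite T \<and> T \<subseteq> S \<and>
     (\<forall>\<rho> a1 a2. smooth \<rho> \<and> smooth a1 \<and> smooth a2 \<longrightarrow>
        X \<rho> a1 a2 = (\<lambda>I x. \<Sum>\<Gamma>\<in>T. c \<Gamma> * \<Phi> \<Gamma> \<rho> a1 a2 I x))}"


section \<open>The spaces of vector fields and Hamiltonians\<close>

definition target_lifts :: "nat \<Rightarrow> nat set" where
  "target_lifts t = (if t = 0 then {0} else {t, t + 3, t + 6})"

definition descendants :: "graph_code \<Rightarrow> graph_code set" where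
  "descendants \<Delta> = {\<Gamma>. nambu_micrograph 3 \<Gamma> \<and>
     (\<forall>k\<in>{1..3}. target \<Gamma> k 1 \<in> target_lifts (target \<Delta> k 1) \<and>
                 target \<Gamma> k 2 \<in> target_lifts (target \<Delta> k 2) \<and>
                 target \<Gamma> k 3 = 3 + k \<and> target \<Gamma> k 4 = 6 + k)}"

definition W_minus :: "nambu_operator set" where
  "W_minus = real_span phi_minus
     (descendants [[0, 1], [1, 3], [1, 2]] \<union> descendants [[0, 3], [1, 3], [1, 2]])"

definition H_plus :: "nambu_operator set" where
  "H_plus = real_span phi_plus {\<Gamma>. nambu_micrograph 2 \<Gamma> \<and> edges_into \<Gamma> 0 = []}"

text \<open>\<open>Q = [P, X]\<close> identically in \<open>\<rho>, a\<^sup>1, a\<^sup>2\<close>, with the flow \<open>Q\<close> normalized by the constant \<open>c\<close>.\<close>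

definition trivializes_flow :: "real \<Rightarrow> nambu_operator \<Rightarrow> bool" where
  "trivializes_flow c X \<longleftrightarrow>
     (\<forall>\<rho> a1 a2. smooth \<rho> \<and> smooth a1 \<and> smooth a2 \<longrightarrow>
        (\<lambda>I x. c * tetrahedral_flow (nambu \<rho> a1 a2) I x) =
        schouten (nambu \<rho> a1 a2) (X \<rho> a1 a2))"

end

theory Submission
  imports Defs
begin

text \<open>
  Under the integral sign the jets of \<open>\<rho>\<close>, \<open>a\<^sup>1\<close> and \<open>a\<^sup>2\<close> at a point may be replaced by the moments of
  finitely supported measures on \<open>\<real>\<^sup>4\<close>, one copy for each vertex; a graph then becomes an integral of
  a product of \<open>4 \<times> 4\<close> determinants, and a Levi-Civita vertex becomes the bracket of its targets.
  Renaming of vertices of the same class and the exchange (Pluecker) relation for determinants reduce the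
  descendants to 64 graphs and express the brackets \<open>[P, H]\<close> of 7 Hamiltonians through these graphs.
  Evaluating \<open>[P, X] = 0\<close> at the origin for 57 triples of functions with prescribed jets gives
  linear equations for the 64 coefficients of \<open>X\<close>, whose solutions are spanned by these 7 fields.
\<close>

section \<open>Iterated partial derivatives\<close>

text \<open>The moment substitution is the symbolic (umbral) method of classical invariant theory.
  An evaluation is a sum over \<open>4^12\<close> decorations; as an integral of a product of
  determinants it obeys every determinant identity under the integral sign and, since vertices with
  the same content carry the same measure, every renaming within a class. A further derivative
  \<open>pd j\<close> multiplies the integrand by the sum of the \<open>j\<close>-th coordinates of
  all vertices (Leibniz), so a Schouten bracket is again a sum of such integrals. Two trivializing
  fields differ by a field that commutes with \<open>P\<close>, so the kernel of
  \<open>[P, -]\<close> on the span has to be found. The tests determine a commuting field by 7 of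
  its 64 coordinates, one for each Hamiltonian, and the Hamiltonians realize all choices of these 7.
  The order bound 13 arises because a field has 12 edges and the bracket with \<open>P\<close>
  differentiates once more. The constant 24 is a common denominator of the solved linear
  system.\<close>

lemma pd_eqI: "(f has_derivative f') (at x) \<Longrightarrow> pd i f x = f' (axis i 1)"
  unfolding pd_def dir_deriv_def using frechet_derivative_at by metis

lemma smooth_differentiable: "smooth f \<Longrightarrow> f differentiable (at x)"
proof -
  assume "smooth f"
  then have "foldr pd [] f differentiable_on UNIV" unfolding smooth_def by blast
  then show ?thesis by (simp add: differentiable_on_def)
qed

lemma smooth_foldr_pd: "smooth f \<Longrightarrow> smooth (foldr pd is f)"
  unfolding smooth_def by (metis foldr_append)

lemma smooth_pd: "smooth f \<Longrightarrow> smooth (pd i f)"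
  using smooth_foldr_pd[of f "[i]"] by simp

lemma DERIV_line:
  assumes "f differentiable (at (y + t *\<^sub>R axis i 1))"
  shows "((\<lambda>t. f (y + t *\<^sub>R axis i 1)) has_real_derivative pd i f (y + t *\<^sub>R axis i 1)) (at t)"
proof -
  let ?D = "frechet_derivative f (at (y + t *\<^sub>R axis i 1))"
  have D: "(f has_derivative ?D) (at (y + t *\<^sub>R axis i 1))"
    using assms frechet_derivative_works by blast
  have "((\<lambda>t. f (y + t *\<^sub>R axis i 1)) has_derivative (\<lambda>s. ?D (s *\<^sub>R axis i 1))) (at t)"
    by (rule has_derivative_compose[where f = "\<lambda>t. y + t *\<^sub>R axis i 1", OF _ D])
      (auto intro!: derivative_eq_intros)
  moreover have "?D (s *\<^sub>R axis i 1) = pd i f (y + t *\<^sub>R axis i 1) * s" for s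
    using linear_scale[OF has_derivative_linear[OF D]] by (simp add: pd_def dir_deriv_def)
  ultimately show ?thesis unfolding has_field_derivative_def by simp
qed

text \<open>The mean value theorem is applied twice: in direction \<open>i\<close> to the increment
  of \<open>f\<close> in direction \<open>j\<close>, then in direction \<open>j\<close> to
  \<open>pd i f\<close>.\<close>

lemma second_difference:
  assumes f: "smooth f" and t: "t > 0"
  shows "\<exists>a b. 0 < a \<and> a < t \<and> 0 < b \<and> b < t \<and>
    f (x + t *\<^sub>R axis i 1 + t *\<^sub>R axis j 1) - f (x + t *\<^sub>R axis i 1) - f (x + t *\<^sub>R axis j 1) + f x
    = t * (t * pd j (pd i f) (x + a *\<^sub>R axis i 1 + b *\<^sub>R axis j 1))"
proof -
  define g where "g = (\<lambda>s. f ((x + t *\<^sub>R axis j 1) + s *\<^sub>R axis i 1) - f (x + s *\<^sub>R axis i 1))"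
  define g' where "g' = (\<lambda>s. pd i f ((x + t *\<^sub>R axis j 1) + s *\<^sub>R axis i 1) - pd i f (x + s *\<^sub>R axis i 1))"
  have "\<And>s. 0 \<le> s \<Longrightarrow> s \<le> t \<Longrightarrow> DERIV g s :> g' s"
    unfolding g_def g'_def by (intro DERIV_diff DERIV_line smooth_differentiable f)
  from MVT2[OF t this] obtain a where a: "0 < a" "a < t" "g t - g 0 = (t - 0) * g' a" by auto
  define h where "h = (\<lambda>s. pd i f ((x + a *\<^sub>R axis i 1) + s *\<^sub>R axis j 1))"
  have "\<And>s. 0 \<le> s \<Longrightarrow> s \<le> t \<Longrightarrow> DERIV h s :> pd j (pd i f) ((x + a *\<^sub>R axis i 1) + s *\<^sub>R axis j 1)"
    unfolding h_def by (intro DERIV_line smooth_differentiable smooth_pd f)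
  from MVT2[OF t this] obtain b where b: "0 < b" "b < t"
    "h t - h 0 = (t - 0) * pd j (pd i f) ((x + a *\<^sub>R axis i 1) + b *\<^sub>R axis j 1)" by auto
  have "h t - h 0 = g' a" by (simp add: h_def g'_def add_ac)
  moreover have "f (x + t *\<^sub>R axis i 1 + t *\<^sub>R axis j 1) - f (x + t *\<^sub>R axis i 1)
      - f (x + t *\<^sub>R axis j 1) + f x = g t - g 0"
    by (simp add: g_def add_ac)
  ultimately show ?thesis
    using a b by (intro exI[of _ a] exI[of _ b] conjI) simp_all
qed

lemma smooth_isCont: "smooth f \<Longrightarrow> isCont f x"
  by (simp add: smooth_differentiable differentiable_imp_continuous_within)

lemma LIMSEQ_near:
  fixes x :: "'a::real_normed_vector"
  assumes "\<And>n. norm (y n - x) \<le> c * inverse (real (Suc n))"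
  shows "y \<longlonglongrightarrow> x"
proof -
  have "(\<lambda>n. c * inverse (real (Suc n))) \<longlonglongrightarrow> c * 0"
    by (intro tendsto_mult tendsto_const LIMSEQ_inverse_real_of_nat)
  then have lim: "(\<lambda>n. c * inverse (real (Suc n))) \<longlonglongrightarrow> 0" by (simp only: mult_zero_right)
  have "(\<lambda>n. y n - x) \<longlonglongrightarrow> 0"
    by (rule Lim_null_comparison[OF _ lim]) (rule always_eventually, rule allI, rule assms)
  then show ?thesis by (rule LIM_zero_cancel)
qed

text \<open>The second difference is symmetric in \<open>i\<close> and \<open>j\<close>; computing
  it in both orders equates the two mixed partials at two points near \<open>x\<close>.\<close>

lemma mixed_partials_meet:
  assumes f: "smooth f" and t: "t > 0"
  shows "\<exists>y z. norm (y - x) \<le> 2 * t \<and> norm (z - x) \<le> 2 * t \<and> pd j (pd i f) y = pd i (pd j f) z"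
proof -
  obtain a b where ab: "0 < a" "a < t" "0 < b" "b < t" and
    1: "f (x + t *\<^sub>R axis i 1 + t *\<^sub>R axis j 1) - f (x + t *\<^sub>R axis i 1) - f (x + t *\<^sub>R axis j 1) + f x
      = t * (t * pd j (pd i f) (x + a *\<^sub>R axis i 1 + b *\<^sub>R axis j 1))"
    using second_difference[OF f t, of x i j] by blast
  obtain c d where cd: "0 < c" "c < t" "0 < d" "d < t" and
    2: "f (x + t *\<^sub>R axis j 1 + t *\<^sub>R axis i 1) - f (x + t *\<^sub>R axis j 1) - f (x + t *\<^sub>R axis i 1) + f x
      = t * (t * pd i (pd j f) (x + c *\<^sub>R axis j 1 + d *\<^sub>R axis i 1))"
    using second_difference[OF f t, of x j i] by blast
  have "x + t *\<^sub>R axis i 1 + t *\<^sub>R axis j 1 = x + t *\<^sub>R axis j 1 + t *\<^sub>R axis i 1"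
    by (simp add: add_ac)
  then have "f (x + t *\<^sub>R axis i 1 + t *\<^sub>R axis j 1) = f (x + t *\<^sub>R axis j 1 + t *\<^sub>R axis i 1)"
    by (rule arg_cong)
  with 1 2 have "t * (t * pd j (pd i f) (x + a *\<^sub>R axis i 1 + b *\<^sub>R axis j 1)) =
      t * (t * pd i (pd j f) (x + c *\<^sub>R axis j 1 + d *\<^sub>R axis i 1))"
    by linarith
  then have "pd j (pd i f) (x + a *\<^sub>R axis i 1 + b *\<^sub>R axis j 1) =
      pd i (pd j f) (x + c *\<^sub>R axis j 1 + d *\<^sub>R axis i 1)"
    using t by simp
  moreover have "norm (u *\<^sub>R axis k (1::real) + v *\<^sub>R axis l (1::real) :: real^4) \<le> 2 * t"
    if "0 < u" "u < t" "0 < v" "v < t" for u v k l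
  proof -
    have "norm (u *\<^sub>R axis k (1::real) + v *\<^sub>R axis l (1::real) :: real^4)
      \<le> norm (u *\<^sub>R axis k (1::real) :: real^4) + norm (v *\<^sub>R axis l (1::real) :: real^4)"
      by (rule norm_triangle_ineq)
    then show ?thesis using that by (simp add: norm_axis_1)
  qed
  ultimately show ?thesis
    using ab cd by (intro exI[of _ "x + a *\<^sub>R axis i 1 + b *\<^sub>R axis j 1"]
        exI[of _ "x + c *\<^sub>R axis j 1 + d *\<^sub>R axis i 1"] conjI) (simp_all add: add.assoc)
qed

text \<open>Schwarz's theorem: the two points of \<open>mixed_partials_meet\<close> tend to
  \<open>x\<close> as the step \<open>1 / (n + 1)\<close> shrinks, and both mixed partials are
  continuous.\<close>

lemma pd_commute:
  assumes f: "smooth f"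
  shows "pd i (pd j f) = pd j (pd i f)"
proof
  fix x
  have "\<exists>y z. norm (y - x) \<le> 2 * inverse (real (Suc n)) \<and> norm (z - x) \<le> 2 * inverse (real (Suc n)) \<and>
      pd j (pd i f) y = pd i (pd j f) z" for n
    by (rule mixed_partials_meet[OF f]) simp
  then obtain y z where yz: "\<And>n. norm (y n - x) \<le> 2 * inverse (real (Suc n))"
    "\<And>n. norm (z n - x) \<le> 2 * inverse (real (Suc n))" and
    eq: "\<And>n. pd j (pd i f) (y n) = pd i (pd j f) (z n)"
    by metis
  have "(\<lambda>n. pd j (pd i f) (y n)) \<longlonglongrightarrow> pd j (pd i f) x"
    by (rule isCont_tendsto_compose[OF smooth_isCont LIMSEQ_near[OF yz(1)]]) (intro smooth_pd f)
  moreover have "(\<lambda>n. pd i (pd j f) (z n)) \<longlonglongrightarrow> pd i (pd j f) x"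
    by (rule isCont_tendsto_compose[OF smooth_isCont LIMSEQ_near[OF yz(2)]]) (intro smooth_pd f)
  ultimately show "pd i (pd j f) x = pd j (pd i f) x"
    unfolding eq using LIMSEQ_unique by blast
qed

lemma foldr_pd_Cons_move:
  assumes "smooth f"
  shows "foldr pd (is @ i # js) f = foldr pd (i # is @ js) f"
proof (induction "is")
  case (Cons k ks)
  then show ?case
    using pd_commute[OF smooth_foldr_pd[OF assms, of "ks @ js"], of k i] by simp
qed simp

lemma foldr_pd_mset:
  assumes f: "smooth f" and "mset is = mset js"
  shows "foldr pd is f = foldr pd js f"
  using assms(2)
proof (induction "is" arbitrary: js)
  case (Cons i "is")
  then have "i \<in> set js" by (metis list.set_intros(1) set_mset_mset)
  then obtain as bs where js: "js = as @ i # bs" by (meson split_list)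
  then have "mset is = mset (as @ bs)" using Cons.prems by simp
  then have "foldr pd is f = foldr pd (as @ bs) f" by (rule Cons.IH)
  then show ?case using foldr_pd_Cons_move[OF f, of as i bs] js by simp
qed simp

section \<open>Moment representation of jets\<close>

text \<open>Solves a Vandermonde system with nodes \<open>0..N\<close> by induction: multiplying the
  weights by \<open>s - (N + 1)\<close> removes the new node and turns the moments
  \<open>g n\<close> into \<open>g (n + 1) - (N + 1) * g n\<close>.\<close>

lemma finite_moment_problem:
  "\<exists>r::nat \<Rightarrow> real. \<forall>n\<le>N. (\<Sum>s\<le>N. r s * real s ^ n) = g n"
proof (induction N arbitrary: g)
  case 0
  show ?case by (rule exI[of _ g]) simp
next
  case (Suc N)
  obtain r' where r': "\<And>n. n \<le> N \<Longrightarrow> (\<Sum>s\<le>N. r' s * real s ^ n) = g (Suc n) - real (Suc N) * g n"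
    using Suc.IH[of "\<lambda>n. g (Suc n) - real (Suc N) * g n"] by blast
  \<comment> \<open>The weight of the new node only has to correct the total mass; the higher
    moments then follow from the recursion.\<close>
  define r where "r s = (if s \<le> N then r' s / (real s - real (Suc N))
      else g 0 - (\<Sum>s\<le>N. r' s / (real s - real (Suc N))))" for s
  have r: "r s * (real s - real (Suc N)) = r' s" if "s \<le> N" for s
    using that by (simp add: r_def)
  have "(\<Sum>s\<le>Suc N. r s * real s ^ n) = g n" if "n \<le> Suc N" for n
    using that
  proof (induction n)
    case 0
    then show ?case by (simp add: r_def)
  next
    case (Suc n)
    have "(\<Sum>s\<le>Suc N. r s * real s ^ Suc n) =
      real (Suc N) * (\<Sum>s\<le>Suc N. r s * real s ^ n) + (\<Sum>s\<le>N. r s * (real s - real (Suc N)) * real s ^ n)"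
      by (simp add: algebra_simps sum.distrib sum_subtractf sum_distrib_left)
    also have "(\<Sum>s\<le>N. r s * (real s - real (Suc N)) * real s ^ n) = (\<Sum>s\<le>N. r' s * real s ^ n)"
      by (rule sum.cong) (use r in auto)
    finally show ?case using Suc r'[of n] by simp
  qed
  then show ?case by blast
qed

type_synonym point_measure = "(real \<times> (real^4)) list"

definition integ :: "point_measure \<Rightarrow> (real^4 \<Rightarrow> real) \<Rightarrow> real" where
  "integ \<mu> h = (\<Sum>(r, q)\<leftarrow>\<mu>. r * h q)"

definition coord_prod :: "4 list \<Rightarrow> real^4 \<Rightarrow> real" where
  "coord_prod is q = (\<Prod>i\<leftarrow>is. q $ i)"

lemma coord_prod_simps [simp]: "coord_prod [] q = 1" "coord_prod (i # is) q = q $ i * coord_prod is q"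
  by (simp_all add: coord_prod_def)

lemma coord_prod_eq_powers:
  "coord_prod is q = q$1 ^ count_list is 1 * q$2 ^ count_list is 2 * q$3 ^ count_list is 3 * q$4 ^ count_list is 4"
proof (induction "is")
  case (Cons i "is")
  then show ?case using exhaust_4[of i] by auto
qed simp

lemma count_list_mset: "count_list xs x = count (mset xs) x"
  by (induction xs) auto

text \<open>A symmetric array of derivatives is a function of four multiplicities. The moments are
  matched on the grid \<open>{0..N}^4\<close>; the bound on the length keeps each exponent at most
  \<open>N\<close>.\<close>

lemma moment_representation:
  fixes G :: "4 list \<Rightarrow> real"
  assumes G: "\<And>is js. mset is = mset js \<Longrightarrow> G is = G js"
  shows "\<exists>\<mu>. \<forall>is. length is \<le> N \<longrightarrow> integ \<mu> (coord_prod is) = G is"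
proof -
  define J where "J n1 n2 n3 n4 = G (replicate n1 1 @ replicate n2 2 @ replicate n3 3 @ replicate n4 4)"
    for n1 n2 n3 n4
  have J: "J (count_list is 1) (count_list is 2) (count_list is 3) (count_list is 4) = G is" for "is"
    unfolding J_def
  proof (rule G, rule multiset_eqI)
    fix i :: 4
    show "count (mset (replicate (count_list is 1) 1 @ replicate (count_list is 2) 2 @
      replicate (count_list is 3) 3 @ replicate (count_list is 4) 4)) i = count (mset is) i"
      using exhaust_4[of i] by (auto simp: count_list_mset)
  qed
  have "\<exists>r::nat \<Rightarrow> real. \<forall>n\<le>N. (\<Sum>s\<le>N. r s * real s ^ n) = g n" for g
    by (rule finite_moment_problem)
  then obtain R :: "(nat \<Rightarrow> real) \<Rightarrow> nat \<Rightarrow> real"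
    where R: "\<And>g n. n \<le> N \<Longrightarrow> (\<Sum>s\<le>N. R g s * real s ^ n) = g n" by metis
  \<comment> \<open>One coordinate at a time: each stage solves a moment problem for fixed nodes of
    the earlier coordinates and fixed exponents of the later ones.\<close>
  define r1 where "r1 n2 n3 n4 = R (\<lambda>n1. J n1 n2 n3 n4)" for n2 n3 n4
  define r2 where "r2 s1 n3 n4 = R (\<lambda>n2. r1 n2 n3 n4 s1)" for s1 n3 n4
  define r3 where "r3 s1 s2 n4 = R (\<lambda>n3. r2 s1 n3 n4 s2)" for s1 s2 n4
  define r4 where "r4 s1 s2 s3 = R (\<lambda>n4. r3 s1 s2 n4 s3)" for s1 s2 s3
  have r: "(\<Sum>s1\<le>N. (\<Sum>s2\<le>N. (\<Sum>s3\<le>N. (\<Sum>s4\<le>N. r4 s1 s2 s3 s4 * real s4 ^ n4)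
      * real s3 ^ n3) * real s2 ^ n2) * real s1 ^ n1) = J n1 n2 n3 n4"
    if "n1 \<le> N" "n2 \<le> N" "n3 \<le> N" "n4 \<le> N" for n1 n2 n3 n4
    using that by (simp add: r4_def r3_def r2_def r1_def R)
  define A where "A = {..N} \<times> {..N} \<times> {..N} \<times> {..N}"
  obtain L where L: "set L = A" "distinct L"
    using finite_distinct_list[of A] by (auto simp: A_def)
  define pt :: "nat \<times> nat \<times> nat \<times> nat \<Rightarrow> real^4" where
    "pt = (\<lambda>(s1, s2, s3, s4). \<chi> i. if i = 1 then real s1 else if i = 2 then real s2 else if i = 3 then real s3 else real s4)"
  define \<mu> where "\<mu> = map (\<lambda>s. ((\<lambda>(s1, s2, s3, s4). r4 s1 s2 s3 s4) s, pt s)) L"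
  have "integ \<mu> (coord_prod is) = G is" if "length is \<le> N" for "is"
  proof -
    have le: "count_list is i \<le> N" for i using that count_le_length[of "is" i] by linarith
    have "integ \<mu> (coord_prod is) = (\<Sum>(s1, s2, s3, s4)\<in>A. r4 s1 s2 s3 s4 * coord_prod is (pt (s1, s2, s3, s4)))"
      unfolding integ_def \<mu>_def using L
      by (simp add: comp_def sum_list_distinct_conv_sum_set case_prod_unfold)
    also have "\<dots> = J (count_list is 1) (count_list is 2) (count_list is 3) (count_list is 4)"
      unfolding A_def r[OF le le le le, symmetric]
      by (simp add: sum.cartesian_product[symmetric] coord_prod_eq_powers pt_def
          sum_distrib_left sum_distrib_right mult_ac)
    finally show ?thesis using J by simp
  qed
  then show ?thesis by blast
qed

lemma integ_linear:
  "integ \<mu> (\<lambda>q. h q + k q) = integ \<mu> h + integ \<mu> k"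
  "integ \<mu> (\<lambda>q. c * h q) = c * integ \<mu> h"
  "integ \<mu> (\<lambda>q. h q * c) = integ \<mu> h * c"
  "integ \<mu> (\<lambda>q. 0) = 0"
  unfolding integ_def by (induction \<mu>) (auto simp: algebra_simps)

lemma integ_swap: "integ \<mu> (\<lambda>q. integ \<nu> (\<lambda>q'. h q q')) = integ \<nu> (\<lambda>q'. integ \<mu> (\<lambda>q. h q q'))"
proof (induction \<mu>)
  case Nil
  then show ?case by (simp add: integ_def case_prod_unfold)
next
  case (Cons a \<mu>)
  have "integ (a # \<mu>) k = fst a * k (snd a) + integ \<mu> k" for k
    by (simp add: integ_def case_prod_unfold)
  then show ?case using Cons by (simp add: integ_linear)
qed

section \<open>Product functionals\<close>

text \<open>Iterated integration over one point for each listed vertex. The assignment supplies the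
  values at all other vertices, in particular the vector at the sink 0.\<close>

fun multi_integ :: "(nat \<Rightarrow> point_measure) \<Rightarrow> nat list \<Rightarrow> ((nat \<Rightarrow> real^4) \<Rightarrow> real) \<Rightarrow> (nat \<Rightarrow> real^4) \<Rightarrow> real" where
  "multi_integ C [] F p = F p"
| "multi_integ C (v # vs) F p = integ (C v) (\<lambda>q. multi_integ C vs F (p(v := q)))"

lemma multi_integ_linear:
  "multi_integ C vs (\<lambda>p. F p + G p) p0 = multi_integ C vs F p0 + multi_integ C vs G p0"
  "multi_integ C vs (\<lambda>p. c * F p) p0 = c * multi_integ C vs F p0"
  "multi_integ C vs (\<lambda>p. F p * c) p0 = multi_integ C vs F p0 * c"
  "multi_integ C vs (\<lambda>p. 0) p0 = 0"
  by (induction vs arbitrary: p0) (simp_all add: integ_linear)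

lemma multi_integ_sum:
  "multi_integ C vs (\<lambda>p. \<Sum>a\<in>A. F a p) p0 = (\<Sum>a\<in>A. multi_integ C vs (F a) p0)"
  by (induction A rule: infinite_finite_induct) (simp_all add: multi_integ_linear)

lemma multi_integ_sum_list:
  "multi_integ C vs (\<lambda>p. \<Sum>a\<leftarrow>as. F a p) p0 = (\<Sum>a\<leftarrow>as. multi_integ C vs (F a) p0)"
  by (induction as) (simp_all add: multi_integ_linear)

lemma multi_integ_cong:
  assumes "\<And>p. (\<And>w. w \<notin> set vs \<Longrightarrow> p w = p0 w) \<Longrightarrow> F p = G p"
  shows "multi_integ C vs F p0 = multi_integ C vs G p0"
  using assms
proof (induction vs arbitrary: p0)
  case (Cons v vs)
  have "multi_integ C vs F (p0(v := q)) = multi_integ C vs G (p0(v := q))" for q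
  proof (rule Cons.IH)
    show "F p = G p" if "\<And>w. w \<notin> set vs \<Longrightarrow> p w = (p0(v := q)) w" for p
      by (rule Cons.prems) (use that in \<open>auto simp: fun_upd_def\<close>)
  qed
  then show ?case by simp
qed simp

lemma multi_integ_append:
  "multi_integ C (vs @ ws) F p = multi_integ C vs (\<lambda>p. multi_integ C ws F p) p"
  by (induction vs arbitrary: p) simp_all

lemma multi_integ_contents_cong:
  "(\<And>v. v \<in> set vs \<Longrightarrow> C v = C' v) \<Longrightarrow> multi_integ C vs F p = multi_integ C' vs F p"
  by (induction vs arbitrary: p) simp_all

text \<open>\<open>W\<close> collects the vertices whose values are already fixed; the induction
  moves each integrated vertex into it.\<close>

lemma multi_integ_base_cong:
  assumes "\<And>p p'. (\<And>w. w \<in> set vs \<union> W \<Longrightarrow> p w = p' w) \<Longrightarrow> F p = F p'"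
    and "\<And>w. w \<in> W \<Longrightarrow> p0 w = p0' w"
  shows "multi_integ C vs F p0 = multi_integ C vs F p0'"
  using assms
proof (induction vs arbitrary: p0 p0' W)
  case Nil
  have "F p0 = F p0'" by (rule Nil.prems(1)) (use Nil.prems(2) in auto)
  then show ?case by simp
next
  case (Cons v vs)
  have "multi_integ C vs F (p0(v := q)) = multi_integ C vs F (p0'(v := q))" for q
  proof (rule Cons.IH[of "insert v W"])
    show "F p = F p'" if "\<And>w. w \<in> set vs \<union> insert v W \<Longrightarrow> p w = p' w" for p p'
      by (rule Cons.prems(1)) (rule that, auto)
    show "(p0(v := q)) w = (p0'(v := q)) w" if "w \<in> insert v W" for w
      using that Cons.prems(2)[of w] by auto
  qed
  then show ?case by simp
qed

lemma multi_integ_upd: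
  "w \<notin> set vs \<Longrightarrow> multi_integ C vs F (p0(w := z)) = multi_integ C vs (\<lambda>p. F (p(w := z))) p0"
  by (induction vs arbitrary: p0) (auto simp: fun_upd_twist)

text \<open>Fubini for two factors that do not see each other's vertices. It fuses the jets of
  \<open>P\<close> with those of a field or a Hamiltonian into one integral.\<close>

lemma multi_integ_mult:
  assumes "\<And>p q. (\<And>w. w \<notin> set ws \<Longrightarrow> p w = q w) \<Longrightarrow> F p = F q"
    and "\<And>p q. (\<And>w. w \<notin> set vs \<Longrightarrow> p w = q w) \<Longrightarrow> G p = G q"
  shows "multi_integ C (vs @ ws) (\<lambda>p. F p * G p) p0 = multi_integ C vs F p0 * multi_integ C ws G p0"
proof -
  have 1: "multi_integ C ws (\<lambda>p. F p * G p) p = F p * multi_integ C ws G p" for p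
  proof -
    have "multi_integ C ws (\<lambda>p. F p * G p) p = multi_integ C ws (\<lambda>p'. F p * G p') p"
    proof (rule multi_integ_cong)
      fix p' assume "\<And>w. w \<notin> set ws \<Longrightarrow> p' w = p w"
      then have "F p' = F p" by (rule assms(1))
      then show "F p' * G p' = F p * G p'" by simp
    qed
    then show ?thesis by (simp add: multi_integ_linear)
  qed
  have 2: "multi_integ C ws G p = multi_integ C ws G p0" if "\<And>w. w \<notin> set vs \<Longrightarrow> p w = p0 w" for p
  proof (rule multi_integ_base_cong[of _ "- set vs"])
    show "G q = G q'" if "\<And>w. w \<in> set ws \<union> - set vs \<Longrightarrow> q w = q' w" for q q'
      by (rule assms(2)) (use that in auto)
  qed (use that in auto)
  have "multi_integ C vs (\<lambda>p. F p * multi_integ C ws G p) p0 =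
      multi_integ C vs (\<lambda>p. F p * multi_integ C ws G p0) p0"
  proof (rule multi_integ_cong)
    fix p assume "\<And>w. w \<notin> set vs \<Longrightarrow> p w = p0 w"
    then have "multi_integ C ws G p = multi_integ C ws G p0" by (rule 2)
    then show "F p * multi_integ C ws G p = F p * multi_integ C ws G p0" by simp
  qed
  then show ?thesis by (simp add: multi_integ_append 1 multi_integ_linear)
qed

lemma multi_integ_swap:
  "v \<noteq> w \<Longrightarrow> multi_integ C (v # w # vs) F p = multi_integ C (w # v # vs) F p"
  by (simp add: fun_upd_twist) (rule integ_swap)

lemma multi_integ_perm:
  assumes "mset vs = mset ws" "distinct vs"
  shows "multi_integ C vs F p = multi_integ C ws F p"
  using assms
proof (induction vs arbitrary: ws p)
  case (Cons v vs)
  have "v \<in> set ws" using Cons.prems(1) by (metis list.set_intros(1) set_mset_mset)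
  then obtain as bs where ws: "ws = as @ v # bs" by (meson split_list)
  have vs: "mset vs = mset (as @ bs)" using Cons.prems ws by simp
  have dw: "distinct ws" using Cons.prems by (metis mset_eq_imp_distinct_iff)
  have "multi_integ C (as @ v # bs) F p = multi_integ C (v # as @ bs) F p" for p
    using dw unfolding ws
  proof (induction as arbitrary: p)
    case (Cons a as)
    have "multi_integ C (a # as @ v # bs) F p = multi_integ C (a # v # as @ bs) F p"
      using Cons by simp
    also have "\<dots> = multi_integ C (v # a # as @ bs) F p"
      by (rule multi_integ_swap) (use Cons.prems in auto)
    finally show ?case by simp
  qed simp
  then show ?case using Cons.IH[OF vs] Cons.prems ws by simp
qed simp

lemma multi_integ_relabel:
  assumes "bij m"
  shows "multi_integ C (map m vs) F p = multi_integ (C \<circ> m) vs (\<lambda>q. F (q \<circ> inv m)) (p \<circ> m)"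
proof (induction vs arbitrary: p)
  case Nil
  have "(p \<circ> m) \<circ> inv m = p"
    using assms by (simp add: fun_eq_iff bij_is_surj surj_f_inv_f)
  then show ?case by (simp only: list.map multi_integ.simps)
next
  case (Cons v vs)
  have eq: "(p(m v := q)) \<circ> m = (p \<circ> m)(v := q)" for q
    using assms by (auto simp: fun_eq_iff bij_is_inj inj_eq)
  show ?case unfolding list.map multi_integ.simps Cons.IH eq by simp
qed

section \<open>Determinants\<close>

fun picks :: "'a list \<Rightarrow> (int \<times> 'a \<times> 'a list) list" where
  "picks [] = []"
| "picks (k # ks) = (1, k, ks) # map (\<lambda>(s, l, ls). (- s, l, k # ls)) (picks ks)"

text \<open>The determinant as a Laplace expansion along the first vector. The evaluator
  \<open>eval_slots\<close> later follows this recursion one slot at a time.\<close>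

fun laplace :: "(real^4) list \<Rightarrow> 4 list \<Rightarrow> real" where
  "laplace [] ks = 1"
| "laplace (v # vs) ks = (\<Sum>(s, k, ls)\<leftarrow>picks ks. of_int s * v $ k * laplace vs ls)"

definition det4 :: "real^4 \<Rightarrow> real^4 \<Rightarrow> real^4 \<Rightarrow> real^4 \<Rightarrow> real" where
  "det4 a b c d = laplace [a, b, c, d] [1, 2, 3, 4]"

lemma det4_expand:
  "det4 a b c d =
     a$1 * (b$2 * (c$3 * d$4 - c$4 * d$3) - b$3 * (c$2 * d$4 - c$4 * d$2) + b$4 * (c$2 * d$3 - c$3 * d$2))
   - a$2 * (b$1 * (c$3 * d$4 - c$4 * d$3) - b$3 * (c$1 * d$4 - c$4 * d$1) + b$4 * (c$1 * d$3 - c$3 * d$1))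
   + a$3 * (b$1 * (c$2 * d$4 - c$4 * d$2) - b$2 * (c$1 * d$4 - c$4 * d$1) + b$4 * (c$1 * d$2 - c$2 * d$1))
   - a$4 * (b$1 * (c$2 * d$3 - c$3 * d$2) - b$2 * (c$1 * d$3 - c$3 * d$1) + b$3 * (c$1 * d$2 - c$2 * d$1))"
  unfolding det4_def by (simp add: algebra_simps)

lemma det4_swap:
  "det4 b a c d = - det4 a b c d"
  "det4 a c b d = - det4 a b c d"
  "det4 a b d c = - det4 a b c d"
  unfolding det4_expand by (simp_all add: algebra_simps)

lemma det4_add: "det4 (a + a') b c d = det4 a b c d + det4 a' b c d"
  unfolding det4_expand by (simp add: algebra_simps)

lemma det4_scale: "det4 (r *\<^sub>R a) b c d = r * det4 a b c d"
  unfolding det4_expand by (simp add: algebra_simps)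

lemma det4_zero: "det4 0 b c d = 0"
  unfolding det4_expand by simp

lemma det4_sum: "det4 (\<Sum>i\<in>A. f i) b c d = (\<Sum>i\<in>A. det4 (f i) b c d)"
  by (induction A rule: infinite_finite_induct) (simp_all add: det4_add det4_zero)

lemma det4_axis_sum: "(\<Sum>i\<in>UNIV. y $ i * det4 (axis i 1) b c d) = det4 y b c d"
proof -
  have "det4 y b c d = det4 (\<Sum>i\<in>UNIV. y $ i *\<^sub>R axis i 1) b c d"
    using basis_expansion[of y] by (simp add: scalar_mult_eq_scaleR)
  then show ?thesis by (simp add: det4_sum det4_scale)
qed

text \<open>Cramer's rule, cleared of denominators, for five vectors in a four-dimensional
  space.\<close>

lemma cramer4:
  "det4 a b c d *\<^sub>R e = det4 e b c d *\<^sub>R a + det4 a e c d *\<^sub>R b + det4 a b e d *\<^sub>R c + det4 a b c e *\<^sub>R d"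
  unfolding vec_eq_iff det4_expand forall_4 by (simp; algebra)

text \<open>The Pluecker relation: \<open>det4 _ f g h\<close> applied to both sides of
  \<open>cramer4\<close>.\<close>

lemma det4_exchange:
  "det4 a b c d * det4 e f g h = det4 e b c d * det4 a f g h + det4 a e c d * det4 b f g h
    + det4 a b e d * det4 c f g h + det4 a b c e * det4 d f g h"
  using arg_cong[OF cramer4[of a b c d e], of "\<lambda>z. det4 z f g h"]
  by (simp add: det4_add det4_scale)

text \<open>A swap of arguments composes the index map with a transposition, which preserves
  bijectivity and flips the sign.\<close>

lemma levi_civita_swap:
  "levi_civita j i k l = - levi_civita i j k l"
  "levi_civita i k j l = - levi_civita i j k l"
  "levi_civita i j l k = - levi_civita i j k l"
proof -
  have gen: "(if bij (q \<circ> Transposition.transpose a b) then of_int (sign (q \<circ> Transposition.transpose a b)) else 0) =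
      - (if bij q then of_int (sign q) else (0::real))" if "a \<noteq> b" for q :: "4 \<Rightarrow> 4" and a b
  proof -
    have "bij (q \<circ> Transposition.transpose a b) \<longleftrightarrow> bij q"
      by (rule bij_betw_comp_iff[OF bij_transpose, symmetric])
    moreover have "sign (q \<circ> Transposition.transpose a b) = - sign q" if "bij q"
    proof -
      have "permutation q" using that by (simp add: permutation)
      then show ?thesis using \<open>a \<noteq> b\<close> by (simp add: sign_compose permutation_swap_id sign_swap_id)
    qed
    ultimately show ?thesis by auto
  qed
  have d: "(1::4) \<noteq> 2" "(2::4) \<noteq> 3" "(3::4) \<noteq> 4" "(1::4) \<noteq> 3" "(1::4) \<noteq> 4" "(2::4) \<noteq> 4" by simp_all
  let ?q = "\<lambda>i j k l p::4. if p = 1 then i else if p = 2 then j else if p = 3 then k else (l::4)"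
  have q: "?q j i k l = ?q i j k l \<circ> Transposition.transpose 1 2"
    "?q i k j l = ?q i j k l \<circ> Transposition.transpose 2 3"
    "?q i j l k = ?q i j k l \<circ> Transposition.transpose 3 4"
    using d by (auto simp: fun_eq_iff transpose_def forall_4)
  show "levi_civita j i k l = - levi_civita i j k l"
    unfolding levi_civita_def Let_def q(1) by (rule gen[OF d(1)])
  show "levi_civita i k j l = - levi_civita i j k l"
    unfolding levi_civita_def Let_def q(2) by (rule gen[OF d(2)])
  show "levi_civita i j l k = - levi_civita i j k l"
    unfolding levi_civita_def Let_def q(3) by (rule gen[OF d(3)])
qed

lemma levi_civita_1234: "levi_civita 1 2 3 4 = 1"
proof -
  have "(\<lambda>p::4. if p = 1 then 1 else if p = 2 then 2 else if p = 3 then 3 else 4) = id"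
    by (auto simp: fun_eq_iff forall_4)
  then show ?thesis unfolding levi_civita_def Let_def by simp
qed

text \<open>Sorting the indices changes both functions by the same sign, and both vanish on a
  repeated index, so the value at \<open>1 2 3 4\<close> decides.\<close>

lemma alternating4_eqI:
  fixes f g :: "4 \<Rightarrow> 4 \<Rightarrow> 4 \<Rightarrow> 4 \<Rightarrow> real"
  assumes "\<And>i j k l. f j i k l = - f i j k l" "\<And>i j k l. f i k j l = - f i j k l"
    "\<And>i j k l. f i j l k = - f i j k l"
    and "\<And>i j k l. g j i k l = - g i j k l" "\<And>i j k l. g i k j l = - g i j k l"
    "\<And>i j k l. g i j l k = - g i j k l"
    and "f 1 2 3 4 = g 1 2 3 4"
  shows "f i j k l = g i j k l"
proof -
  \<comment> \<open>Agreement, as a predicate, is invariant under swaps, so the simplifier can sort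
    the arguments in each of the 256 cases down to \<open>Z 1 2 3 4\<close> or to a repeated
    index.\<close>
  define Z where "Z i j k l \<longleftrightarrow> f i j k l = g i j k l" for i j k l
  have Z: "Z j i k l \<longleftrightarrow> Z i j k l" "Z i k j l \<longleftrightarrow> Z i j k l" "Z i j l k \<longleftrightarrow> Z i j k l" for i j k l
    unfolding Z_def using assms(1)[of i j k l] assms(2)[of i j k l] assms(3)[of i j k l]
      assms(4)[of i j k l] assms(5)[of i j k l] assms(6)[of i j k l] by linarith+
  have same: "Z i i k l" "Z i k k l" "Z i k l l" for i k l
    unfolding Z_def using assms(1)[of i i k l] assms(2)[of i k k l] assms(3)[of i k l l]
      assms(4)[of i i k l] assms(5)[of i k k l] assms(6)[of i k l l] by linarith+
  have "Z 1 2 3 4" using assms(7) by (simp add: Z_def)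
  then have "\<forall>i j k l. Z i j k l"
    unfolding forall_4 by (simp add: Z same)
  then show ?thesis by (simp add: Z_def)
qed

lemma levi_civita_eq_det4: "levi_civita i j k l = det4 (axis i 1) (axis j 1) (axis k 1) (axis l 1)"
proof (rule alternating4_eqI[of levi_civita "\<lambda>i j k l. det4 (axis i 1) (axis j 1) (axis k 1) (axis l 1)"])
  show "levi_civita 1 2 3 4 = det4 (axis 1 1) (axis 2 1) (axis 3 1) (axis 4 1)"
    unfolding levi_civita_1234 det4_expand by (simp add: axis_def)
qed (rule levi_civita_swap det4_swap)+

lemma levi_civita_sum:
  "(\<Sum>i\<in>UNIV. \<Sum>j\<in>UNIV. \<Sum>k\<in>UNIV. \<Sum>l\<in>UNIV. levi_civita i j k l * (a $ i * b $ j * c $ k * d $ l)) = det4 a b c d"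
proof -
  have 2: "(\<Sum>i\<in>UNIV. y $ i * det4 x (axis i 1) c d) = det4 x y c d" for x y c d
    using det4_axis_sum[of y x c d] by (simp add: det4_swap(1)[of x] sum_negf)
  have 3: "(\<Sum>i\<in>UNIV. y $ i * det4 x z (axis i 1) d) = det4 x z y d" for x y z d
    using 2[of y x z d] by (simp add: det4_swap(2)[of x z] sum_negf)
  have 4: "(\<Sum>i\<in>UNIV. y $ i * det4 x z w (axis i 1)) = det4 x z w y" for x y z w
    using 3[of y x z w] by (simp add: det4_swap(3)[of x z w] sum_negf)
  have "(\<Sum>i\<in>UNIV. \<Sum>j\<in>UNIV. \<Sum>k\<in>UNIV. \<Sum>l\<in>UNIV. levi_civita i j k l * (a $ i * b $ j * c $ k * d $ l)) =
    (\<Sum>i\<in>UNIV. a $ i * (\<Sum>j\<in>UNIV. b $ j * (\<Sum>k\<in>UNIV. c $ k * (\<Sum>l\<in>UNIV. d $ l *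
      det4 (axis i 1) (axis j 1) (axis k 1) (axis l 1)))))"
    unfolding sum_distrib_left levi_civita_eq_det4 by (intro sum.cong refl) (simp only: mult_ac)
  then show ?thesis unfolding 4 3 2 det4_axis_sum .
qed

section \<open>Sums of products of jets\<close>

definition has_moments :: "nat \<Rightarrow> point_measure \<Rightarrow> (real^4 \<Rightarrow> real) \<Rightarrow> real^4 \<Rightarrow> bool" where
  "has_moments N \<mu> f x \<longleftrightarrow> (\<forall>is. length is \<le> N \<longrightarrow> integ \<mu> (coord_prod is) = foldr pd is f x)"

lemma has_moments_exists: "smooth f \<Longrightarrow> \<exists>\<mu>. has_moments N \<mu> f x"
  unfolding has_moments_def
  by (rule moment_representation) (metis foldr_pd_mset)

text \<open>Under a product measure the integral splits into one moment for each vertex, and each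
  moment is a derivative.\<close>

lemma jet_product_value:
  assumes "\<And>v. v \<in> set vs \<Longrightarrow> has_moments N (C v) (f v) x"
    and "\<And>v. v \<in> set vs \<Longrightarrow> length (\<kappa> v) \<le> N" and "distinct vs"
  shows "multi_integ C vs (\<lambda>p. \<Prod>v\<in>set vs. coord_prod (\<kappa> v) (p v)) p0 = (\<Prod>v\<in>set vs. foldr pd (\<kappa> v) (f v) x)"
  using assms
proof (induction vs arbitrary: p0)
  case (Cons v vs)
  let ?G = "\<lambda>p. \<Prod>v\<in>set vs. coord_prod (\<kappa> v) (p v)"
  have "multi_integ C vs (\<lambda>p. coord_prod (\<kappa> v) (p v) * ?G p) (p0(v := q)) =
      coord_prod (\<kappa> v) q * (\<Prod>v\<in>set vs. foldr pd (\<kappa> v) (f v) x)" for q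
  proof -
    have "multi_integ C vs (\<lambda>p. coord_prod (\<kappa> v) (p v) * ?G p) (p0(v := q)) =
        multi_integ C vs (\<lambda>p. coord_prod (\<kappa> v) q * ?G p) (p0(v := q))"
    proof (rule multi_integ_cong)
      fix p assume "\<And>w. w \<notin> set vs \<Longrightarrow> p w = (p0(v := q)) w"
      then have "p v = q" using Cons.prems(3) by simp
      then show "coord_prod (\<kappa> v) (p v) * ?G p = coord_prod (\<kappa> v) q * ?G p" by simp
    qed
    then show ?thesis using Cons by (simp add: multi_integ_linear)
  qed
  moreover have "integ (C v) (coord_prod (\<kappa> v)) = foldr pd (\<kappa> v) (f v) x"
    using Cons.prems(1)[of v] Cons.prems(2)[of v] unfolding has_moments_def by simp
  ultimately show ?case using Cons.prems(3) by (simp add: integ_linear)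
qed simp

text \<open>Leibniz rule: differentiating the factor of vertex \<open>u\<close> adds the index
  \<open>j\<close> there, which multiplies the integrand by \<open>p u $ j\<close>. The bound on the
  orders is strict to leave room for it.\<close>

lemma jet_product_derivative:
  assumes f: "\<And>v. v \<in> set vs \<Longrightarrow> smooth (f v)"
    and mom: "\<And>v. v \<in> set vs \<Longrightarrow> has_moments N (C v) (f v) x"
    and len: "\<And>v. v \<in> set vs \<Longrightarrow> length (\<kappa> v) < N" and d: "distinct vs"
  shows "\<exists>D. ((\<lambda>x. \<Prod>v\<in>set vs. foldr pd (\<kappa> v) (f v) x) has_derivative D) (at x) \<and>
    D (axis j 1) = multi_integ C vs (\<lambda>p. (\<Prod>v\<in>set vs. coord_prod (\<kappa> v) (p v)) * (\<Sum>v\<in>set vs. p v $ j)) p0"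
proof -
  let ?D = "\<lambda>v. frechet_derivative (foldr pd (\<kappa> v) (f v)) (at x)"
  have "(foldr pd (\<kappa> v) (f v) has_derivative ?D v) (at x)" if "v \<in> set vs" for v
    using smooth_differentiable[OF smooth_foldr_pd[OF f[OF that]]] frechet_derivative_works by blast
  then have "((\<lambda>x. \<Prod>v\<in>set vs. foldr pd (\<kappa> v) (f v) x) has_derivative
      (\<lambda>y. \<Sum>u\<in>set vs. ?D u y * (\<Prod>v\<in>set vs - {u}. foldr pd (\<kappa> v) (f v) x))) (at x)"
    by (rule has_derivative_prod)
  moreover have "?D u (axis j 1) * (\<Prod>v\<in>set vs - {u}. foldr pd (\<kappa> v) (f v) x) =
      multi_integ C vs (\<lambda>p. (\<Prod>v\<in>set vs. coord_prod (\<kappa> v) (p v)) * p u $ j) p0" if u: "u \<in> set vs" for u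
  proof -
    define \<kappa>' where "\<kappa>' = \<kappa>(u := j # \<kappa> u)"
    have "?D u (axis j 1) * (\<Prod>v\<in>set vs - {u}. foldr pd (\<kappa> v) (f v) x) =
        (\<Prod>v\<in>set vs. foldr pd (\<kappa>' v) (f v) x)"
      using u by (simp add: prod.remove[of "set vs" u] \<kappa>'_def pd_def dir_deriv_def)
    also have "\<dots> = multi_integ C vs (\<lambda>p. \<Prod>v\<in>set vs. coord_prod (\<kappa>' v) (p v)) p0"
      by (rule jet_product_value[symmetric, OF mom _ d]) (use len in \<open>auto simp: \<kappa>'_def Suc_le_eq less_imp_le\<close>)
    also have "(\<lambda>p. \<Prod>v\<in>set vs. coord_prod (\<kappa>' v) (p v)) = (\<lambda>p. (\<Prod>v\<in>set vs. coord_prod (\<kappa> v) (p v)) * p u $ j)"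
      using u by (simp add: fun_eq_iff prod.remove[of "set vs" u] \<kappa>'_def mult_ac)
    finally show ?thesis .
  qed
  then have "(\<Sum>u\<in>set vs. ?D u (axis j 1) * (\<Prod>v\<in>set vs - {u}. foldr pd (\<kappa> v) (f v) x)) =
      multi_integ C vs (\<lambda>p. (\<Prod>v\<in>set vs. coord_prod (\<kappa> v) (p v)) * (\<Sum>v\<in>set vs. p v $ j)) p0"
    by (simp add: sum_distrib_left multi_integ_sum)
  ultimately show ?thesis by blast
qed

text \<open>Common interface for graphs and for the coefficients of \<open>P\<close>. The polynomial
  \<open>F\<close> is compared only where \<open>p\<close> agrees with \<open>p0\<close> off
  \<open>vs\<close>, so it may involve the vector placed at the sink.\<close>

lemma jet_sum:
  fixes c :: "'a \<Rightarrow> real"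
  assumes f: "\<And>v. v \<in> set vs \<Longrightarrow> smooth (f v)"
    and mom: "\<And>v. v \<in> set vs \<Longrightarrow> has_moments N (C v) (f v) x"
    and len: "\<And>a v. a \<in> A \<Longrightarrow> v \<in> set vs \<Longrightarrow> length (\<kappa> a v) < N" and d: "distinct vs"
    and g: "\<And>x. g x = (\<Sum>a\<in>A. c a * (\<Prod>v\<in>set vs. foldr pd (\<kappa> a v) (f v) x))"
    and F: "\<And>p. (\<And>w. w \<notin> set vs \<Longrightarrow> p w = p0 w) \<Longrightarrow> F p = (\<Sum>a\<in>A. c a * (\<Prod>v\<in>set vs. coord_prod (\<kappa> a v) (p v)))"
  shows "g x = multi_integ C vs F p0"
    and "g differentiable (at x)"
    and "pd j g x = multi_integ C vs (\<lambda>p. F p * (\<Sum>v\<in>set vs. p v $ j)) p0"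
proof -
  have F': "multi_integ C vs F p0 = multi_integ C vs (\<lambda>p. \<Sum>a\<in>A. c a * (\<Prod>v\<in>set vs. coord_prod (\<kappa> a v) (p v))) p0"
    by (rule multi_integ_cong) (rule F)
  have F'': "multi_integ C vs (\<lambda>p. F p * (\<Sum>v\<in>set vs. p v $ j)) p0 =
      multi_integ C vs (\<lambda>p. (\<Sum>a\<in>A. c a * ((\<Prod>v\<in>set vs. coord_prod (\<kappa> a v) (p v)) * (\<Sum>v\<in>set vs. p v $ j)))) p0" for j
    by (rule multi_integ_cong) (simp add: F sum_distrib_right mult.assoc)
  show "g x = multi_integ C vs F p0"
    unfolding F' g multi_integ_sum multi_integ_linear
    by (intro sum.cong refl arg_cong2[where f = "(*)"])
      (rule jet_product_value[OF mom less_imp_le[OF len] d, symmetric])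
  have "\<forall>a\<in>A. \<exists>D. ((\<lambda>x. \<Prod>v\<in>set vs. foldr pd (\<kappa> a v) (f v) x) has_derivative D) (at x) \<and>
    D (axis j 1) = multi_integ C vs (\<lambda>p. (\<Prod>v\<in>set vs. coord_prod (\<kappa> a v) (p v)) * (\<Sum>v\<in>set vs. p v $ j)) p0"
    by (intro ballI jet_product_derivative[OF f mom len d])
  from bchoice[OF this] obtain D where
    D: "\<And>a. a \<in> A \<Longrightarrow> ((\<lambda>x. \<Prod>v\<in>set vs. foldr pd (\<kappa> a v) (f v) x) has_derivative D a) (at x)"
      "\<And>a. a \<in> A \<Longrightarrow> D a (axis j 1) =
        multi_integ C vs (\<lambda>p. (\<Prod>v\<in>set vs. coord_prod (\<kappa> a v) (p v)) * (\<Sum>v\<in>set vs. p v $ j)) p0"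
    by blast
  have "((\<lambda>x. \<Sum>a\<in>A. c a * (\<Prod>v\<in>set vs. foldr pd (\<kappa> a v) (f v) x)) has_derivative
      (\<lambda>y. \<Sum>a\<in>A. c a * D a y)) (at x)"
    by (intro has_derivative_sum has_derivative_mult_right D)
  then have gD: "(g has_derivative (\<lambda>y. \<Sum>a\<in>A. c a * D a y)) (at x)"
    using g by presburger
  then show "g differentiable (at x)" by (rule differentiableI)
  show "pd j g x = multi_integ C vs (\<lambda>p. F p * (\<Sum>v\<in>set vs. p v $ j)) p0"
    unfolding pd_eqI[OF gD] F'' multi_integ_sum multi_integ_linear by (simp add: D(2))
qed

section \<open>Graphs as products of determinants\<close>

definition bracket :: "nat list \<Rightarrow> (nat \<Rightarrow> real^4) \<Rightarrow> real" where
  "bracket b p = laplace (map p b) [1, 2, 3, 4]"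

definition brackets :: "graph_code \<Rightarrow> (nat \<Rightarrow> real^4) \<Rightarrow> real" where
  "brackets \<Gamma> p = (\<Prod>b\<leftarrow>\<Gamma>. bracket b p)"

lemma bracket_det4: "bracket [a, b, c, d] p = det4 (p a) (p b) (p c) (p d)"
  by (simp add: bracket_def det4_def)

text \<open>Distributivity: a decoration of all edges is a choice of a quadruple of indices for each
  Levi-Civita vertex.\<close>

lemma prod_sum_grid:
  fixes g :: "nat \<Rightarrow> 4 \<Rightarrow> 4 \<Rightarrow> 4 \<Rightarrow> 4 \<Rightarrow> real"
  shows "(\<Sum>\<iota>\<in>({1..n} \<times> {1..4::nat}) \<rightarrow>\<^sub>E UNIV. \<Prod>k=1..n. g k (\<iota> (k, 1)) (\<iota> (k, 2)) (\<iota> (k, 3)) (\<iota> (k, 4))) =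
    (\<Prod>k=1..n. \<Sum>i\<in>UNIV. \<Sum>j\<in>UNIV. \<Sum>l\<in>UNIV. \<Sum>m\<in>UNIV. g k i j l m)"
proof -
  have S: "{1..4::nat} = {1, 2, 3, 4}" by auto
  have q4: "q = 4" if "Suc 0 \<le> q" "q \<le> 4" "q \<noteq> Suc 0" "q \<noteq> 2" "q \<noteq> 3" for q :: nat
    using that by linarith
  have "(\<Prod>k=1..n. \<Sum>i\<in>UNIV. \<Sum>j\<in>UNIV. \<Sum>l\<in>UNIV. \<Sum>m\<in>UNIV. g k i j l m) =
      (\<Prod>k=1..n. \<Sum>(i, j, l, m)\<in>UNIV. g k i j l m)"
    by (simp add: sum.cartesian_product UNIV_Times_UNIV case_prod_unfold)
  also have "\<dots> = (\<Sum>\<kappa>\<in>{1..n} \<rightarrow>\<^sub>E UNIV. \<Prod>k=1..n. (\<lambda>(i, j, l, m). g k i j l m) (\<kappa> k))"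
    by (rule prod_sum_PiE) auto
  also have "\<dots> = (\<Sum>\<iota>\<in>({1..n} \<times> {1..4::nat}) \<rightarrow>\<^sub>E UNIV. \<Prod>k=1..n. g k (\<iota> (k, 1)) (\<iota> (k, 2)) (\<iota> (k, 3)) (\<iota> (k, 4)))"
    by (rule sum.reindex_bij_witness[of _
          "\<lambda>\<iota>. \<lambda>k\<in>{1..n}. (\<iota> (k, 1::nat), \<iota> (k, 2), \<iota> (k, 3), \<iota> (k, 4))"
          "\<lambda>\<kappa>. \<lambda>(k, q)\<in>{1..n} \<times> {1..4}. (\<lambda>(i, j, l, m). if q = 1 then i else if q = 2 then j else if q = 3 then l else m) (\<kappa> k)"])
      (auto simp: S fun_eq_iff PiE_def extensional_def case_prod_unfold restrict_def intro!: prod.cong, metis q4)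
  finally show ?thesis by simp
qed

lemma set_edges_into: "set (edges_into \<Gamma> v) = {e \<in> {1..length \<Gamma>} \<times> {1..4::nat}. (\<lambda>(k, q). target \<Gamma> k q) e = v}"
  unfolding edges_into_def by auto

lemma distinct_edges_into: "distinct (edges_into \<Gamma> v)"
  unfolding edges_into_def by (simp add: distinct_product)

text \<open>Each edge enters exactly one vertex, so grouping edges by their target exhausts
  them.\<close>

lemma prod_edges_by_target:
  assumes "\<And>k q. k \<in> {1..length \<Gamma>} \<Longrightarrow> q \<in> {1..4} \<Longrightarrow> target \<Gamma> k q \<in> V" "finite V"
  shows "(\<Prod>v\<in>V. coord_prod (map \<iota> (edges_into \<Gamma> v)) (p v)) =
    (\<Prod>k=1..length \<Gamma>. \<Prod>q=1..4. p (target \<Gamma> k q) $ \<iota> (k, q))"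
proof -
  let ?E = "{1..length \<Gamma>} \<times> {1..4::nat}" and ?t = "\<lambda>(k, q). target \<Gamma> k q"
  have "coord_prod (map \<iota> (edges_into \<Gamma> v)) (p v) = (\<Prod>e\<in>{e \<in> ?E. ?t e = v}. p (?t e) $ \<iota> e)" for v
  proof -
    have "coord_prod (map \<iota> (edges_into \<Gamma> v)) (p v) = (\<Prod>e\<leftarrow>edges_into \<Gamma> v. p v $ \<iota> e)"
      by (simp add: coord_prod_def comp_def)
    also have "\<dots> = (\<Prod>e\<in>set (edges_into \<Gamma> v). p v $ \<iota> e)"
      using prod.distinct_set_conv_list[OF distinct_edges_into] by metis
    also have "\<dots> = (\<Prod>e\<in>{e \<in> ?E. ?t e = v}. p (?t e) $ \<iota> e)"
      unfolding set_edges_into by (rule prod.cong) auto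
    finally show ?thesis .
  qed
  then have "(\<Prod>v\<in>V. coord_prod (map \<iota> (edges_into \<Gamma> v)) (p v)) =
      (\<Prod>v\<in>V. \<Prod>e\<in>{e \<in> ?E. ?t e = v}. p (?t e) $ \<iota> e)" by simp
  also have "\<dots> = (\<Prod>e\<in>?E. p (?t e) $ \<iota> e)"
    by (rule prod.group) (use assms in auto)
  also have "\<dots> = (\<Prod>k=1..length \<Gamma>. \<Prod>q=1..4. p (target \<Gamma> k q) $ \<iota> (k, q))"
    by (simp add: prod.cartesian_product case_prod_unfold)
  finally show ?thesis .
qed

lemma brackets_eq_sum:
  assumes "\<And>b. b \<in> set \<Gamma> \<Longrightarrow> length b = 4"
  shows "brackets \<Gamma> p = (\<Sum>\<iota>\<in>({1..length \<Gamma>} \<times> {1..4::nat}) \<rightarrow>\<^sub>E UNIV.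
     (\<Prod>k=1..length \<Gamma>. levi_civita (\<iota> (k, 1)) (\<iota> (k, 2)) (\<iota> (k, 3)) (\<iota> (k, 4))) *
     (\<Prod>k=1..length \<Gamma>. \<Prod>q=1..4. p (target \<Gamma> k q) $ \<iota> (k, q)))"
proof -
  have "{1..4::nat} = {1, 2, 3, 4}" by auto
  then have P4: "(\<Prod>q=1..4. h q) = h 1 * h 2 * h 3 * h 4" for h :: "nat \<Rightarrow> real"
    by (simp add: mult.assoc)
  have row: "bracket (\<Gamma> ! k) p = (\<Sum>i\<in>UNIV. \<Sum>j\<in>UNIV. \<Sum>l\<in>UNIV. \<Sum>m\<in>UNIV. levi_civita i j l m *
     (p (target \<Gamma> (Suc k) 1) $ i * p (target \<Gamma> (Suc k) 2) $ j * p (target \<Gamma> (Suc k) 3) $ l * p (target \<Gamma> (Suc k) 4) $ m))"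
    if "k < length \<Gamma>" for k
  proof -
    have "length (\<Gamma> ! k) = 4" using that assms by simp
    then obtain a b c d where "\<Gamma> ! k = [a, b, c, d]"
      by (auto simp: length_Suc_conv eval_nat_numeral)
    then show ?thesis by (simp add: levi_civita_sum bracket_det4 target_def)
  qed
  have "brackets \<Gamma> p = (\<Prod>k<length \<Gamma>. bracket (\<Gamma> ! k) p)"
    unfolding brackets_def by (simp add: prod.list_conv_set_nth lessThan_atLeast0)
  also have "\<dots> = (\<Prod>k=1..length \<Gamma>. \<Sum>i\<in>UNIV. \<Sum>j\<in>UNIV. \<Sum>l\<in>UNIV. \<Sum>m\<in>UNIV. levi_civita i j l m *
     (p (target \<Gamma> k 1) $ i * p (target \<Gamma> k 2) $ j * p (target \<Gamma> k 3) $ l * p (target \<Gamma> k 4) $ m))"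
    by (rule prod.reindex_bij_witness[of _ "\<lambda>k. k - 1" Suc]) (auto simp: row)
  also have "\<dots> = (\<Sum>\<iota>\<in>({1..length \<Gamma>} \<times> {1..4::nat}) \<rightarrow>\<^sub>E UNIV. \<Prod>k=1..length \<Gamma>.
     levi_civita (\<iota> (k, 1)) (\<iota> (k, 2)) (\<iota> (k, 3)) (\<iota> (k, 4)) *
     (p (target \<Gamma> k 1) $ \<iota> (k, 1) * p (target \<Gamma> k 2) $ \<iota> (k, 2) * p (target \<Gamma> k 3) $ \<iota> (k, 3) * p (target \<Gamma> k 4) $ \<iota> (k, 4)))"
    by (rule prod_sum_grid[symmetric])
  finally show ?thesis unfolding P4 by (simp only: prod.distrib)
qed

definition well_formed :: "graph_code \<Rightarrow> bool" where
  "well_formed \<Gamma> \<longleftrightarrow> (\<forall>b\<in>set \<Gamma>. length b = 4 \<and> set b \<subseteq> {0..3 * length \<Gamma>})"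

lemma well_formed_target:
  assumes "well_formed \<Gamma>" "k \<in> {1..length \<Gamma>}" "q \<in> {1..4}"
  shows "target \<Gamma> k q \<in> {0..3 * length \<Gamma>}"
proof -
  have "\<Gamma> ! (k - 1) \<in> set \<Gamma>" using assms(2) by (intro nth_mem) auto
  then have "length (\<Gamma> ! (k - 1)) = 4" "set (\<Gamma> ! (k - 1)) \<subseteq> {0..3 * length \<Gamma>}"
    using assms(1) by (auto simp: well_formed_def)
  moreover from this(1) have "\<Gamma> ! (k - 1) ! (q - 1) \<in> set (\<Gamma> ! (k - 1))"
    using assms(3) by (intro nth_mem) auto
  ultimately show ?thesis unfolding target_def by blast
qed

lemma length_edges_into: "length (edges_into \<Gamma> v) \<le> length \<Gamma> * 4"
  unfolding edges_into_def by (rule order_trans[OF length_filter_le]) auto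

text \<open>The assumption \<open>sink\<close> selects the component \<open>I\<close>: the factor in
  the anticommuting variables must equal the monomial of the vector \<open>p0 0\<close> at the sink.
  That vector is a coordinate vector for a vector field, and the monomial is an empty product when
  there is no sink.\<close>

lemma phi_brackets:
  assumes \<Gamma>: "well_formed \<Gamma>" and N: "length \<Gamma> * 4 < N"
    and smooth: "smooth \<rho>" "smooth a1" "smooth a2"
    and mom: "\<And>v. v \<in> {1..3 * length \<Gamma>} \<Longrightarrow> has_moments N (C v) (vertex_content (length \<Gamma>) \<rho> a1 a2 v) x"
    and sink: "\<And>\<iota> (y :: real^4). sf_prod_list (map (\<lambda>e. xi (\<iota> e)) (edges_into \<Gamma> 0)) I y = coord_prod (map \<iota> (edges_into \<Gamma> 0)) (p0 0)"
  shows "phi \<Gamma> \<rho> a1 a2 I x = multi_integ C [1..<3 * length \<Gamma> + 1] (brackets \<Gamma>) p0"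
    and "phi \<Gamma> \<rho> a1 a2 I differentiable (at x)"
    and "pd j (phi \<Gamma> \<rho> a1 a2 I) x =
      multi_integ C [1..<3 * length \<Gamma> + 1] (\<lambda>p. brackets \<Gamma> p * (\<Sum>v\<in>{1..3 * length \<Gamma>}. p v $ j)) p0"
proof -
  define n where "n = length \<Gamma>"
  have vs: "set [1..<3 * n + 1] = {1..3 * n}" by auto
  define c where "c \<iota> = (\<Prod>k=1..n. levi_civita (\<iota> (k, 1)) (\<iota> (k, 2)) (\<iota> (k, 3)) (\<iota> (k, 4))) *
     coord_prod (map \<iota> (edges_into \<Gamma> 0)) (p0 0)" for \<iota> :: "nat \<times> nat \<Rightarrow> 4"
  define A where "A = (({1..n} \<times> {1..4::nat}) \<rightarrow>\<^sub>E (UNIV :: 4 set))"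
  have phi: "phi \<Gamma> \<rho> a1 a2 I x = (\<Sum>\<iota>\<in>A. c \<iota> * (\<Prod>v\<in>set [1..<3 * n + 1].
      foldr pd (map \<iota> (edges_into \<Gamma> v)) (vertex_content n \<rho> a1 a2 v) x))" for x
    unfolding phi_def Let_def sink c_def A_def n_def vs[unfolded n_def] by (rule sum.cong) (simp_all only: mult_ac)
  have br: "brackets \<Gamma> p = (\<Sum>\<iota>\<in>A. c \<iota> * (\<Prod>v\<in>set [1..<3 * n + 1]. coord_prod (map \<iota> (edges_into \<Gamma> v)) (p v)))"
    if "\<And>w. w \<notin> set [1..<3 * n + 1] \<Longrightarrow> p w = p0 w" for p
  proof -
    have p0: "p 0 = p0 0" by (rule that) simp
    \<comment> \<open>The sink joins the vertices \<open>1..3n\<close> as a target, with the fixed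
      vector \<open>p0 0\<close> in place of an integration variable.\<close>
    have all: "{0..3 * n} = insert 0 {1..3 * n}" by auto
    have eq: "coord_prod (map \<iota> (edges_into \<Gamma> 0)) (p0 0) * (\<Prod>v\<in>{1..3 * n}. coord_prod (map \<iota> (edges_into \<Gamma> v)) (p v))
        = (\<Prod>k=1..n. \<Prod>q=1..4. p (target \<Gamma> k q) $ \<iota> (k, q))" for \<iota>
    proof -
      have "(\<Prod>v\<in>{0..3 * n}. coord_prod (map \<iota> (edges_into \<Gamma> v)) (p v))
          = (\<Prod>k=1..length \<Gamma>. \<Prod>q=1..4. p (target \<Gamma> k q) $ \<iota> (k, q))"
        by (rule prod_edges_by_target) (use well_formed_target[OF \<Gamma>] in \<open>auto simp: n_def\<close>)
      then show ?thesis by (simp add: all p0[symmetric] n_def[symmetric] del: One_nat_def)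
    qed
    have len4: "\<And>b. b \<in> set \<Gamma> \<Longrightarrow> length b = 4" using \<Gamma> by (simp add: well_formed_def)
    show ?thesis
      unfolding vs c_def mult.assoc A_def eq using brackets_eq_sum[OF len4, where p = p] unfolding n_def by simp
  qed
  have sm: "smooth (vertex_content n \<rho> a1 a2 v)" for v
    using smooth by (simp add: vertex_content_def)
  have mom': "has_moments N (C v) (vertex_content n \<rho> a1 a2 v) x" if "v \<in> set [1..<3 * n + 1]" for v
    using mom[of v] that by (auto simp: n_def)
  have len: "length (map \<iota> (edges_into \<Gamma> v)) < N" for \<iota> :: "nat \<times> nat \<Rightarrow> 4" and v
    using length_edges_into[of \<Gamma> v] N by simp
  note J = jet_sum[OF sm mom' len distinct_upt phi br]
  show "phi \<Gamma> \<rho> a1 a2 I x = multi_integ C [1..<3 * length \<Gamma> + 1] (brackets \<Gamma>) p0"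
    using J(1) unfolding n_def by blast
  show "phi \<Gamma> \<rho> a1 a2 I differentiable (at x)"
    using J(2) by blast
  show "pd j (phi \<Gamma> \<rho> a1 a2 I) x =
      multi_integ C [1..<3 * length \<Gamma> + 1] (\<lambda>p. brackets \<Gamma> p * (\<Sum>v\<in>{1..3 * length \<Gamma>}. p v $ j)) p0"
    using J(3) unfolding vs unfolding n_def by blast
qed

section \<open>Superfunctions of low degree\<close>

lemma sf_mult_degree_zero:
  fixes F G :: "'p superfun"
  assumes "\<And>J. J \<noteq> {} \<Longrightarrow> G J x = 0"
  shows "sf_mult F G I x = F I x * G {} x"
proof -
  have "sf_mult F G I x = (\<Sum>J\<in>Pow I. if J = I then F I x * G {} x else 0)"
    unfolding sf_mult_def
  proof (rule sum.cong)
    fix J assume J: "J \<in> Pow I"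
    show "(-1) ^ card {(j, k). j \<in> J \<and> k \<in> I - J \<and> k < j} * F J x * G (I - J) x
      = (if J = I then F I x * G {} x else 0)"
    proof (cases "J = I")
      case True
      have "{(j, k). j \<in> I \<and> k \<in> I - I \<and> k < j} = {}" by auto
      then show ?thesis by (simp only: True) simp
    next
      case False
      then have "I - J \<noteq> {}" using J by blast
      then show ?thesis using False assms by simp
    qed
  qed simp
  then show ?thesis by simp
qed

lemma sf_mult_one: "sf_mult F (sf_monomial {}) I x = F I x"
  by (subst sf_mult_degree_zero) (simp_all add: sf_monomial_def)

lemma sf_prod_list_simps:
  "sf_prod_list [] I x = (if I = {} then 1 else 0)"
  "sf_prod_list [xi i] I x = (if I = {i} then 1 else 0)"
  unfolding sf_prod_list_def list.map foldr.simps o_apply id_apply sf_mult_one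
  by (simp_all add: sf_monomial_def)

lemma sf_mult_xi_xi:
  "sf_mult (xi i) (xi j) I x = (if i \<noteq> j \<and> I = {i, j} then (if j < i then - 1 else 1) else 0)"
proof -
  have "sf_mult (xi i) (xi j) I x = (\<Sum>J\<in>Pow I. if J = {i} then
      (if i \<noteq> j \<and> I = {i, j} then (if j < i then - 1 else 1) else 0) else 0)"
    unfolding sf_mult_def
  proof (rule sum.cong)
    fix J assume J: "J \<in> Pow I"
    show "(-1) ^ card {(k, l). k \<in> J \<and> l \<in> I - J \<and> l < k} * xi i J x * xi j (I - J) x =
      (if J = {i} then (if i \<noteq> j \<and> I = {i, j} then (if j < i then - 1 else 1) else 0) else 0)"
    proof (cases "J = {i} \<and> I - J = {j}")
      case True
      then have ij: "I = {i, j}" "i \<noteq> j" using J by blast+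
      have c: "{(k, l). k \<in> {i} \<and> l \<in> {j} \<and> l < k} = (if j < i then {(i, j)} else {})" by auto
      show ?thesis
        unfolding conjunct2[OF True] unfolding conjunct1[OF True] c using ij by (simp add: sf_monomial_def)
    next
      case False
      show ?thesis
      proof (cases "J = {i}")
        case True
        then have "xi j (I - J) x = 0" using False by (simp add: sf_monomial_def)
        moreover have n: "(i \<noteq> j \<and> I = {i, j}) = False" unfolding eq_False
        proof
          assume "i \<noteq> j \<and> I = {i, j}"
          then have "I - J = {j}" using True by blast
          then show False using False True by blast
        qed
        ultimately show ?thesis unfolding n if_False by simp
      qed (simp add: sf_monomial_def)
    qed
  qed simp
  also have "\<dots> = (if {i} \<in> Pow I then if i \<noteq> j \<and> I = {i, j} then if j < i then - 1 else 1 else 0 else 0)"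
    by (rule sum.delta) simp
  also have "\<dots> = (if i \<noteq> j \<and> I = {i, j} then (if j < i then - 1 else 1) else 0)"
    by simp
  finally show ?thesis .
qed

lemma nambu_coeff_skew: "nambu_coeff \<rho> a1 a2 j i x = - nambu_coeff \<rho> a1 a2 i j x"
  unfolding nambu_coeff_def levi_civita_swap(1)[where i = i and j = j] by (simp add: sum_negf)

lemma nambu_coeff_diag: "nambu_coeff \<rho> a1 a2 i i x = 0"
  using nambu_coeff_skew[of \<rho> a1 a2 i i x] by simp

lemma nambu_eq:
  "nambu \<rho> a1 a2 I x = 1 / 2 * (\<Sum>i\<in>UNIV. \<Sum>j\<in>UNIV. if i \<noteq> j \<and> I = {i, j}
     then nambu_coeff \<rho> a1 a2 i j x * (if j < i then - 1 else 1) else 0)"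
  unfolding nambu_def sf_mult_xi_xi by (intro arg_cong2[where f = "(*)"] sum.cong refl) simp

text \<open>The monomial occurs twice in the double sum, from \<open>(a, b)\<close> and from
  \<open>(b, a)\<close>, with equal contributions; this cancels the factor
  \<open>1 / 2\<close>.\<close>

lemma nambu_pair:
  assumes "a \<noteq> b"
  shows "nambu \<rho> a1 a2 {a, b} x = (if a < b then 1 else - 1) * nambu_coeff \<rho> a1 a2 a b x"
proof -
  have delta2: "(\<Sum>i\<in>UNIV. \<Sum>j\<in>UNIV. if i = a then if j = b then c else 0 else 0) = c" for a b :: 4 and c :: real
  proof -
    have "(\<Sum>j\<in>UNIV. if i = a then if j = b then c else 0 else 0) = (if i = a then c else 0)" for i
      by (cases "i = a") simp_all
    then show ?thesis by simp
  qed
  have "(\<Sum>i\<in>UNIV. \<Sum>j\<in>UNIV. if i \<noteq> j \<and> {a, b} = {i, j}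
     then nambu_coeff \<rho> a1 a2 i j x * (if j < i then - 1 else 1) else 0) =
    (\<Sum>i\<in>UNIV. \<Sum>j\<in>UNIV. (if i = a then if j = b then (if a < b then 1 else - 1) * nambu_coeff \<rho> a1 a2 a b x else 0 else 0)
      + (if i = b then if j = a then (if a < b then 1 else - 1) * nambu_coeff \<rho> a1 a2 a b x else 0 else 0))"
    by (intro sum.cong refl)
      (use assms nambu_coeff_skew[of \<rho> a1 a2 a b x] in \<open>auto simp: doubleton_eq_iff\<close>)
  also have "\<dots> = 2 * ((if a < b then 1 else - 1) * nambu_coeff \<rho> a1 a2 a b x)"
    unfolding sum.distrib delta2 by simp
  finally show ?thesis unfolding nambu_eq by simp
qed

lemma nambu_other:
  assumes "\<And>a b. a \<noteq> b \<Longrightarrow> I \<noteq> {a, b}"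
  shows "nambu \<rho> a1 a2 I x = 0"
proof -
  have F: "(i \<noteq> j \<and> I = {i, j}) = False" for i j using assms[of i j] by blast
  show ?thesis unfolding nambu_eq F if_False by simp
qed

lemma sf_mult_pair:
  assumes "a < b"
  shows "sf_mult F G {a, b} x =
    F {} x * G {a, b} x + F {a} x * G {b} x - F {b} x * G {a} x + F {a, b} x * G {} x"
proof -
  have ab: "a \<noteq> b" using assms by simp
  have P: "Pow {a, b} = {{}, {a}, {b}, {a, b}}" by auto
  have d: "{} \<noteq> {a}" "{} \<noteq> {b}" "{} \<noteq> {a, b}" "{a} \<noteq> {b}" "{a} \<noteq> {a, b}" "{b} \<noteq> {a, b}"
    using ab by auto
  have 1: "{(j, k). j \<in> {a} \<and> k \<in> {a, b} - {a} \<and> k < j} = {}" using assms by auto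
  have 2: "{(j, k). j \<in> {b} \<and> k \<in> {a, b} - {b} \<and> k < j} = {(b, a)}" using assms by auto
  have 3: "{(j, k). j \<in> {a, b} \<and> k \<in> {a, b} - {a, b} \<and> k < j} = {}"
    "{(j, k). j \<in> {} \<and> k \<in> {a, b} - {} \<and> k < j} = {}" by auto
  have 4: "{a, b} - {a} = {b}" "{a, b} - {b} = {a}" using ab by auto
  have S: "(\<Sum>J\<in>{{}, {a}, {b}, {a, b}}. f J) = f {} + f {a} + f {b} + f {a, b}" for f :: "4 set \<Rightarrow> real"
    using d by (simp add: add.assoc)
  show ?thesis unfolding sf_mult_def P S 1 2 3 by (simp add: 4)
qed

text \<open>The right derivative strips \<open>\<xi>_i\<close> from the right end of
  \<open>P\<close> and leaves \<open>P^{ji}\<close> on \<open>\<xi>_j\<close>; the second term of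
  the bracket vanishes because a function has no derivative in the anticommuting variables.\<close>

lemma schouten_nambu_function:
  assumes "\<And>J. J \<noteq> {} \<Longrightarrow> H J = (\<lambda>x. 0)"
  shows "schouten (nambu \<rho> a1 a2) H {j} x = (\<Sum>i\<in>UNIV. nambu_coeff \<rho> a1 a2 j i x * pd i (H {}) x)"
    and "(\<And>j. I \<noteq> {j}) \<Longrightarrow> schouten (nambu \<rho> a1 a2) H I x = 0"
proof -
  have H0: "H J y = 0" if "J \<noteq> {}" for J y using assms[OF that] by simp
  have pd0: "pd i (\<lambda>x. 0) x = 0" for i x
    using pd_eqI[of "\<lambda>x. 0" "\<lambda>h. 0" x i] by simp
  have xH: "xi_deriv i H J y = 0" for i J y unfolding xi_deriv_def using H0 by simp
  have dH: "x_deriv i H J y = 0" if "J \<noteq> {}" for i J y unfolding x_deriv_def assms[OF that] by (rule pd0)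
  have rP: "xi_rderiv i (nambu \<rho> a1 a2) {j} x = nambu_coeff \<rho> a1 a2 j i x" for i j x
  proof (cases "i = j")
    case False
    have "{k \<in> {j}. i < k} = (if i < j then {j} else {})" by auto
    then show ?thesis using False nambu_coeff_skew[of \<rho> a1 a2 j i x]
      by (simp add: xi_rderiv_def nambu_pair)
  qed (simp add: xi_rderiv_def nambu_coeff_diag)
  have r0: "xi_rderiv i (nambu \<rho> a1 a2) J x = 0" if "\<And>j. J \<noteq> {j}" for i J x
  proof (cases "i \<in> J")
    case False
    have "insert i J \<noteq> {a, b}" if "a \<noteq> b" for a b
    proof
      assume eq: "insert i J = {a, b}"
      then have "J = {a, b} - {i}" using False by auto
      moreover have "i = a \<or> i = b" using eq by auto
      ultimately have "J = {b} \<or> J = {a}" using \<open>a \<noteq> b\<close> by auto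
      then show False using \<open>\<And>j. J \<noteq> {j}\<close> by auto
    qed
    then show ?thesis using False by (simp add: xi_rderiv_def nambu_other)
  qed (simp add: xi_rderiv_def)
  have 1: "sf_mult F (x_deriv i H) I x = F I x * x_deriv i H {} x" for F i I x
    by (rule sf_mult_degree_zero) (rule dH)
  have 2: "sf_mult F (xi_deriv i H) I x = 0" for F i I x
    by (subst sf_mult_degree_zero) (simp_all add: xH)
  have *: "schouten (nambu \<rho> a1 a2) H I x =
      (\<Sum>i\<in>UNIV. xi_rderiv i (nambu \<rho> a1 a2) I x * pd i (H {}) x)" for I
    unfolding schouten_def 1 2 by (simp add: x_deriv_def)
  show "schouten (nambu \<rho> a1 a2) H {j} x = (\<Sum>i\<in>UNIV. nambu_coeff \<rho> a1 a2 j i x * pd i (H {}) x)"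
    unfolding * rP ..
  show "schouten (nambu \<rho> a1 a2) H I x = 0" if "\<And>j. I \<noteq> {j}"
    unfolding * r0[OF that] by simp
qed

text \<open>In degree two, the first half of the bracket is a product of two vectors, which gives
  the derivatives of \<open>X\<close> in both orders of \<open>a\<close> and \<open>b\<close>; the
  second half is a bivector times a function, which gives the derivative of \<open>P\<close> along
  \<open>X\<close>.\<close>

lemma schouten_nambu_vector:
  assumes X: "\<And>J. (\<And>j. J \<noteq> {j}) \<Longrightarrow> X J = (\<lambda>x. 0)" and ab: "a < b"
  shows "schouten (nambu \<rho> a1 a2) X {a, b} x =
    (\<Sum>i\<in>UNIV. nambu_coeff \<rho> a1 a2 a i x * pd i (X {b}) x - nambu_coeff \<rho> a1 a2 b i x * pd i (X {a}) x
      - X {i} x * pd i (nambu_coeff \<rho> a1 a2 a b) x)"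
proof -
  have pd0: "pd i (\<lambda>x. 0) x = 0" for i x
    using pd_eqI[of "\<lambda>x. 0" "\<lambda>h. 0" x i] by simp
  have e: "{} \<noteq> {j}" "a \<noteq> b \<Longrightarrow> {a, b} \<noteq> {j}" for j :: 4 by auto
  have X0: "X {} = (\<lambda>x. 0)" "X {a, b} = (\<lambda>x. 0)" using X e ab by (auto simp: order.strict_iff_order)
  have rP: "xi_rderiv i (nambu \<rho> a1 a2) {j} x = nambu_coeff \<rho> a1 a2 j i x" for i j x
  proof (cases "i = j")
    case False
    have "{k \<in> {j}. i < k} = (if i < j then {j} else {})" by auto
    then show ?thesis using False nambu_coeff_skew[of \<rho> a1 a2 j i x]
      by (simp add: xi_rderiv_def nambu_pair)
  qed (simp add: xi_rderiv_def nambu_coeff_diag)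
  have P0: "nambu \<rho> a1 a2 {j} = (\<lambda>x. 0)" "nambu \<rho> a1 a2 {} = (\<lambda>x. 0)" for j
    by (auto simp: fun_eq_iff intro!: nambu_other)
  have Pab: "nambu \<rho> a1 a2 {a, b} = nambu_coeff \<rho> a1 a2 a b"
    using ab by (auto simp: fun_eq_iff nambu_pair)
  have 1: "sf_mult (xi_rderiv i (nambu \<rho> a1 a2)) (x_deriv i X) {a, b} x =
      nambu_coeff \<rho> a1 a2 a i x * pd i (X {b}) x - nambu_coeff \<rho> a1 a2 b i x * pd i (X {a}) x" for i
    unfolding sf_mult_pair[OF ab] x_deriv_def X0 pd0 rP by simp
  have xX: "xi_deriv i X {} x = X {i} x" for i x by (simp add: xi_deriv_def)
  have 2: "sf_mult (x_deriv i (nambu \<rho> a1 a2)) (xi_deriv i X) {a, b} x =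
      X {i} x * pd i (nambu_coeff \<rho> a1 a2 a b) x" for i
    unfolding sf_mult_pair[OF ab] x_deriv_def P0 Pab pd0 xX by simp
  show ?thesis unfolding schouten_def 1 2 ..
qed

lemma schouten_sum:
  assumes "\<And>k I. k \<in> K \<Longrightarrow> Y k I differentiable (at x)" "finite K"
    and X: "X = (\<lambda>I x. \<Sum>k\<in>K. c k * Y k I x)"
  shows "schouten F X I x = (\<Sum>k\<in>K. c k * schouten F (Y k) I x)"
proof -
  have pdX: "pd i (X J) x = (\<Sum>k\<in>K. c k * pd i (Y k J) x)" for i J
  proof -
    have "(Y k J has_derivative frechet_derivative (Y k J) (at x)) (at x)" if "k \<in> K" for k
      using assms(1)[OF that] frechet_derivative_works by blast
    then have "((\<lambda>x. \<Sum>k\<in>K. c k * Y k J x) has_derivative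
        (\<lambda>h. \<Sum>k\<in>K. c k * frechet_derivative (Y k J) (at x) h)) (at x)"
      by (intro has_derivative_sum has_derivative_mult_right)
    from pd_eqI[OF this] show ?thesis unfolding X by (simp add: pd_def dir_deriv_def)
  qed
  have m: "sf_mult F G I x = (\<Sum>k\<in>K. c k * sf_mult F (G' k) I x)"
    if "\<And>J. G J x = (\<Sum>k\<in>K. c k * G' k J x)" for F G :: multivector and G' and I
    unfolding sf_mult_def that
    by (simp add: sum_distrib_left) (subst sum.swap, simp only: mult_ac)
  have 1: "sf_mult (xi_rderiv i F) (x_deriv i X) I x = (\<Sum>k\<in>K. c k * sf_mult (xi_rderiv i F) (x_deriv i (Y k)) I x)" for i
    by (rule m) (simp add: x_deriv_def pdX)
  have 2: "sf_mult (x_deriv i F) (xi_deriv i X) I x = (\<Sum>k\<in>K. c k * sf_mult (x_deriv i F) (xi_deriv i (Y k)) I x)" for i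
    by (rule m) (simp add: xi_deriv_def X sum_distrib_left sum_distrib_right mult_ac)
  show ?thesis unfolding schouten_def 1 2
    by (simp only: sum_subtractf sum_distrib_left right_diff_distrib)
      (subst (1 2) sum.swap, rule refl)
qed

section \<open>Schouten brackets as products of determinants\<close>

lemma det4_axis_sums:
  "(\<Sum>i\<in>UNIV. y $ i * det4 b (axis i 1) c d) = det4 b y c d"
  "(\<Sum>i\<in>UNIV. y $ i * det4 b c (axis i 1) d) = det4 b c y d"
  "(\<Sum>i\<in>UNIV. y $ i * det4 b c d (axis i 1)) = det4 b c d y"
proof -
  show 1: "(\<Sum>i\<in>UNIV. y $ i * det4 b (axis i 1) c d) = det4 b y c d" for b c d
    using det4_axis_sum[of y b c d] by (simp add: det4_swap(1)[of b] sum_negf)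
  show 2: "(\<Sum>i\<in>UNIV. y $ i * det4 b c (axis i 1) d) = det4 b c y d" for b c d
    using 1[of b c d] by (simp add: det4_swap(2)[of b c] sum_negf)
  show "(\<Sum>i\<in>UNIV. y $ i * det4 b c d (axis i 1)) = det4 b c d y"
    using 2[of b c d] by (simp add: det4_swap(3)[of b c d] sum_negf)
qed

text \<open>Two slots of the determinant hold coordinate vectors, the other two the Casimir vertices
  \<open>v\<close> and \<open>w\<close>. The vertex \<open>u\<close> of \<open>\<rho>\<close>
  receives no edge and enters only through its total mass until a derivative hits it.\<close>

lemma nambu_coeff_jets:
  assumes smooth: "smooth \<rho>" "smooth a1" "smooth a2" and d: "distinct [u, v, w]" and N: "N > 1"
    and mom: "has_moments N (C u) \<rho> x" "has_moments N (C v) a1 x" "has_moments N (C w) a2 x"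
  shows "nambu_coeff \<rho> a1 a2 a i x = multi_integ C [u, v, w] (\<lambda>p. det4 (axis a 1) (axis i 1) (p v) (p w)) p0"
    and "pd j (nambu_coeff \<rho> a1 a2 a i) x = multi_integ C [u, v, w]
      (\<lambda>p. det4 (axis a 1) (axis i 1) (p v) (p w) * (\<Sum>z\<in>{u, v, w}. p z $ j)) p0"
proof -
  define f where "f z = (if z = u then \<rho> else if z = v then a1 else a2)" for z
  define \<kappa> :: "4 \<times> 4 \<Rightarrow> nat \<Rightarrow> 4 list" where
    "\<kappa> kl z = (if z = v then [fst kl] else if z = w then [snd kl] else [])" for kl z
  have uvw: "u \<noteq> v" "u \<noteq> w" "v \<noteq> w" using d by auto
  have sm: "smooth (f z)" for z using smooth by (simp add: f_def)
  have m: "has_moments N (C z) (f z) x" if "z \<in> set [u, v, w]" for z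
    using that mom uvw by (auto simp: f_def)
  have len: "length (\<kappa> kl z) < N" for kl z using N by (simp add: \<kappa>_def)
  have g: "nambu_coeff \<rho> a1 a2 a i x = (\<Sum>kl\<in>UNIV. levi_civita a i (fst kl) (snd kl) *
      (\<Prod>z\<in>set [u, v, w]. foldr pd (\<kappa> kl z) (f z) x))" for x
    using uvw by (simp add: nambu_coeff_def UNIV_Times_UNIV[symmetric] f_def \<kappa>_def
        sum.cartesian_product case_prod_unfold mult_ac del: UNIV_Times_UNIV)
  have F: "det4 (axis a 1) (axis i 1) (p v) (p w) = (\<Sum>kl\<in>UNIV. levi_civita a i (fst kl) (snd kl) *
      (\<Prod>z\<in>set [u, v, w]. coord_prod (\<kappa> kl z) (p z)))" for p
  proof -
    have "det4 (axis a 1) (axis i 1) (p v) (p w) =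
        (\<Sum>k\<in>UNIV. p v $ k * (\<Sum>l\<in>UNIV. p w $ l * levi_civita a i k l))"
      unfolding levi_civita_eq_det4 det4_axis_sums ..
    also have "\<dots> = (\<Sum>kl\<in>UNIV. p v $ fst kl * (p w $ snd kl * levi_civita a i (fst kl) (snd kl)))"
      by (simp add: sum_distrib_left UNIV_Times_UNIV[symmetric] sum.cartesian_product case_prod_unfold
          del: UNIV_Times_UNIV)
    finally show ?thesis using uvw by (simp add: \<kappa>_def mult_ac)
  qed
  note J = jet_sum[OF sm m len d g F]
  show "nambu_coeff \<rho> a1 a2 a i x = multi_integ C [u, v, w] (\<lambda>p. det4 (axis a 1) (axis i 1) (p v) (p w)) p0"
    by (rule J(1))
  show "pd j (nambu_coeff \<rho> a1 a2 a i) x = multi_integ C [u, v, w]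
      (\<lambda>p. det4 (axis a 1) (axis i 1) (p v) (p w) * (\<Sum>z\<in>{u, v, w}. p z $ j)) p0"
    using J(3) by simp
qed

lemma brackets_relabel: "brackets (map (map m) \<Gamma>) p = brackets \<Gamma> (p \<circ> m)"
  by (simp add: brackets_def bracket_def comp_def)

lemma brackets_Cons: "brackets (b # \<Gamma>) p = bracket b p * brackets \<Gamma> p"
  by (simp add: brackets_def)

lemma brackets_cong: "(\<And>b v. b \<in> set \<Gamma> \<Longrightarrow> v \<in> set b \<Longrightarrow> p v = q v) \<Longrightarrow> brackets \<Gamma> p = brackets \<Gamma> q"
  unfolding brackets_def bracket_def
  by (intro arg_cong[where f = prod_list] map_cong refl arg_cong[where f = "\<lambda>xs. laplace xs _"]) blast

text \<open>A free datatype for the four indices: in the certified computations, equality of indices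
  is then decided by constructors.\<close>

datatype ix = I1 | I2 | I3 | I4

fun coord_of :: "ix \<Rightarrow> 4" where
  "coord_of I1 = 1" | "coord_of I2 = 2" | "coord_of I3 = 3" | "coord_of I4 = 4"

text \<open>A bivector component has two free indices; \<open>Fixed\<close> marks the slots that
  carry their coordinate vectors.\<close>

datatype slot = Fixed ix | Vertex nat

fun slot_vec :: "(nat \<Rightarrow> real^4) \<Rightarrow> slot \<Rightarrow> real^4" where
  "slot_vec p (Fixed k) = axis (coord_of k) 1"
| "slot_vec p (Vertex v) = p v"

definition slot_brackets :: "slot list list \<Rightarrow> (nat \<Rightarrow> real^4) \<Rightarrow> real" where
  "slot_brackets g p = (\<Prod>b\<leftarrow>g. laplace (map (slot_vec p) b) [1, 2, 3, 4])"

definition fill_sink :: "slot \<Rightarrow> graph_code \<Rightarrow> slot list list" where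
  "fill_sink t \<Gamma> = map (map (\<lambda>v. if v = 0 then t else Vertex v)) \<Gamma>"

lemma slot_brackets_fill_sink:
  "slot_brackets (fill_sink t \<Gamma>) p = brackets \<Gamma> (p(0 := slot_vec p t))"
proof -
  have "(\<lambda>v. slot_vec p (if v = 0 then t else Vertex v)) = p(0 := slot_vec p t)"
    by (auto simp: fun_eq_iff)
  then show ?thesis
    by (simp add: slot_brackets_def fill_sink_def brackets_def bracket_def comp_def)
qed

lemma slot_brackets_Cons:
  "slot_brackets ([s, t, u, w] # g) p =
    det4 (slot_vec p s) (slot_vec p t) (slot_vec p u) (slot_vec p w) * slot_brackets g p"
  by (simp add: slot_brackets_def det4_def)

text \<open>The first row starts with the only edge to the sink. Casimir vertices are not tied to a
  Levi-Civita vertex: exchange relations lead out of the class of micro-graphs, and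
  \<open>phi\<close> makes sense for the larger class.\<close>

definition field_graph :: "graph_code \<Rightarrow> bool" where
  "field_graph \<Gamma> \<longleftrightarrow> (\<exists>b c d r s. \<Gamma> = [[0, b, c, d], r, s] \<and> length r = 4 \<and> length s = 4 \<and>
     set ([b, c, d] @ r @ s) \<subseteq> {1..9})"

lemma field_graph_props:
  assumes "field_graph \<Gamma>"
  shows "length \<Gamma> = 3" "well_formed \<Gamma>" "edges_into \<Gamma> 0 = [(1, 1)]"
proof -
  obtain b c d r s where \<Gamma>: "\<Gamma> = [[0, b, c, d], r, s]" "length r = 4" "length s = 4"
    and sub: "set ([b, c, d] @ r @ s) \<subseteq> {1..9}"
    using assms unfolding field_graph_def by blast
  obtain r1 r2 r3 r4 s1 s2 s3 s4 where rs: "r = [r1, r2, r3, r4]" "s = [s1, s2, s3, s4]"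
    using \<Gamma>(2,3) by (auto simp: length_Suc_conv eval_nat_numeral)
  have pos: "x \<noteq> 0" "x \<le> 9" if "x \<in> set ([b, c, d] @ r @ s)" for x using sub that by auto
  show "length \<Gamma> = 3" using \<Gamma> by simp
  show "well_formed \<Gamma>" unfolding well_formed_def using \<Gamma> sub by auto
  have "List.product [1..<length \<Gamma> + 1] [1..<5] =
      [(1,1),(1,2),(1,3),(1,4),(2,1),(2,2),(2,3),(2,4),(3,1),(3,2),(3,3),(3,4)]"
    unfolding \<Gamma>(1) by (simp add: upt_rec eval_nat_numeral)
  then show "edges_into \<Gamma> 0 = [(1, 1)]"
    using pos(1) unfolding edges_into_def rs \<Gamma>(1) by (simp add: target_def eval_nat_numeral)
qed

text \<open>The component \<open>i\<close> is selected by putting the \<open>i\<close>-th coordinate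
  vector at the sink.\<close>

lemma phi_vector_jets:
  assumes \<Gamma>: "field_graph \<Gamma>" and smooth: "smooth \<rho>" "smooth a1" "smooth a2"
    and mom: "\<forall>v\<in>{1..9}. has_moments 13 (C v) (vertex_content 3 \<rho> a1 a2 v) x"
  shows "phi \<Gamma> \<rho> a1 a2 {i} x = multi_integ C [1..<10] (\<lambda>p. brackets \<Gamma> (p(0 := axis i 1))) p0"
    and "phi \<Gamma> \<rho> a1 a2 I differentiable (at x)"
    and "pd j (phi \<Gamma> \<rho> a1 a2 {i}) x =
      multi_integ C [1..<10] (\<lambda>p. brackets \<Gamma> (p(0 := axis i 1)) * (\<Sum>v\<in>{1..9}. p v $ j)) p0"
    and "(\<And>j. I \<noteq> {j}) \<Longrightarrow> phi \<Gamma> \<rho> a1 a2 I = (\<lambda>x. 0)"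
proof -
  note P = field_graph_props[OF \<Gamma>]
  have len: "length \<Gamma> * 4 < 13" using P(1) by simp
  have mom': "has_moments 13 (C v) (vertex_content (length \<Gamma>) \<rho> a1 a2 v) x" if "v \<in> {1..3 * length \<Gamma>}" for v
    using that mom unfolding P(1) by auto
  have sink: "sf_prod_list (map (\<lambda>e. xi (\<iota> e)) (edges_into \<Gamma> 0)) {i} y =
      coord_prod (map \<iota> (edges_into \<Gamma> 0)) ((p0(0 := axis i 1)) 0)" for \<iota> :: "nat \<times> nat \<Rightarrow> 4" and y :: "real^4" and i
    unfolding P(3) by (simp add: sf_prod_list_simps axis_def)
  have vs: "[1..<3 * length \<Gamma> + 1] = [1..<10]" "{1..3 * length \<Gamma>} = {1..9::nat}" unfolding P(1) by simp_all
  have J: "phi \<Gamma> \<rho> a1 a2 {k} x = multi_integ C [1..<10] (brackets \<Gamma>) (p0(0 := axis k 1))"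
    "phi \<Gamma> \<rho> a1 a2 {k} differentiable (at x)"
    "pd j (phi \<Gamma> \<rho> a1 a2 {k}) x =
      multi_integ C [1..<10] (\<lambda>p. brackets \<Gamma> p * (\<Sum>v\<in>{1..9}. p v $ j)) (p0(0 := axis k 1))" for k j
    using phi_brackets[where ?p0.0 = "p0(0 := axis k 1)" and I = "{k}", OF P(2) len smooth mom' sink]
    unfolding vs by blast+
  have upd: "multi_integ C [1..<10] F (p0(0 := z)) = multi_integ C [1..<10] (\<lambda>p. F (p(0 := z))) p0" for F z
    by (rule multi_integ_upd) simp
  show "phi \<Gamma> \<rho> a1 a2 {i} x = multi_integ C [1..<10] (\<lambda>p. brackets \<Gamma> (p(0 := axis i 1))) p0"
    using J(1) unfolding upd .
  have "(\<Sum>v\<in>{1..9}. (p(0 := z)) v $ j) = (\<Sum>v\<in>{1..9}. p v $ j)" for p :: "nat \<Rightarrow> real^4" and z j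
    by (rule sum.cong) auto
  then show "pd j (phi \<Gamma> \<rho> a1 a2 {i}) x =
      multi_integ C [1..<10] (\<lambda>p. brackets \<Gamma> (p(0 := axis i 1)) * (\<Sum>v\<in>{1..9}. p v $ j)) p0"
    using J(3) unfolding upd by simp
  show zero: "phi \<Gamma> \<rho> a1 a2 I = (\<lambda>x. 0)" if "\<And>j. I \<noteq> {j}"
    unfolding phi_def Let_def P(3) using that by (simp add: sf_prod_list_simps)
  show "phi \<Gamma> \<rho> a1 a2 I differentiable (at x)"
  proof (cases "\<exists>j. I = {j}")
    case True
    then show ?thesis using J(2) by blast
  next
    case False
    then show ?thesis using zero by simp
  qed
qed

text \<open>The part of \<open>[P, X]\<close> in which the derivative hits the vertex
  \<open>v\<close>. Vertices 10, 11, 12 carry \<open>\<rho>\<close>, \<open>a1\<close>,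
  \<open>a2\<close> of the copy of \<open>P\<close>. For \<open>v \<le> 9\<close> the free edge of
  \<open>P\<close> enters the field, in both orders of \<open>a\<close> and \<open>b\<close>;
  otherwise the sink edge of the field enters \<open>P\<close>.\<close>

definition schouten_graphs :: "ix \<Rightarrow> ix \<Rightarrow> graph_code \<Rightarrow> nat \<Rightarrow> (int \<times> slot list list) list" where
  "schouten_graphs a b \<Gamma> v = (if v \<le> 9
     then [(1, [Fixed a, Vertex v, Vertex 11, Vertex 12] # fill_sink (Fixed b) \<Gamma>),
           (- 1, [Fixed b, Vertex v, Vertex 11, Vertex 12] # fill_sink (Fixed a) \<Gamma>)]
     else [(- 1, [Fixed a, Fixed b, Vertex 11, Vertex 12] # fill_sink (Vertex v) \<Gamma>)])"

lemma field_graph_cong: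
  assumes "field_graph \<Gamma>" "\<And>v. v \<in> {1..9} \<Longrightarrow> p v = q v" "p 0 = q 0"
  shows "brackets \<Gamma> p = brackets \<Gamma> q"
proof (rule brackets_cong)
  fix b v assume "b \<in> set \<Gamma>" "v \<in> set b"
  then have "v = 0 \<or> v \<in> {1..9}" using assms(1) unfolding field_graph_def
    by (auto simp: subset_iff)
  then show "p v = q v" using assms(2,3) by auto
qed

text \<open>The sink occupies a single slot of a single determinant, so the product is linear in the
  vector placed there.\<close>

lemma field_graph_sink_linear:
  assumes "field_graph \<Gamma>"
  shows "(\<Sum>i\<in>UNIV. y $ i * brackets \<Gamma> (p(0 := axis i 1))) = brackets \<Gamma> (p(0 := y))"
    and "brackets \<Gamma> (p(0 := (\<Sum>z\<in>Z. f z))) = (\<Sum>z\<in>Z. brackets \<Gamma> (p(0 := f z)))"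
proof -
  obtain b c d r s where \<Gamma>: "\<Gamma> = [[0, b, c, d], r, s]" and sub: "set ([b, c, d] @ r @ s) \<subseteq> {1..9}"
    using assms unfolding field_graph_def by blast
  have "v \<noteq> 0" if "v \<in> set ([b, c, d] @ r @ s)" for v using sub that by auto
  then have "b \<noteq> 0" "c \<noteq> 0" "d \<noteq> 0" "0 \<notin> set r" "0 \<notin> set s" by (metis Un_iff list.set_intros set_append)+
  then have *: "brackets \<Gamma> (p(0 := y)) = det4 y (p b) (p c) (p d) * (bracket r p * bracket s p)" for y
    unfolding \<Gamma> by (simp add: brackets_def bracket_det4) (simp add: bracket_def)
  show "(\<Sum>i\<in>UNIV. y $ i * brackets \<Gamma> (p(0 := axis i 1))) = brackets \<Gamma> (p(0 := y))"
    unfolding * det4_axis_sum[symmetric, of y] sum_distrib_right by (simp only: mult.assoc)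
  show "brackets \<Gamma> (p(0 := (\<Sum>z\<in>Z. f z))) = (\<Sum>z\<in>Z. brackets \<Gamma> (p(0 := f z)))"
    unfolding * det4_sum sum_distrib_right ..
qed

lemma sum_prod_exchange:
  "(\<Sum>i\<in>A. B * (\<Sum>v\<in>V. f v i) * g i) = (B::real) * (\<Sum>v\<in>V. \<Sum>i\<in>A. f v i * g i)"
proof -
  have "(\<Sum>v\<in>V. \<Sum>i\<in>A. f v i * g i) = (\<Sum>i\<in>A. \<Sum>v\<in>V. f v i * g i)"
    by (rule sum.swap)
  then show ?thesis by (simp add: sum_distrib_left sum_distrib_right mult.assoc)
qed

text \<open>The field has its own Casimirs \<open>b1\<close>, \<open>b2\<close> because
  skew-symmetrization swaps them in the field while \<open>P\<close> keeps \<open>a1\<close>,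
  \<open>a2\<close>.\<close>

lemma schouten_phi:
  assumes \<Gamma>: "field_graph \<Gamma>" and smooth: "smooth \<rho>" "smooth a1" "smooth a2" "smooth b1" "smooth b2"
    and mom: "\<forall>v\<in>{1..9}. has_moments 13 (C v) (vertex_content 3 \<rho> b1 b2 v) x"
      "has_moments 13 (C 10) \<rho> x" "has_moments 13 (C 11) a1 x" "has_moments 13 (C 12) a2 x"
    and ab: "coord_of a < coord_of b"
  shows "schouten (nambu \<rho> a1 a2) (phi \<Gamma> \<rho> b1 b2) {coord_of a, coord_of b} x =
    (\<Sum>v\<in>{1..12}. \<Sum>(s, g)\<leftarrow>schouten_graphs a b \<Gamma> v. of_int s * multi_integ C [1..<13] (slot_brackets g) p0)"
proof -
  let ?a = "coord_of a" and ?b = "coord_of b"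
  note V = phi_vector_jets[OF \<Gamma> smooth(1,4,5) mom(1)]
  have d: "distinct [10, 11, 12::nat]" "1 < (13::nat)" by simp_all
  note P = nambu_coeff_jets[OF smooth(1-3) d mom(2-4)]
  have app: "[1..<10] @ [10, 11, 12] = [1..<13::nat]" by (simp add: upt_rec)
  have dep1: "brackets \<Gamma> (p(0 := z)) = brackets \<Gamma> (q(0 := z))" if "\<And>w. w \<notin> set [10, 11, 12] \<Longrightarrow> p w = q w"
    for p q :: "nat \<Rightarrow> real^4" and z
    by (rule field_graph_cong[OF \<Gamma>]) (use that in auto)
  \<comment> \<open>\<open>K\<close> is the Leibniz factor on the vertices \<open>1..9\<close> of
    the field (or 1 when \<open>P\<close> is differentiated), \<open>G\<close> the part that belongs
    to \<open>P\<close>; the two integrals merge into one over \<open>1..12\<close>.\<close>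
  have prod1: "multi_integ C [10, 11, 12] G p0 * multi_integ C [1..<10] (\<lambda>p. brackets \<Gamma> (p(0 := z)) * K p) p0 =
      multi_integ C [1..<13] (\<lambda>p. brackets \<Gamma> (p(0 := z)) * K p * G p) p0"
    if G: "\<And>p q. (\<And>w. w \<notin> {1..9} \<Longrightarrow> p w = q w) \<Longrightarrow> G p = G q"
      and K: "\<And>p q. (\<And>w. w \<in> {1..9} \<Longrightarrow> p w = q w) \<Longrightarrow> K p = K q" for G K z
    unfolding app[symmetric]
  proof (subst multi_integ_mult)
    fix p q :: "nat \<Rightarrow> real^4" assume pq: "\<And>w. w \<notin> set [10, 11, 12] \<Longrightarrow> p w = q w"
    have "K p = K q" by (rule K) (use pq in auto)
    then show "brackets \<Gamma> (p(0 := z)) * K p = brackets \<Gamma> (q(0 := z)) * K q" using dep1[OF pq] by simp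
  next
    fix p q :: "nat \<Rightarrow> real^4" assume pq: "\<And>w. w \<notin> set [1..<10] \<Longrightarrow> p w = q w"
    show "G p = G q" by (rule G) (use pq in auto)
  qed simp
  have T: "(\<Sum>i\<in>UNIV. nambu_coeff \<rho> a1 a2 (coord_of c) i x * pd i (phi \<Gamma> \<rho> b1 b2 {coord_of d}) x) =
      (\<Sum>v\<in>{1..9}. multi_integ C [1..<13]
        (slot_brackets ([Fixed c, Vertex v, Vertex 11, Vertex 12] # fill_sink (Fixed d) \<Gamma>)) p0)" for c d
  proof -
    have "(\<Sum>i\<in>UNIV. nambu_coeff \<rho> a1 a2 (coord_of c) i x * pd i (phi \<Gamma> \<rho> b1 b2 {coord_of d}) x) =
      (\<Sum>i\<in>UNIV. multi_integ C [1..<13] (\<lambda>p. brackets \<Gamma> (p(0 := axis (coord_of d) 1)) * (\<Sum>v\<in>{1..9}. p v $ i) *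
          det4 (axis (coord_of c) 1) (axis i 1) (p 11) (p 12)) p0)"
      unfolding P(1)[where ?p0.0 = p0] V(3)[where ?p0.0 = p0] by (rule sum.cong[OF refl], rule prod1) auto
    also have "\<dots> = multi_integ C [1..<13] (\<lambda>p. brackets \<Gamma> (p(0 := axis (coord_of d) 1)) *
        (\<Sum>v\<in>{1..9}. \<Sum>i\<in>UNIV. p v $ i * det4 (axis (coord_of c) 1) (axis i 1) (p 11) (p 12))) p0"
      unfolding multi_integ_sum[symmetric] sum_prod_exchange ..
    also have "\<dots> = multi_integ C [1..<13] (\<lambda>p. \<Sum>v\<in>{1..9}.
        slot_brackets ([Fixed c, Vertex v, Vertex 11, Vertex 12] # fill_sink (Fixed d) \<Gamma>) p) p0"
      unfolding det4_axis_sums slot_brackets_Cons slot_brackets_fill_sink slot_vec.simps sum_distrib_left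
      by (simp only: mult.commute)
    finally show ?thesis unfolding multi_integ_sum .
  qed
  have T3: "(\<Sum>i\<in>UNIV. phi \<Gamma> \<rho> b1 b2 {i} x * pd i (nambu_coeff \<rho> a1 a2 ?a ?b) x) =
      (\<Sum>v\<in>{10..12}. multi_integ C [1..<13]
        (slot_brackets ([Fixed a, Fixed b, Vertex 11, Vertex 12] # fill_sink (Vertex v) \<Gamma>)) p0)"
  proof -
    have Z: "{10, 11, 12} = {10..12::nat}" by auto
    have pull: "D * (\<Sum>i\<in>UNIV. S i * B i) = (\<Sum>i\<in>UNIV. B i * 1 * (D * S i))" for D :: real and S B :: "4 \<Rightarrow> real"
      by (simp add: sum_distrib_left mult_ac)
    have "(\<Sum>i\<in>UNIV. phi \<Gamma> \<rho> b1 b2 {i} x * pd i (nambu_coeff \<rho> a1 a2 ?a ?b) x) =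
      (\<Sum>i\<in>UNIV. multi_integ C [1..<13] (\<lambda>p. brackets \<Gamma> (p(0 := axis i 1)) * 1 *
          (det4 (axis ?a 1) (axis ?b 1) (p 11) (p 12) * (\<Sum>z\<in>{10, 11, 12}. p z $ i))) p0)"
    proof (rule sum.cong[OF refl])
      fix i
      show "phi \<Gamma> \<rho> b1 b2 {i} x * pd i (nambu_coeff \<rho> a1 a2 ?a ?b) x =
        multi_integ C [1..<13] (\<lambda>p. brackets \<Gamma> (p(0 := axis i 1)) * 1 *
          (det4 (axis ?a 1) (axis ?b 1) (p 11) (p 12) * (\<Sum>z\<in>{10, 11, 12}. p z $ i))) p0"
        unfolding P(2)[where ?p0.0 = p0] V(1)[where ?p0.0 = p0]
        by (subst prod1[symmetric]) (auto simp: mult.commute)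
    qed
    also have "\<dots> = multi_integ C [1..<13] (\<lambda>p. det4 (axis ?a 1) (axis ?b 1) (p 11) (p 12) *
        (\<Sum>i\<in>UNIV. (\<Sum>z\<in>{10, 11, 12}. p z) $ i * brackets \<Gamma> (p(0 := axis i 1)))) p0"
      unfolding multi_integ_sum[symmetric] sum_component pull ..
    also have "\<dots> = multi_integ C [1..<13] (\<lambda>p. \<Sum>z\<in>{10..12}.
        slot_brackets ([Fixed a, Fixed b, Vertex 11, Vertex 12] # fill_sink (Vertex z) \<Gamma>) p) p0"
      unfolding field_graph_sink_linear[OF \<Gamma>] slot_brackets_Cons slot_brackets_fill_sink slot_vec.simps
        sum_distrib_left Z ..
    finally show ?thesis unfolding multi_integ_sum .
  qed
  have split: "{1..12} = {1..9} \<union> {10..12::nat}" "{1..9} \<inter> {10..12::nat} = {}" by auto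
  have S: "schouten (nambu \<rho> a1 a2) (phi \<Gamma> \<rho> b1 b2) {?a, ?b} x =
    (\<Sum>i\<in>UNIV. nambu_coeff \<rho> a1 a2 ?a i x * pd i (phi \<Gamma> \<rho> b1 b2 {?b}) x
      - nambu_coeff \<rho> a1 a2 ?b i x * pd i (phi \<Gamma> \<rho> b1 b2 {?a}) x
      - phi \<Gamma> \<rho> b1 b2 {i} x * pd i (nambu_coeff \<rho> a1 a2 ?a ?b) x)"
    by (rule schouten_nambu_vector[OF _ ab]) (rule V(4))
  show ?thesis
    unfolding S sum_subtractf T T3
    unfolding split(1) sum.union_disjoint[OF finite_atLeastAtMost finite_atLeastAtMost split(2)]
    by (simp add: schouten_graphs_def sum_subtractf sum_negf)
qed

section \<open>Brackets of \<open>P\<close> with Hamiltonians\<close>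

definition class_measure :: "point_measure \<Rightarrow> point_measure \<Rightarrow> point_measure \<Rightarrow> nat \<Rightarrow> point_measure" where
  "class_measure \<mu> \<mu>1 \<mu>2 v = (if v \<le> 3 then \<mu> else if v \<le> 6 then \<mu>1 else \<mu>2)"

definition ham_graph :: "graph_code \<Rightarrow> bool" where
  "ham_graph \<Gamma> \<longleftrightarrow> (\<exists>r s. \<Gamma> = [r, s] \<and> length r = 4 \<and> length s = 4 \<and> set (r @ s) \<subseteq> {1..6})"

lemma ham_graph_props:
  assumes "ham_graph \<Gamma>"
  shows "length \<Gamma> = 2" "well_formed \<Gamma>" "edges_into \<Gamma> 0 = []"
proof -
  obtain r s where \<Gamma>: "\<Gamma> = [r, s]" "length r = 4" "length s = 4" and sub: "set (r @ s) \<subseteq> {1..6}"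
    using assms unfolding ham_graph_def by blast
  show "length \<Gamma> = 2" using \<Gamma> by simp
  show "well_formed \<Gamma>" unfolding well_formed_def using \<Gamma> sub by auto
  have "target \<Gamma> k q \<noteq> 0" if "k \<in> {1..2}" "q \<in> {1..4}" for k q
  proof -
    have "\<Gamma> ! (k - 1) = r \<or> \<Gamma> ! (k - 1) = s" using that(1) \<Gamma>(1) by (auto simp: nth_Cons')
    then have "\<Gamma> ! (k - 1) ! (q - 1) \<in> set (r @ s)" using \<Gamma> that(2) by (auto intro!: nth_mem)
    then show ?thesis using sub unfolding target_def by fastforce
  qed
  then have "set (edges_into \<Gamma> 0) = {}" unfolding set_edges_into using \<Gamma>(1) by auto
  then show "edges_into \<Gamma> 0 = []" by simp
qed

text \<open>The vertices of a graph on two copies of \<open>P\<close> are renamed so that a third copy has the vertices 3, 6 and 9.\<close>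

definition shift_vertex :: "nat \<Rightarrow> nat" where
  "shift_vertex v = (if v = 3 then 4 else if v = 4 then 5 else if v = 5 then 7 else if v = 6 then 8
     else if v = 7 then 3 else if v = 8 then 6 else v)"

lemma bij_shift_vertex: "bij shift_vertex"
proof (rule o_bij)
  let ?g = "\<lambda>v::nat. if v = 4 then 3 else if v = 5 then 4 else if v = 7 then 5 else if v = 8 then 6
     else if v = 3 then 7 else if v = 6 then 8 else v"
  show "?g \<circ> shift_vertex = id" "shift_vertex \<circ> ?g = id"
    by (auto simp: fun_eq_iff shift_vertex_def)
qed

lemma phi_function_jets:
  assumes \<Gamma>: "ham_graph \<Gamma>" and smooth: "smooth \<rho>" "smooth a1" "smooth a2"
    and mom: "has_moments 13 \<mu> \<rho> x" "has_moments 13 \<mu>1 a1 x" "has_moments 13 \<mu>2 a2 x"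
  shows "phi \<Gamma> \<rho> a1 a2 {} differentiable (at x)"
    and "pd j (phi \<Gamma> \<rho> a1 a2 {}) x = multi_integ (class_measure \<mu> \<mu>1 \<mu>2) [1, 2, 4, 5, 7, 8]
      (\<lambda>p. brackets (map (map shift_vertex) \<Gamma>) p * (\<Sum>v\<in>{1, 2, 4, 5, 7, 8}. p v $ j)) p0"
    and "I \<noteq> {} \<Longrightarrow> phi \<Gamma> \<rho> a1 a2 I = (\<lambda>x. 0)"
proof -
  let ?C = "class_measure \<mu> \<mu>1 \<mu>2" and ?m = shift_vertex
  note P = ham_graph_props[OF \<Gamma>]
  have N: "length \<Gamma> * 4 < 13" using P(1) by simp
  have mom': "has_moments 13 ((?C \<circ> ?m) v) (vertex_content (length \<Gamma>) \<rho> a1 a2 v) x"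
    if "v \<in> {1..3 * length \<Gamma>}" for v
  proof -
    have "v \<in> {1, 2, 3, 4, 5, 6}" using that P(1) by auto
    then show ?thesis using mom P(1)
      by (auto simp: class_measure_def shift_vertex_def vertex_content_def)
  qed
  have sink: "sf_prod_list (map (\<lambda>e. xi (\<iota> e)) (edges_into \<Gamma> 0)) {} y =
      coord_prod (map \<iota> (edges_into \<Gamma> 0)) ((p0 \<circ> ?m) 0)" for \<iota> :: "nat \<times> nat \<Rightarrow> 4" and y :: "real^4"
    unfolding P(3) by (simp add: sf_prod_list_simps)
  have vs: "[1..<3 * length \<Gamma> + 1] = [1..<7]" "{1..3 * length \<Gamma>} = {1..6::nat}" unfolding P(1) by simp_all
  have J: "phi \<Gamma> \<rho> a1 a2 {} differentiable (at x)"
    "pd j (phi \<Gamma> \<rho> a1 a2 {}) x =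
      multi_integ (?C \<circ> ?m) [1..<7] (\<lambda>p. brackets \<Gamma> p * (\<Sum>v\<in>{1..6}. p v $ j)) (p0 \<circ> ?m)"
    using phi_brackets[where ?p0.0 = "p0 \<circ> ?m" and I = "{}", OF P(2) N smooth mom' sink]
    unfolding vs by blast+
  show "phi \<Gamma> \<rho> a1 a2 {} differentiable (at x)" by (rule J(1))
  have inv: "(q \<circ> inv ?m) \<circ> ?m = q" for q :: "nat \<Rightarrow> real^4"
    using bij_shift_vertex by (simp add: fun_eq_iff bij_is_inj inv_f_f)
  have m: "map ?m [1..<7] = [1, 2, 4, 5, 7, 8]" by (simp add: upt_rec shift_vertex_def)
  have sum: "(\<Sum>v\<in>{1..6}. (p \<circ> ?m) v $ j) = (\<Sum>v\<in>{1, 2, 4, 5, 7, 8}. p v $ j)" for p :: "nat \<Rightarrow> real^4"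
  proof -
    have "{1..6::nat} = {1, 2, 3, 4, 5, 6}" by auto
    then show ?thesis by (simp add: shift_vertex_def)
  qed
  show "pd j (phi \<Gamma> \<rho> a1 a2 {}) x = multi_integ ?C [1, 2, 4, 5, 7, 8]
      (\<lambda>p. brackets (map (map ?m) \<Gamma>) p * (\<Sum>v\<in>{1, 2, 4, 5, 7, 8}. p v $ j)) p0"
    unfolding J(2) m[symmetric] multi_integ_relabel[OF bij_shift_vertex] brackets_relabel
      sum[symmetric] inv ..
  show "phi \<Gamma> \<rho> a1 a2 I = (\<lambda>x. 0)" if "I \<noteq> {}"
    unfolding phi_def Let_def P(3) using that by (simp add: sf_prod_list_simps)
qed

text \<open>The free edge of the new copy of \<open>P\<close>, on the vertices 3, 6, 9, hits the six
  vertices of the shifted graph in turn. The row \<open>[0, v, 6, 9]\<close> completes it to a graph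
  on three copies whose first entry is the sink.\<close>

lemma schouten_ham:
  assumes \<Gamma>: "ham_graph \<Gamma>" and smooth: "smooth \<rho>" "smooth a1" "smooth a2"
    and mom: "has_moments 13 \<mu> \<rho> x" "has_moments 13 \<mu>1 a1 x" "has_moments 13 \<mu>2 a2 x"
  shows "schouten (nambu \<rho> a1 a2) (phi \<Gamma> \<rho> a1 a2) {j} x = (\<Sum>v\<in>{1, 2, 4, 5, 7, 8}.
     multi_integ (class_measure \<mu> \<mu>1 \<mu>2) [1..<10] (brackets ([0, v, 6, 9] # map (map shift_vertex) \<Gamma>)) (\<lambda>_. axis j 1))"
    and "(\<And>j. I \<noteq> {j}) \<Longrightarrow> schouten (nambu \<rho> a1 a2) (phi \<Gamma> \<rho> a1 a2) I x = 0"
proof -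
  let ?C = "class_measure \<mu> \<mu>1 \<mu>2" and ?G = "map (map shift_vertex) \<Gamma>" and ?e = "\<lambda>_::nat. axis j (1::real) :: real^4"
  let ?V = "{1, 2, 4, 5, 7, 8::nat}"
  note F = phi_function_jets[OF \<Gamma> smooth mom]
  have Cm: "has_moments 13 (?C 3) \<rho> x" "has_moments 13 (?C 6) a1 x" "has_moments 13 (?C 9) a2 x"
    using mom by (simp_all add: class_measure_def)
  have d: "distinct [3, 6, 9::nat]" "1 < (13::nat)" by simp_all
  note N = nambu_coeff_jets(1)[OF smooth d Cm]
  have dep: "brackets ?G p = brackets ?G q" if "\<And>w. w \<notin> set [3, 6, 9] \<Longrightarrow> p w = q w" for p q
  proof (rule brackets_cong)
    fix b v assume "b \<in> set ?G" "v \<in> set b"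
    then obtain b' w where bw: "b' \<in> set \<Gamma>" "w \<in> set b'" "v = shift_vertex w" by auto
    then have "w \<in> {1..6}" using \<Gamma> unfolding ham_graph_def by (auto simp: subset_iff)
    then have "w \<in> {1, 2, 3, 4, 5, 6}" by auto
    moreover note bw(3)
    ultimately have "v \<notin> set [3, 6, 9]" by (auto simp: shift_vertex_def)
    then show "p v = q v" by (rule that)
  qed
  have "nambu_coeff \<rho> a1 a2 j i x * pd i (phi \<Gamma> \<rho> a1 a2 {}) x =
      multi_integ ?C ([1, 2, 4, 5, 7, 8] @ [3, 6, 9])
        (\<lambda>p. brackets ?G p * (\<Sum>v\<in>?V. p v $ i) * det4 (axis j 1) (axis i 1) (p 6) (p 9)) ?e" for i
  proof (subst multi_integ_mult)
    fix p q :: "nat \<Rightarrow> real^4" assume pq: "\<And>w. w \<notin> set [3, 6, 9] \<Longrightarrow> p w = q w"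
    then have "p v = q v" if "v \<in> ?V" for v using that by auto
    then show "brackets ?G p * (\<Sum>v\<in>?V. p v $ i) = brackets ?G q * (\<Sum>v\<in>?V. q v $ i)"
      using dep[OF pq] by simp
  next
    fix p q :: "nat \<Rightarrow> real^4" assume pq: "\<And>w. w \<notin> set [1, 2, 4, 5, 7, 8] \<Longrightarrow> p w = q w"
    then have "p 6 = q 6" "p 9 = q 9" by auto
    then show "det4 (axis j 1) (axis i 1) (p 6) (p 9) = det4 (axis j 1) (axis i 1) (q 6) (q 9)" by simp
  next
    show "nambu_coeff \<rho> a1 a2 j i x * pd i (phi \<Gamma> \<rho> a1 a2 {}) x =
      multi_integ ?C [1, 2, 4, 5, 7, 8] (\<lambda>p. brackets ?G p * (\<Sum>v\<in>?V. p v $ i)) ?e *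
      multi_integ ?C [3, 6, 9] (\<lambda>p. det4 (axis j 1) (axis i 1) (p 6) (p 9)) ?e"
      unfolding N[where ?p0.0 = ?e] F(2)[where ?p0.0 = ?e] by (rule mult.commute)
  qed
  then have "(\<Sum>i\<in>UNIV. nambu_coeff \<rho> a1 a2 j i x * pd i (phi \<Gamma> \<rho> a1 a2 {}) x) =
      (\<Sum>i\<in>UNIV. multi_integ ?C ([1, 2, 4, 5, 7, 8] @ [3, 6, 9])
        (\<lambda>p. brackets ?G p * (\<Sum>v\<in>?V. p v $ i) * det4 (axis j 1) (axis i 1) (p 6) (p 9)) ?e)"
    by simp
  also have "\<dots> = multi_integ ?C ([1, 2, 4, 5, 7, 8] @ [3, 6, 9])
      (\<lambda>p. \<Sum>v\<in>?V. brackets ?G p * det4 (axis j 1) (p v) (p 6) (p 9)) ?e"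
    unfolding multi_integ_sum[symmetric] sum_prod_exchange det4_axis_sums unfolding sum_distrib_left ..
  \<comment> \<open>The merged integral lists the vertices of the new copy last; Fubini restores the
    natural order.\<close>
  also have "\<dots> = multi_integ ?C [1..<10]
      (\<lambda>p. \<Sum>v\<in>?V. brackets ?G p * det4 (axis j 1) (p v) (p 6) (p 9)) ?e"
  proof (rule multi_integ_perm)
    have "[1..<10] = [1, 2, 3, 4, 5, 6, 7, 8, 9::nat]" by (simp add: upt_conv_Cons)
    then show "mset ([1, 2, 4, 5, 7, 8] @ [3, 6, 9]) = mset [1..<10]" by (simp add: add_mset_commute)
  qed simp
  also have "\<dots> = multi_integ ?C [1..<10] (\<lambda>p. \<Sum>v\<in>?V. brackets ([0, v, 6, 9] # ?G) p) ?e"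
  proof (rule multi_integ_cong)
    fix p :: "nat \<Rightarrow> real^4" assume "\<And>w. w \<notin> set [1..<10] \<Longrightarrow> p w = axis j 1"
    then have "p 0 = axis j 1" by simp
    then show "(\<Sum>v\<in>?V. brackets ?G p * det4 (axis j 1) (p v) (p 6) (p 9)) = (\<Sum>v\<in>?V. brackets ([0, v, 6, 9] # ?G) p)"
      unfolding brackets_Cons bracket_det4 by (simp only: mult.commute)
  qed
  finally show "schouten (nambu \<rho> a1 a2) (phi \<Gamma> \<rho> a1 a2) {j} x = (\<Sum>v\<in>?V.
     multi_integ ?C [1..<10] (brackets ([0, v, 6, 9] # ?G)) ?e)"
    unfolding multi_integ_sum using schouten_nambu_function(1)[of "phi \<Gamma> \<rho> a1 a2", OF F(3)] by simp
  show "schouten (nambu \<rho> a1 a2) (phi \<Gamma> \<rho> a1 a2) I x = 0" if "\<And>j. I \<noteq> {j}"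
    by (rule schouten_nambu_function(2)[of "phi \<Gamma> \<rho> a1 a2", OF F(3) that])
qed

section \<open>Prescribing finitely many derivatives\<close>

text \<open>The moment generating function of a measure realizes its moments as derivatives at 0;
  each differentiation inserts a coordinate of \<open>q\<close>.\<close>

lemma has_derivative_exp_sum:
  "((\<lambda>y. integ \<mu> (\<lambda>q. c q * exp (q \<bullet> y))) has_derivative (\<lambda>h. integ \<mu> (\<lambda>q. c q * exp (q \<bullet> y) * (q \<bullet> h)))) (at y)"
proof (induction \<mu>)
  case Nil
  then show ?case by (simp add: integ_def)
next
  case (Cons a \<mu>)
  have *: "integ (a # \<mu>) k = fst a * k (snd a) + integ \<mu> k" for k
    by (simp add: integ_def case_prod_unfold)
  show ?case unfolding * using Cons
    by (auto intro!: derivative_eq_intros simp: mult_ac)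
qed

lemma foldr_pd_exp_sum:
  "foldr pd is (\<lambda>y. integ \<mu> (\<lambda>q. exp (q \<bullet> y))) = (\<lambda>y. integ \<mu> (\<lambda>q. coord_prod is q * exp (q \<bullet> y)))"
proof (induction "is")
  case (Cons i "is")
  have *: "pd i (\<lambda>y. integ \<mu> (\<lambda>q. coord_prod is q * exp (q \<bullet> y))) y =
      integ \<mu> (\<lambda>q. coord_prod (i # is) q * exp (q \<bullet> y))" for y
    unfolding pd_eqI[OF has_derivative_exp_sum] by (simp add: inner_axis mult_ac)
  show ?case unfolding foldr.simps o_apply Cons by (rule ext) (rule *)
qed simp

lemma smooth_exp_sum: "smooth (\<lambda>y. integ \<mu> (\<lambda>q. exp (q \<bullet> y)))"
  unfolding smooth_def foldr_pd_exp_sum differentiable_on_def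
  using has_derivative_exp_sum by (auto intro: differentiableI)

lemma inj_coord_of: "inj coord_of"
proof (rule injI)
  show "x = y" if "coord_of x = coord_of y" for x y
    using that by (cases x; cases y) simp_all
qed

text \<open>The list \<open>ms\<close> names the Taylor monomials \<open>x^m / m!\<close> of
  \<open>f\<close> at 0, counted with repetition; up to order 13 all other derivatives
  vanish.\<close>

lemma smooth_with_jets:
  "\<exists>f \<mu>. smooth f \<and> has_moments 13 \<mu> f 0 \<and> (\<forall>is. length is \<le> 13 \<longrightarrow>
     integ \<mu> (coord_prod (map coord_of is)) = real (length (filter (\<lambda>m. mset m = mset is) ms)))"
proof -
  define G where "G is = real (length (filter (\<lambda>m. mset (map coord_of m) = mset is) ms))" for "is"
  have "\<exists>\<mu>. \<forall>is. length is \<le> 13 \<longrightarrow> integ \<mu> (coord_prod is) = G is"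
    by (rule moment_representation) (simp add: G_def)
  then obtain \<mu> where \<mu>: "\<And>is. length is \<le> 13 \<Longrightarrow> integ \<mu> (coord_prod is) = G is" by blast
  let ?f = "\<lambda>y. integ \<mu> (\<lambda>q. exp (q \<bullet> y))"
  have "has_moments 13 \<mu> ?f 0" unfolding has_moments_def foldr_pd_exp_sum by simp
  moreover have "G (map coord_of is) = real (length (filter (\<lambda>m. mset m = mset is) ms))" for "is"
  proof -
    have "mset (map coord_of m) = mset (map coord_of is) \<longleftrightarrow> mset m = mset is" for m
      unfolding mset_map using multiset.inj_map[OF inj_coord_of] by (simp add: inj_eq)
    then show ?thesis by (simp only: G_def)
  qed
  ultimately show ?thesis using smooth_exp_sum[of \<mu>] \<mu> by (intro exI[of _ ?f] exI[of _ \<mu>]) simp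
qed

section \<open>Evaluation of products of determinants on jets\<close>

lemma of_int_sum_list: "of_int (sum_list xs) = (\<Sum>x\<leftarrow>xs. of_int x)"
  by (induction xs) simp_all

fun strike :: "ix \<Rightarrow> ix list \<Rightarrow> ix list option" where
  "strike k [] = None"
| "strike k (l # ls) = (if k = l then Some ls else map_option (Cons l) (strike k ls))"

text \<open>Differentiation of a sum of monomials \<open>x^m / m!\<close>: the exponent drops
  without a numerical factor, and monomials free of \<open>k\<close> disappear.\<close>

fun strike_all :: "ix \<Rightarrow> ix list list \<Rightarrow> ix list list" where
  "strike_all k [] = []"
| "strike_all k (m # ms) = (case strike k m of None \<Rightarrow> strike_all k ms | Some l \<Rightarrow> l # strike_all k ms)"

text \<open>Expands all determinants in turn. The state holds for each vertex the monomials that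
  survive the derivatives taken so far. A branch is cut as soon as the differentiated vertex has
  none left; at the end the constant terms are counted and multiplied.\<close>

fun eval_slots :: "slot list \<Rightarrow> ix list \<Rightarrow> slot list list \<Rightarrow> ix list list list \<Rightarrow> int" where
  "eval_slots [] ks [] st = (\<Prod>ms\<leftarrow>st. int (length (filter (\<lambda>m. m = []) ms)))"
| "eval_slots [] ks (b # bs) st = eval_slots b [I1, I2, I3, I4] bs st"
| "eval_slots (Fixed i # ts) ks bs st =
    (\<Sum>(s, k, ls)\<leftarrow>picks ks. if k = i then s * eval_slots ts ls bs st else 0)"
| "eval_slots (Vertex v # ts) ks bs st = (let ms = st ! v in
    (\<Sum>(s, k, ls)\<leftarrow>picks ks. (case strike_all k ms of [] \<Rightarrow> 0
       | m # ms' \<Rightarrow> s * eval_slots ts ls bs (st[v := m # ms']))))"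

lemma strike_props:
  "strike k m = Some l \<Longrightarrow> mset m = add_mset k (mset l)"
  "strike k m = None \<Longrightarrow> k \<notin> set m"
  by (induction m arbitrary: l) (auto split: if_splits)

lemma count_strike_all:
  "length (filter (\<lambda>m. mset m = M) (strike_all k ms)) = length (filter (\<lambda>m. mset m = add_mset k M) ms)"
proof (induction ms)
  case (Cons m ms)
  show ?case
  proof (cases "strike k m")
    case None
    then have "k \<notin># mset m" using strike_props(2) by simp
    then have "mset m \<noteq> add_mset k M" by (metis union_single_eq_member)
    then show ?thesis using None Cons by simp
  next
    case (Some l)
    then show ?thesis using strike_props(1)[OF Some] Cons by simp
  qed
qed simp

text \<open>Counting the constants that remain after differentiation reads off one derivative at
  0.\<close>

lemma count_fold_strike_all:
  "length (filter (\<lambda>m. m = []) (fold strike_all is ms)) = length (filter (\<lambda>m. mset m = mset is) ms)"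
  by (induction "is" arbitrary: ms) (simp_all add: count_strike_all)

text \<open>Justifies the pruning: an exhausted vertex contributes a zero factor whatever happens at
  the others.\<close>

lemma eval_slots_empty:
  "[] \<in> set st \<Longrightarrow> eval_slots ts ks bs st = 0"
proof (induction ts ks bs st rule: eval_slots.induct)
  case (1 ks st)
  then have "0 \<in> set (map (\<lambda>ms. int (length (filter (\<lambda>m. m = []) ms))) st)" by force
  then show ?case unfolding eval_slots.simps prod_list_zero_iff .
next
  case (2 ks b bs st)
  then show ?case by simp
next
  case (3 i ts ks bs st)
  have "(if k = i then s * eval_slots ts ls bs st else 0) = 0" if "(s, k, ls) \<in> set (picks ks)" for s k ls
    using 3 that by auto
  then have "(\<Sum>(s, k, ls)\<leftarrow>picks ks. if k = i then s * eval_slots ts ls bs st else 0) = (\<Sum>x\<leftarrow>picks ks. 0)"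
    by (intro arg_cong[where f = sum_list] map_cong refl) auto
  then show ?case by simp
next
  case (4 v ts ks bs st)
  have "(case strike_all k (st ! v) of [] \<Rightarrow> 0 | m # ms \<Rightarrow> s * eval_slots ts ls bs (st[v := m # ms])) = 0"
    if x: "(s, k, ls) \<in> set (picks ks)" for s k ls
  proof (cases "strike_all k (st ! v)")
    case (Cons m ms)
    obtain i where i: "i < length st" "st ! i = []" using 4(2) by (metis in_set_conv_nth)
    have "i \<noteq> v" using i Cons by auto
    then have "[] \<in> set (st[v := m # ms])"
      using i by (metis length_list_update nth_list_update_neq nth_mem)
    then have "eval_slots ts ls bs (st[v := m # ms]) = 0" using 4(1) x Cons by auto
    then show ?thesis using Cons by simp
  qed simp
  then have "(\<Sum>(s, k, ls)\<leftarrow>picks ks. (case strike_all k (st ! v) of [] \<Rightarrow> 0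
       | m # ms' \<Rightarrow> s * eval_slots ts ls bs (st[v := m # ms']))) = (\<Sum>x\<leftarrow>picks ks. 0)"
    by (intro arg_cong[where f = sum_list] map_cong refl) auto
  then show ?case by simp
qed

lemma picks_map: "picks (map f ks) = map (\<lambda>(s, k, ls). (s, f k, map f ls)) (picks ks)"
  by (induction ks) (auto simp: case_prod_unfold)

lemma coord_prod_append: "coord_prod (is @ js) q = coord_prod is q * coord_prod js q"
  by (simp add: coord_prod_def)

lemma multi_integ_prod:
  "distinct vs \<Longrightarrow> multi_integ C vs (\<lambda>p. \<Prod>v\<in>set vs. h v (p v)) p0 = (\<Prod>v\<in>set vs. integ (C v) (h v))"
proof (induction vs arbitrary: p0)
  case (Cons v vs)
  let ?G = "\<lambda>p. \<Prod>v\<in>set vs. h v (p v)"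
  have "multi_integ C vs (\<lambda>p. h v (p v) * ?G p) (p0(v := q)) = h v q * (\<Prod>v\<in>set vs. integ (C v) (h v))" for q
  proof -
    have "multi_integ C vs (\<lambda>p. h v (p v) * ?G p) (p0(v := q)) =
        multi_integ C vs (\<lambda>p. h v q * ?G p) (p0(v := q))"
    proof (rule multi_integ_cong)
      fix p assume "\<And>w. w \<notin> set vs \<Longrightarrow> p w = (p0(v := q)) w"
      then have "p v = q" using Cons.prems by simp
      then show "h v (p v) * ?G p = h v q * ?G p" by simp
    qed
    then show ?thesis using Cons by (simp add: multi_integ_linear)
  qed
  then show ?case using Cons.prems by (simp add: integ_linear)
qed simp

text \<open>\<open>\<kappa> v\<close> collects the indices already sent to \<open>v\<close>. Its
  length and the pending occurrences of \<open>v\<close> add up to the fixed in-degree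
  \<open>d v\<close>, so each vertex is probed by moments of a single order.\<close>

definition slots_ok :: "(nat \<Rightarrow> nat) \<Rightarrow> slot list \<Rightarrow> (nat \<Rightarrow> ix list) \<Rightarrow> bool" where
  "slots_ok d ts \<kappa> \<longleftrightarrow> (\<forall>v. Vertex v \<in> set ts \<longrightarrow> v \<in> {1..12}) \<and> \<kappa> 0 = [] \<and>
     (\<forall>v\<in>{1..12}. length (\<kappa> v) + count_list ts (Vertex v) = d v)"

text \<open>Position 0 belongs to the sink. With \<open>J 0 = [[]]\<close> it is a neutral factor
  that aligns list positions with vertex numbers.\<close>

definition jet_state :: "(nat \<Rightarrow> ix list list) \<Rightarrow> (nat \<Rightarrow> ix list) \<Rightarrow> ix list list list" where
  "jet_state J \<kappa> = map (\<lambda>v. fold strike_all (\<kappa> v) (J v)) [0..<13]"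

definition jet_factor :: "(nat \<Rightarrow> ix list) \<Rightarrow> (nat \<Rightarrow> real^4) \<Rightarrow> real" where
  "jet_factor \<kappa> p = (\<Prod>v\<in>{1..12}. coord_prod (map coord_of (\<kappa> v)) (p v))"

context
  fixes C :: "nat \<Rightarrow> point_measure" and J :: "nat \<Rightarrow> ix list list" and d :: "nat \<Rightarrow> nat" and p0 :: "nat \<Rightarrow> real^4"
  assumes moments: "\<And>v is. v \<in> {1..12} \<Longrightarrow> length is = d v \<Longrightarrow>
      integ (C v) (coord_prod (map coord_of is)) = real (length (filter (\<lambda>m. mset m = mset is) (J v)))"
    and J0: "J 0 = [[]]"
begin

text \<open>Invariant of the evaluator: derivatives already taken appear as the monomial
  \<open>jet_factor \<kappa>\<close>, the rest as a partly expanded determinant times the brackets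
  still to come.\<close>

definition eval_sound :: "slot list \<Rightarrow> slot list list \<Rightarrow> bool" where
  "eval_sound ts bs \<longleftrightarrow> (\<forall>\<kappa> ks. slots_ok d (ts @ concat bs) \<kappa> \<longrightarrow>
     real_of_int (eval_slots ts ks bs (jet_state J \<kappa>)) = multi_integ C [1..<13] (\<lambda>p. jet_factor \<kappa> p *
       (laplace (map (slot_vec p) ts) (map coord_of ks) * slot_brackets bs p)) p0)"

lemma eval_sound_Nil: "eval_sound [] []"
  unfolding eval_sound_def
proof (intro allI impI)
  fix \<kappa> ks assume ok: "slots_ok d ([] @ concat []) \<kappa>"
  have S: "set [1..<13] = {1..12::nat}" by auto
  have U: "[0..<13] = 0 # [1..<13::nat]" by (simp add: upt_conv_Cons)
  have "eval_slots [] ks [] (jet_state J \<kappa>) = (\<Prod>v\<leftarrow>[0..<13]. int (length (filter (\<lambda>m. mset m = mset (\<kappa> v)) (J v))))"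
    by (simp add: jet_state_def comp_def count_fold_strike_all)
  also have "\<dots> = (\<Prod>v\<leftarrow>[1..<13]. int (length (filter (\<lambda>m. mset m = mset (\<kappa> v)) (J v))))"
    using ok J0 unfolding U slots_ok_def by simp
  also have "\<dots> = (\<Prod>v\<in>{1..12}. int (length (filter (\<lambda>m. mset m = mset (\<kappa> v)) (J v))))"
    using prod.distinct_set_conv_list[of "[1..<13]" "\<lambda>v. int (length (filter (\<lambda>m. mset m = mset (\<kappa> v)) (J v)))"]
    unfolding S by simp
  finally have "real_of_int (eval_slots [] ks [] (jet_state J \<kappa>)) =
      (\<Prod>v\<in>{1..12}. real (length (filter (\<lambda>m. mset m = mset (\<kappa> v)) (J v))))" by simp
  also have "\<dots> = (\<Prod>v\<in>{1..12}. integ (C v) (coord_prod (map coord_of (\<kappa> v))))"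
    by (rule prod.cong[OF refl], rule moments[symmetric]) (use ok in \<open>auto simp: slots_ok_def\<close>)
  also have "\<dots> = multi_integ C [1..<13] (jet_factor \<kappa>) p0"
    using multi_integ_prod[of "[1..<13]" C "\<lambda>v. coord_prod (map coord_of (\<kappa> v))" p0]
    unfolding S jet_factor_def by simp
  finally show "real_of_int (eval_slots [] ks [] (jet_state J \<kappa>)) = multi_integ C [1..<13] (\<lambda>p. jet_factor \<kappa> p *
       (laplace (map (slot_vec p) []) (map coord_of ks) * slot_brackets [] p)) p0"
    by (simp add: slot_brackets_def)
qed

lemma eval_sound_next_bracket:
  assumes "eval_sound b bs"
  shows "eval_sound [] (b # bs)"
  unfolding eval_sound_def
proof (intro allI impI)
  fix \<kappa> ks assume "slots_ok d ([] @ concat (b # bs)) \<kappa>"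
  then have "slots_ok d (b @ concat bs) \<kappa>" by simp
  then show "real_of_int (eval_slots [] ks (b # bs) (jet_state J \<kappa>)) = multi_integ C [1..<13] (\<lambda>p. jet_factor \<kappa> p *
       (laplace (map (slot_vec p) []) (map coord_of ks) * slot_brackets (b # bs) p)) p0"
    using assms[unfolded eval_sound_def, rule_format, of \<kappa> "[I1, I2, I3, I4]"]
    by (simp add: slot_brackets_def)
qed

lemma multi_integ_laplace_step:
  "multi_integ C vs (\<lambda>p. A p * (laplace (u p # us p) (map coord_of ks) * B p)) p0 =
   (\<Sum>(s, k, ls)\<leftarrow>picks ks. of_int s * multi_integ C vs (\<lambda>p. A p * u p $ coord_of k *
      (laplace (us p) (map coord_of ls) * B p)) p0)"
proof -
  have "(\<lambda>p. A p * (laplace (u p # us p) (map coord_of ks) * B p)) = (\<lambda>p. \<Sum>x\<leftarrow>picks ks.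
      of_int (fst x) * (A p * u p $ coord_of (fst (snd x)) * (laplace (us p) (map coord_of (snd (snd x))) * B p)))"
    by (rule ext) (simp add: picks_map case_prod_unfold comp_def sum_list_mult_const[symmetric]
        sum_list_const_mult[symmetric] mult_ac)
  then show ?thesis
    by (simp add: multi_integ_sum_list multi_integ_linear(2) case_prod_unfold)
qed

text \<open>A fixed slot kills all terms of the expansion but those with its own index; a vertex
  slot moves the index from the determinant into the monomial of that vertex.\<close>

lemma eval_sound_Cons:
  assumes IH: "eval_sound ts bs"
  shows "eval_sound (t # ts) bs"
  unfolding eval_sound_def
proof (intro allI impI)
  fix \<kappa> ks assume ok: "slots_ok d ((t # ts) @ concat bs) \<kappa>"
  let ?R = "\<lambda>\<kappa> ls p. jet_factor \<kappa> p * (laplace (map (slot_vec p) ts) (map coord_of ls) * slot_brackets bs p)"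
  have IH': "multi_integ C [1..<13] (?R \<kappa> ls) p0 = real_of_int (eval_slots ts ls bs (jet_state J \<kappa>))"
    if "slots_ok d (ts @ concat bs) \<kappa>" for \<kappa> ls
    using IH that unfolding eval_sound_def by simp
  have "real_of_int (eval_slots (t # ts) ks bs (jet_state J \<kappa>)) =
    (\<Sum>(s, k, ls)\<leftarrow>picks ks. of_int s * multi_integ C [1..<13] (\<lambda>p. jet_factor \<kappa> p * slot_vec p t $ coord_of k *
      (laplace (map (slot_vec p) ts) (map coord_of ls) * slot_brackets bs p)) p0)"
  proof (cases t)
    case (Fixed i)
    then have ok': "slots_ok d (ts @ concat bs) \<kappa>" using ok by (simp add: slots_ok_def)
    have "real_of_int (if k = i then s * eval_slots ts ls bs (jet_state J \<kappa>) else 0) =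
      of_int s * multi_integ C [1..<13] (\<lambda>p. jet_factor \<kappa> p * slot_vec p t $ coord_of k *
      (laplace (map (slot_vec p) ts) (map coord_of ls) * slot_brackets bs p)) p0" for s k ls
    proof (cases "k = i")
      case True
      then show ?thesis using IH'[OF ok'] Fixed by (simp add: axis_def)
    next
      case False
      then have "coord_of k \<noteq> coord_of i" using inj_coord_of by (simp add: inj_eq)
      then show ?thesis using False Fixed by (simp add: axis_def multi_integ_linear)
    qed
    then show ?thesis unfolding Fixed by (simp add: of_int_sum_list comp_def case_prod_unfold)
  next
    case (Vertex v)
    have v: "v \<in> {1..12}" using ok Vertex by (simp add: slots_ok_def)
    have "real_of_int (case strike_all k (jet_state J \<kappa> ! v) of [] \<Rightarrow> 0
        | m # ms' \<Rightarrow> s * eval_slots ts ls bs ((jet_state J \<kappa>)[v := m # ms'])) =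
      of_int s * multi_integ C [1..<13] (\<lambda>p. jet_factor \<kappa> p * slot_vec p t $ coord_of k *
      (laplace (map (slot_vec p) ts) (map coord_of ls) * slot_brackets bs p)) p0" for s k ls
    proof -
      define \<kappa>' where "\<kappa>' = \<kappa>(v := \<kappa> v @ [k])"
      have "slots_ok d (ts @ concat bs) \<kappa>'"
        using ok v unfolding slots_ok_def \<kappa>'_def Vertex by auto
      note I = IH'[OF this, of ls]
      have st: "jet_state J \<kappa>' = (jet_state J \<kappa>)[v := strike_all k (jet_state J \<kappa> ! v)]"
        by (rule nth_equalityI) (use v in \<open>auto simp: jet_state_def \<kappa>'_def nth_list_update\<close>)
      have "jet_factor \<kappa>' p = jet_factor \<kappa> p * slot_vec p t $ coord_of k" for p
        unfolding jet_factor_def prod.remove[OF finite_atLeastAtMost v] Vertex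
        by (simp add: \<kappa>'_def coord_prod_append mult_ac)
      then have I': "multi_integ C [1..<13] (\<lambda>p. jet_factor \<kappa> p * slot_vec p t $ coord_of k *
        (laplace (map (slot_vec p) ts) (map coord_of ls) * slot_brackets bs p)) p0 =
        real_of_int (eval_slots ts ls bs (jet_state J \<kappa>'))" using I by simp
      show ?thesis
      proof (cases "strike_all k (jet_state J \<kappa> ! v)")
        \<comment> \<open>The evaluator returns 0 at once, while the invariant speaks of the updated
          state; that state contains an exhausted vertex and also evaluates to 0.\<close>
        case Nil
        have "[] \<in> set (jet_state J \<kappa>')" unfolding st Nil
          by (rule set_update_memI) (use v in \<open>simp add: jet_state_def\<close>)
        then show ?thesis unfolding I' Nil by (simp add: eval_slots_empty)
      next
        case (Cons m ms)
        then show ?thesis unfolding I' st by simp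
      qed
    qed
    then show ?thesis unfolding Vertex by (simp add: Let_def of_int_sum_list comp_def case_prod_unfold)
  qed
  then show "real_of_int (eval_slots (t # ts) ks bs (jet_state J \<kappa>)) = multi_integ C [1..<13] (\<lambda>p. jet_factor \<kappa> p *
       (laplace (map (slot_vec p) (t # ts)) (map coord_of ks) * slot_brackets bs p)) p0"
    by (simp only: list.map multi_integ_laplace_step)
qed

lemma eval_sound_all: "eval_sound ts bs"
proof (induction bs arbitrary: ts)
  case Nil
  show ?case by (induction ts) (simp_all add: eval_sound_Nil eval_sound_Cons)
next
  case (Cons b bs)
  show ?case by (induction ts) (simp_all add: eval_sound_next_bracket[OF Cons] eval_sound_Cons)
qed

lemma eval_slots_correct:
  assumes "slots_ok d (concat g) (\<lambda>_. [])"
  shows "real_of_int (eval_slots [] [] g (map J [0..<13])) = multi_integ C [1..<13] (slot_brackets g) p0"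
  using eval_sound_all[of "[]" g, unfolded eval_sound_def, rule_format, of "\<lambda>_. []" "[]"] assms
  by (simp add: jet_state_def jet_factor_def)

end

section \<open>Values of the bracket on prescribed jets\<close>

definition in_degree :: "graph_code \<Rightarrow> nat \<Rightarrow> nat" where
  "in_degree \<Gamma> v = (if v = 0 then 0 else (if v = 11 \<or> v = 12 then 1 else 0) + count_list (concat \<Gamma>) v)"

definition of_length :: "nat \<Rightarrow> ix list list \<Rightarrow> ix list list" where
  "of_length d ms = filter (\<lambda>m. length m = d) ms"

text \<open>Only monomials whose degree is the in-degree of their vertex matter, and the derivative
  raises one in-degree, that of \<open>v\<close>, by 1. A vertex without a monomial of its degree
  must be the one that is hit: a single such vertex determines \<open>v\<close>, and two of them
  force the value 0.\<close>

definition schouten_value :: "ix \<Rightarrow> ix \<Rightarrow> ix list list list \<Rightarrow> graph_code \<times> nat list \<Rightarrow> int" where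
  "schouten_value a b cs = (\<lambda>(\<Gamma>, ds). let st = map2 of_length ds cs in
     (\<Sum>v\<leftarrow>(case filter (\<lambda>v. st ! v = []) [1,2,3,4,5,6,7,8,9,10,11,12] of [] \<Rightarrow> [1,2,3,4,5,6,7,8,9,10,11,12] | [w] \<Rightarrow> [w] | _ \<Rightarrow> []).
        case of_length (Suc (ds ! v)) (cs ! v) of [] \<Rightarrow> 0
        | m # ms \<Rightarrow> (\<Sum>(s, g)\<leftarrow>schouten_graphs a b \<Gamma> v. s * eval_slots [] [] g (st[v := m # ms]))))"

type_synonym jet_test = "ix \<times> ix \<times> ix list list \<times> ix list list \<times> ix list list"

text \<open>Twice the skew-symmetrized value: \<open>m1\<close> and \<open>m2\<close> change places
  at the vertices of the field, while the last three entries, those of \<open>P\<close>,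
  stay.\<close>

definition test_value :: "jet_test \<Rightarrow> graph_code \<times> nat list \<Rightarrow> int" where
  "test_value = (\<lambda>(a, b, r, m1, m2) \<Gamma>.
     schouten_value a b [[[]], r, r, r, m1, m1, m1, m2, m2, m2, r, m1, m2] \<Gamma>
     - schouten_value a b [[[]], r, r, r, m2, m2, m2, m1, m1, m1, r, m1, m2] \<Gamma>)"

definition with_degrees :: "graph_code \<Rightarrow> graph_code \<times> nat list" where
  "with_degrees \<Gamma> = (\<Gamma>, map (in_degree \<Gamma>) [0,1,2,3,4,5,6,7,8,9,10,11,12])"

lemma count_list_fill_sink:
  assumes "field_graph \<Gamma>" "w \<noteq> 0"
  shows "count_list (concat (fill_sink t \<Gamma>)) (Vertex w) = count_list (concat \<Gamma>) w + (if t = Vertex w then 1 else 0)"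
proof -
  have "concat (fill_sink t \<Gamma>) = map (\<lambda>v. if v = 0 then t else Vertex v) (concat \<Gamma>)"
    by (simp add: fill_sink_def map_concat)
  moreover have "count_list (map (\<lambda>v. if v = 0 then t else Vertex v) xs) (Vertex w) =
      count_list xs w + (if t = Vertex w then count_list xs 0 else 0)" for xs
    using assms(2) by (induction xs) auto
  moreover have "count_list (concat \<Gamma>) 0 = 1"
  proof -
    obtain b c e r s where \<Gamma>: "\<Gamma> = [[0, b, c, e], r, s]" and sub: "set ([b, c, e] @ r @ s) \<subseteq> {1..9}"
      using assms unfolding field_graph_def by blast
    have "0 \<notin> set ([b, c, e] @ r @ s)" using sub by (metis atLeastAtMost_iff not_one_le_zero subsetD)
    then have "count_list ([b, c, e] @ r @ s) 0 = 0" by (rule count_notin)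
    then show ?thesis unfolding \<Gamma> by auto
  qed
  ultimately show ?thesis by simp
qed

lemma set_fill_sink:
  assumes "field_graph \<Gamma>" "Vertex u \<in> set (concat (fill_sink t \<Gamma>))"
  shows "u \<in> {1..9} \<or> t = Vertex u"
proof -
  obtain r v where "r \<in> set \<Gamma>" "v \<in> set r" "Vertex u = (if v = 0 then t else Vertex v)"
    using assms(2) unfolding fill_sink_def by auto
  moreover from this have "v = 0 \<or> v \<in> {1..9}"
    using assms(1) unfolding field_graph_def by (auto simp: subset_iff)
  ultimately show ?thesis by (auto split: if_splits)
qed

lemma schouten_graphs_slots:
  assumes \<Gamma>: "field_graph \<Gamma>" and v: "v \<in> {1..12}" and g: "(s, g) \<in> set (schouten_graphs a b \<Gamma> v)"
  shows "w \<in> {1..12} \<Longrightarrow> count_list (concat g) (Vertex w) = in_degree \<Gamma> w + (if w = v then 1 else 0)"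
    and "Vertex u \<in> set (concat g) \<Longrightarrow> u \<in> {1..12}"
proof -
  show "count_list (concat g) (Vertex w) = in_degree \<Gamma> w + (if w = v then 1 else 0)" if w: "w \<in> {1..12}"
  proof -
    have "w \<noteq> 0" using w by simp
    note c = count_list_fill_sink[OF \<Gamma>]
    show ?thesis
    proof (cases "v \<le> 9")
      case True
      then obtain e h where "g = [Fixed e, Vertex v, Vertex 11, Vertex 12] # fill_sink (Fixed h) \<Gamma>"
        using g unfolding schouten_graphs_def by auto
      then show ?thesis using True w \<open>w \<noteq> 0\<close> by (simp add: in_degree_def c)
    next
      case False
      then have "g = [Fixed a, Fixed b, Vertex 11, Vertex 12] # fill_sink (Vertex v) \<Gamma>"
        using g unfolding schouten_graphs_def by auto
      then show ?thesis using w \<open>w \<noteq> 0\<close> by (simp add: in_degree_def c)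
    qed
  qed
  show "u \<in> {1..12}" if u: "Vertex u \<in> set (concat g)"
  proof (cases "v \<le> 9")
    case True
    then obtain c e where "g = [Fixed c, Vertex v, Vertex 11, Vertex 12] # fill_sink (Fixed e) \<Gamma>"
      using g unfolding schouten_graphs_def by auto
    then have "u = v \<or> u = 11 \<or> u = 12 \<or> Vertex u \<in> set (concat (fill_sink (Fixed e) \<Gamma>))" using u by auto
    then have "u = v \<or> u = 11 \<or> u = 12 \<or> u \<in> {1..9}" using set_fill_sink[OF \<Gamma>] by blast
    then show ?thesis using v by auto
  next
    case False
    then have "g = [Fixed a, Fixed b, Vertex 11, Vertex 12] # fill_sink (Vertex v) \<Gamma>"
      using g unfolding schouten_graphs_def by auto
    then have "u = 11 \<or> u = 12 \<or> Vertex u \<in> set (concat (fill_sink (Vertex v) \<Gamma>))" using u by auto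
    then have "u = 11 \<or> u = 12 \<or> u \<in> {1..9} \<or> u = v" using set_fill_sink[OF \<Gamma>] by blast
    then show ?thesis using v by auto
  qed
qed

lemma schouten_value_correct:
  assumes \<Gamma>: "field_graph \<Gamma>" and deg: "\<And>w. w \<in> {1..12} \<Longrightarrow> in_degree \<Gamma> w \<le> 12"
    and cs: "length cs = 13" "cs ! 0 = [[]]"
    and moments: "\<And>v is. v \<in> {1..12} \<Longrightarrow> length is \<le> 13 \<Longrightarrow>
      integ (C v) (coord_prod (map coord_of is)) = real (length (filter (\<lambda>m. mset m = mset is) (cs ! v)))"
  shows "real_of_int (schouten_value a b cs (with_degrees \<Gamma>)) =
    (\<Sum>v\<in>{1..12}. \<Sum>(s, g)\<leftarrow>schouten_graphs a b \<Gamma> v. of_int s * multi_integ C [1..<13] (slot_brackets g) p0)"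
proof -
  define ds where "ds = map (in_degree \<Gamma>) [0,1,2,3,4,5,6,7,8,9,10,11,12]"
  have U: "[0,1,2,3,4,5,6,7,8,9,10,11,12] = [0..<13::nat]" by (simp add: upt_conv_Cons)
  have U1: "[1,2,3,4,5,6,7,8,9,10,11,12] = [1..<13::nat]" by (simp add: upt_conv_Cons)
  define J where "J v w = of_length (in_degree \<Gamma> w + (if w = v then 1 else 0)) (cs ! w)" for v w
  define st0 where "st0 = map2 of_length ds cs"
  define T where "T v = (\<Sum>(s, g)\<leftarrow>schouten_graphs a b \<Gamma> v. s * eval_slots [] [] g (map (J v) [0..<13]))" for v
  have ds: "length ds = 13" "\<And>w. w < 13 \<Longrightarrow> ds ! w = in_degree \<Gamma> w"
    unfolding ds_def U by simp_all
  have st0: "length st0 = 13" "\<And>w. w < 13 \<Longrightarrow> st0 ! w = of_length (in_degree \<Gamma> w) (cs ! w)"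
    unfolding st0_def using ds cs by simp_all
  have st: "st0[v := of_length (Suc (ds ! v)) (cs ! v)] = map (J v) [0..<13]" if "v \<in> {1..12}" for v
    by (rule nth_equalityI) (use that st0 ds in \<open>auto simp: J_def nth_list_update\<close>)
  have correct: "real_of_int (T v) = (\<Sum>(s, g)\<leftarrow>schouten_graphs a b \<Gamma> v. of_int s * multi_integ C [1..<13] (slot_brackets g) p0)"
    if v: "v \<in> {1..12}" for v
  proof -
    have "real_of_int (eval_slots [] [] g (map (J v) [0..<13])) = multi_integ C [1..<13] (slot_brackets g) p0"
      if g: "(s, g) \<in> set (schouten_graphs a b \<Gamma> v)" for s g
    proof (rule eval_slots_correct[where d = "\<lambda>w. in_degree \<Gamma> w + (if w = v then 1 else 0)"])
      fix w and "is" :: "ix list" assume w: "w \<in> {1..12}" and l: "length is = in_degree \<Gamma> w + (if w = v then 1 else 0)"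
      have "filter (\<lambda>m. mset m = mset is) (J v w) = filter (\<lambda>m. mset m = mset is) (cs ! w)"
        unfolding J_def of_length_def l[symmetric] filter_filter
        by (rule filter_cong[OF refl]) (auto dest: mset_eq_length)
      moreover have "length is \<le> 13" using deg[OF w] l by (simp split: if_splits)
      ultimately show "integ (C w) (coord_prod (map coord_of is)) = real (length (filter (\<lambda>m. mset m = mset is) (J v w)))"
        using moments[OF w] by simp
    next
      show "J v 0 = [[]]" using v cs(2) by (simp add: J_def of_length_def in_degree_def)
    next
      show "slots_ok (\<lambda>w. in_degree \<Gamma> w + (if w = v then 1 else 0)) (concat g) (\<lambda>_. [])"
      proof -
        have "count_list (concat g) (Vertex w) = in_degree \<Gamma> w + (if w = v then 1 else 0)" if "w \<in> {1..12}" for w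
          using schouten_graphs_slots(1)[OF \<Gamma> v g that] .
        moreover have "u \<in> {1..12}" if "Vertex u \<in> set (concat g)" for u
          using schouten_graphs_slots(2)[OF \<Gamma> v g that] .
        ultimately show ?thesis by (simp add: slots_ok_def)
      qed
    qed
    then show ?thesis unfolding T_def of_int_sum_list
      by (simp add: comp_def case_prod_unfold) (intro arg_cong[where f = sum_list] map_cong refl, auto)
  qed
  have zero: "T v = 0" if v: "v \<in> {1..12}" and e: "[] \<in> set (map (J v) [0..<13])" for v
  proof -
    have "(\<Sum>(s, g)\<leftarrow>schouten_graphs a b \<Gamma> v. s * eval_slots [] [] g (map (J v) [0..<13])) =
        (\<Sum>x\<leftarrow>schouten_graphs a b \<Gamma> v. 0)"
      unfolding eval_slots_empty[OF e] by (simp add: case_prod_unfold)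
    then show ?thesis unfolding T_def by simp
  qed
  define bad where "bad = filter (\<lambda>v. st0 ! v = []) [1..<13]"
  define L where "L = (case bad of [] \<Rightarrow> [1..<13] | [w] \<Rightarrow> [w] | _ \<Rightarrow> [])"
  have bad: "set bad \<subseteq> {1..12}" "distinct bad" unfolding bad_def by auto
  have L: "set L \<subseteq> {1..12}" "distinct L"
    unfolding L_def using bad by (auto split: list.splits)
  \<comment> \<open>If \<open>v\<close> is outside \<open>L\<close>, some bad vertex other than
    \<open>v\<close> keeps its unraised degree and hence has no monomial at all.\<close>
  have out: "T v = 0" if v: "v \<in> {1..12}" and n: "v \<notin> set L" for v
  proof -
    have "\<exists>w\<in>set bad. w \<noteq> v"
    proof (cases bad)
      case Nil
      then show ?thesis using v n by (simp add: L_def)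
    next
      case (Cons x xs)
      then show ?thesis using n bad(2) by (cases xs) (auto simp: L_def)
    qed
    then obtain w where w': "w \<in> set bad" "w \<noteq> v" by blast
    then have w: "w \<in> {1..12}" "st0 ! w = []" "w \<noteq> v" using bad(1) by (blast, simp_all add: bad_def)
    then have "J v w = []" using st0(2)[of w] by (simp add: J_def)
    then have "[] \<in> set (map (J v) [0..<13])" using w(1) by (auto simp: image_iff intro!: bexI[of _ w])
    then show ?thesis by (rule zero[OF v])
  qed
  have "schouten_value a b cs (with_degrees \<Gamma>) = (\<Sum>v\<leftarrow>L. case of_length (Suc (ds ! v)) (cs ! v) of [] \<Rightarrow> 0
        | m # ms \<Rightarrow> (\<Sum>(s, g)\<leftarrow>schouten_graphs a b \<Gamma> v. s * eval_slots [] [] g (st0[v := m # ms])))"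
    unfolding schouten_value_def with_degrees_def Let_def case_prod_conv ds_def[symmetric] st0_def[symmetric]
    unfolding U1 bad_def[symmetric] L_def ..
  also have "\<dots> = (\<Sum>v\<leftarrow>L. T v)"
  proof (intro arg_cong[where f = sum_list] map_cong refl)
    fix v assume "v \<in> set L"
    then have v: "v \<in> {1..12}" using L(1) by blast
    show "(case of_length (Suc (ds ! v)) (cs ! v) of [] \<Rightarrow> 0
        | m # ms \<Rightarrow> (\<Sum>(s, g)\<leftarrow>schouten_graphs a b \<Gamma> v. s * eval_slots [] [] g (st0[v := m # ms]))) = T v"
    proof (cases "of_length (Suc (ds ! v)) (cs ! v)")
      case Nil
      have "[] \<in> set (st0[v := []])" by (rule set_update_memI) (use v st0 in auto)
      then have "[] \<in> set (map (J v) [0..<13])" using st[OF v] unfolding Nil by simp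
      then show ?thesis using zero[OF v] Nil by simp
    next
      case (Cons m ms)
      then show ?thesis using st[OF v] unfolding T_def by simp
    qed
  qed
  also have "\<dots> = (\<Sum>v\<in>set L. T v)" by (rule sum.distinct_set_conv_list[OF L(2), symmetric])
  also have "\<dots> = (\<Sum>v\<in>{1..12}. T v)"
    by (rule sum.mono_neutral_left) (use L out in auto)
  finally show ?thesis using correct by simp
qed

section \<open>Relations between skew-symmetrized graphs\<close>

text \<open>Twice the component \<open>j\<close> of \<open>phi_minus\<close> when the measures
  represent jets. Identities for arbitrary measures therefore hold for all functions at all
  points.\<close>

definition skew_value :: "point_measure \<Rightarrow> point_measure \<Rightarrow> point_measure \<Rightarrow> 4 \<Rightarrow> graph_code \<Rightarrow> real" where
  "skew_value \<mu> \<mu>1 \<mu>2 j g =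
     multi_integ (class_measure \<mu> \<mu>1 \<mu>2) [1..<10] (brackets g) (\<lambda>_. axis j 1)
     - multi_integ (class_measure \<mu> \<mu>2 \<mu>1) [1..<10] (brackets g) (\<lambda>_. axis j 1)"

definition bounded_graph :: "graph_code \<Rightarrow> bool" where
  "bounded_graph g \<longleftrightarrow> (\<forall>b\<in>set g. length b = 4 \<and> (\<forall>v\<in>set b. v < 10))"

section \<open>Canonical forms under reordering and renaming\<close>

fun insert_sign :: "nat \<Rightarrow> nat list \<Rightarrow> int \<times> nat list" where
  "insert_sign x [] = (1, [x])"
| "insert_sign x (y # ys) = (if x < y then (1, x # y # ys) else if x = y then (0, x # y # ys)
     else (case insert_sign x ys of (s, zs) \<Rightarrow> (- s, y # zs)))"

text \<open>Insertion sort with the sign of the permutation; the sign 0 records a repeated entry,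
  for which the bracket vanishes.\<close>

fun sort_sign :: "nat list \<Rightarrow> int \<times> nat list" where
  "sort_sign [] = (1, [])"
| "sort_sign (x # xs) = (case sort_sign xs of (s, ys) \<Rightarrow> case insert_sign x ys of (t, zs) \<Rightarrow> (s * t, zs))"

text \<open>The prefix \<open>as\<close> lets alternation act at every position; for equal
  neighbours it forces the value 0.\<close>

lemma insert_sign_alternating:
  fixes f :: "nat list \<Rightarrow> real"
  assumes "\<And>as x y bs. f (as @ x # y # bs) = - f (as @ y # x # bs)"
  shows "insert_sign x ys = (s, zs) \<Longrightarrow> f (as @ x # ys) = of_int s * f (as @ zs)"
proof (induction ys arbitrary: s zs as)
  case (Cons y ys)
  show ?case
  proof (cases "x < y")
    case True
    then show ?thesis using Cons.prems by auto
  next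
    case False
    show ?thesis
    proof (cases "x = y")
      case True
      then show ?thesis using Cons.prems assms[of as x x ys] by auto
    next
      case F: False
      obtain s' zs' where I: "insert_sign x ys = (s', zs')" by fastforce
      then have "s = - s'" "zs = y # zs'" using Cons.prems False F by auto
      moreover have "f (as @ x # y # ys) = - f ((as @ [y]) @ x # ys)" using assms[of as x y ys] by simp
      ultimately show ?thesis using Cons.IH[OF I, of "as @ [y]"] by simp
    qed
  qed
qed simp

lemma sort_sign_alternating:
  fixes f :: "nat list \<Rightarrow> real"
  assumes alt: "\<And>as x y bs. f (as @ x # y # bs) = - f (as @ y # x # bs)"
  shows "sort_sign xs = (s, zs) \<Longrightarrow> f (as @ xs) = of_int s * f (as @ zs)"
proof (induction xs arbitrary: s zs as)
  case (Cons x xs)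
  obtain s' ys where S: "sort_sign xs = (s', ys)" by fastforce
  obtain t zs' where I: "insert_sign x ys = (t, zs')" by fastforce
  have "s = s' * t" "zs = zs'" using Cons.prems S I by auto
  moreover have "f (as @ x # xs) = of_int s' * f (as @ x # ys)"
    using Cons.IH[OF S, of "as @ [x]"] by simp
  moreover have "f (as @ x # ys) = of_int t * f (as @ zs')"
    by (rule insert_sign_alternating[where f = f, OF alt I])
  ultimately show ?case by simp
qed simp

lemma length_insert_sign: "insert_sign x ys = (s, zs) \<Longrightarrow> length zs = Suc (length ys)"
  by (induction ys arbitrary: s zs) (auto split: if_splits prod.splits)

lemma length_sort_sign: "sort_sign xs = (s, zs) \<Longrightarrow> length zs = length xs"
  by (induction xs arbitrary: s zs) (auto split: prod.splits dest: length_insert_sign)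

lemma sort_sign_bracket:
  assumes "length b = 4"
  shows "bracket b p = of_int (fst (sort_sign b)) * bracket (snd (sort_sign b)) p"
proof -
  \<comment> \<open>Extended by 0 to lists of other lengths, the bracket alternates on all lists, as
    the sorting lemma demands.\<close>
  define f where "f xs = (if length xs = 4 then bracket xs p else 0)" for xs
  have alt: "f (as @ x # y # bs) = - f (as @ y # x # bs)" for as x y bs
  proof (cases "length as + length bs = 2")
    case True
    then consider "as = []" "\<exists>c d. bs = [c, d]" | "\<exists>c d. as = [c] \<and> bs = [d]" | "\<exists>c d. as = [c, d]" "bs = []"
      by (cases as; cases bs) (auto simp: length_Suc_conv)
    then show ?thesis
      by cases (auto simp: f_def bracket_det4 det4_swap(1)[of "p x" "p y"] det4_swap(2)[of _ "p x" "p y"] det4_swap(3)[of _ _ "p x" "p y"])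
  qed (auto simp: f_def)
  obtain s zs where S: "sort_sign b = (s, zs)" by fastforce
  have "f ([] @ b) = of_int s * f ([] @ zs)" by (rule sort_sign_alternating[where f = f, OF alt S])
  moreover have "length zs = 4" using length_sort_sign[OF S] assms by simp
  ultimately show ?thesis using assms S by (simp add: f_def)
qed

definition normal_form :: "graph_code \<Rightarrow> int \<times> graph_code" where
  "normal_form g = (let bs = map sort_sign g in (prod_list (map fst bs), map snd bs))"

lemma normal_form_brackets:
  "(\<And>b. b \<in> set g \<Longrightarrow> length b = 4) \<Longrightarrow> brackets g p = of_int (fst (normal_form g)) * brackets (snd (normal_form g)) p"
  by (induction g) (simp_all add: brackets_def normal_form_def Let_def sort_sign_bracket)

text \<open>Lexicographic order of rows. The determinants commute, so rows can be sorted without a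
  sign, and equal products become syntactically equal.\<close>

fun row_less :: "nat list \<Rightarrow> nat list \<Rightarrow> bool" where
  "row_less (x # xs) (y # ys) = (if x < y then True else if x = y then row_less xs ys else False)"
| "row_less _ _ = False"

fun insert_row :: "nat list \<Rightarrow> graph_code \<Rightarrow> graph_code" where
  "insert_row b [] = [b]"
| "insert_row b (h # hs) = (if row_less h b then h # insert_row b hs else b # h # hs)"

lemma brackets_insert_row: "brackets (insert_row b g) p = brackets (b # g) p"
  by (induction g) (auto simp: brackets_def)

lemma brackets_sort_rows: "brackets (foldr insert_row g []) p = brackets g p"
  by (induction g) (simp_all add: brackets_insert_row brackets_Cons)

text \<open>
  A list \<open>m\<close> stands for the renaming \<open>v \<mapsto> m ! v\<close> of the vertices. The sign is that of the action on
  skew-symmetrized graphs, and 0 if \<open>m\<close> does not respect the three kinds of vertices.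
\<close>

definition renaming_sign :: "nat list \<Rightarrow> int" where
  "renaming_sign m = (if length m = 10 \<and> distinct m \<and> m ! 0 = 0 \<and> list_all (\<lambda>i. m ! i \<in> set [1, 2, 3]) [1, 2, 3] then
     if list_all (\<lambda>i. m ! i \<in> set [4, 5, 6]) [4, 5, 6] \<and> list_all (\<lambda>i. m ! i \<in> set [7, 8, 9]) [7, 8, 9] then 1
     else if list_all (\<lambda>i. m ! i \<in> set [7, 8, 9]) [4, 5, 6] \<and> list_all (\<lambda>i. m ! i \<in> set [4, 5, 6]) [7, 8, 9] then - 1
     else 0 else 0)"

text \<open>Ten distinct values below 10 make \<open>m\<close> a permutation. It keeps the measures
  of all vertices or exchanges those of the two Casimir kinds, according to its sign.\<close>

lemma renaming_sign_cases:
  assumes "renaming_sign m \<noteq> 0"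
  shows "length m = 10" "distinct m" "m ! 0 = 0" "set m = {0..<10}"
    and "(renaming_sign m = 1 \<and> (\<forall>v\<in>{1..9}. class_measure \<mu> \<mu>1 \<mu>2 (m ! v) = class_measure \<mu> \<mu>1 \<mu>2 v)) \<or>
         (renaming_sign m = - 1 \<and> (\<forall>v\<in>{1..9}. class_measure \<mu> \<mu>1 \<mu>2 (m ! v) = class_measure \<mu> \<mu>2 \<mu>1 v))"
proof -
  define R where "R A B \<longleftrightarrow> (\<forall>i\<in>A. m ! i \<in> (B::nat set))" for A B
  have R: "renaming_sign m = (if length m = 10 \<and> distinct m \<and> m ! 0 = 0 \<and> R {1, 2, 3} {1, 2, 3} then
      if R {4, 5, 6} {4, 5, 6} \<and> R {7, 8, 9} {7, 8, 9} then 1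
      else if R {4, 5, 6} {7, 8, 9} \<and> R {7, 8, 9} {4, 5, 6} then - 1 else 0 else 0)"
    unfolding renaming_sign_def R_def list_all_iff list.set ..
  have L: "length m = 10" "distinct m" "m ! 0 = 0" "R {1, 2, 3} {1, 2, 3}"
    and c: "(R {4, 5, 6} {4, 5, 6} \<and> R {7, 8, 9} {7, 8, 9} \<and> renaming_sign m = 1) \<or>
      (R {4, 5, 6} {7, 8, 9} \<and> R {7, 8, 9} {4, 5, 6} \<and> renaming_sign m = - 1)"
    using assms unfolding R by (auto split: if_splits)
  show "length m = 10" "distinct m" "m ! 0 = 0" by (rule L)+
  have V: "{1..9} = {1, 2, 3} \<union> {4, 5, 6} \<union> {7, 8, 9::nat}" by auto
  have sub: "m ! i \<in> {1..9}" if "i \<in> {1..9}" for i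
    using that L(4) c unfolding V R_def by blast
  show "set m = {0..<10}"
  proof (rule card_subset_eq)
    show "set m \<subseteq> {0..<10}"
    proof
      fix x assume "x \<in> set m"
      then obtain i where i: "i < 10" "x = m ! i" using L(1) by (auto simp: in_set_conv_nth)
      show "x \<in> {0..<10}"
      proof (cases "i = 0")
        case False
        then have "i \<in> {1..9}" using i(1) by auto
        from sub[OF this] show ?thesis using i(2) by auto
      qed (use i L(3) in simp)
    qed
    show "card (set m) = card {0..<10::nat}" using distinct_card[OF L(2)] L(1) by simp
  qed simp
  have r: "class_measure \<mu> \<mu>1 \<mu>2 v = \<mu>" if "v \<in> {1, 2, 3}" for v \<mu> \<mu>1 \<mu>2 using that by (auto simp: class_measure_def)
  have s: "class_measure \<mu> \<mu>1 \<mu>2 v = \<mu>1" if "v \<in> {4, 5, 6}" for v \<mu> \<mu>1 \<mu>2 using that by (auto simp: class_measure_def)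
  have t: "class_measure \<mu> \<mu>1 \<mu>2 v = \<mu>2" if "v \<in> {7, 8, 9}" for v \<mu> \<mu>1 \<mu>2 using that by (auto simp: class_measure_def)
  from c show "(renaming_sign m = 1 \<and> (\<forall>v\<in>{1..9}. class_measure \<mu> \<mu>1 \<mu>2 (m ! v) = class_measure \<mu> \<mu>1 \<mu>2 v)) \<or>
         (renaming_sign m = - 1 \<and> (\<forall>v\<in>{1..9}. class_measure \<mu> \<mu>1 \<mu>2 (m ! v) = class_measure \<mu> \<mu>2 \<mu>1 v))"
  proof
    assume a: "R {4, 5, 6} {4, 5, 6} \<and> R {7, 8, 9} {7, 8, 9} \<and> renaming_sign m = 1"
    have "class_measure \<mu> \<mu>1 \<mu>2 (m ! v) = class_measure \<mu> \<mu>1 \<mu>2 v" if v: "v \<in> {1..9}" for v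
    proof -
      have "v \<in> {1, 2, 3} \<or> v \<in> {4, 5, 6} \<or> v \<in> {7, 8, 9}" using v unfolding V by blast
      then show ?thesis
      proof (elim disjE)
        assume v: "v \<in> {1, 2, 3}"
        then show ?thesis using r[OF v] r[of "m ! v"] L(4) unfolding R_def by metis
      next
        assume v: "v \<in> {4, 5, 6}"
        then show ?thesis using s[OF v] s[of "m ! v"] a unfolding R_def by metis
      next
        assume v: "v \<in> {7, 8, 9}"
        then show ?thesis using t[OF v] t[of "m ! v"] a unfolding R_def by metis
      qed
    qed
    then show ?thesis using a by blast
  next
    assume a: "R {4, 5, 6} {7, 8, 9} \<and> R {7, 8, 9} {4, 5, 6} \<and> renaming_sign m = - 1"
    have "class_measure \<mu> \<mu>1 \<mu>2 (m ! v) = class_measure \<mu> \<mu>2 \<mu>1 v" if v: "v \<in> {1..9}" for v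
    proof -
      have "v \<in> {1, 2, 3} \<or> v \<in> {4, 5, 6} \<or> v \<in> {7, 8, 9}" using v unfolding V by blast
      then show ?thesis
      proof (elim disjE)
        assume v: "v \<in> {1, 2, 3}"
        then show ?thesis using r[OF v] r[of "m ! v"] L(4) unfolding R_def by metis
      next
        assume v: "v \<in> {4, 5, 6}"
        then show ?thesis using s[OF v] t[of "m ! v"] a unfolding R_def by metis
      next
        assume v: "v \<in> {7, 8, 9}"
        then show ?thesis using t[OF v] s[of "m ! v"] a unfolding R_def by metis
      qed
    qed
    then show ?thesis using a by blast
  qed
qed

text \<open>A change of integration variables moves the renaming from the graph to the measures. A
  permutation within the kinds leaves these in place; an exchange of the Casimir kinds swaps the two
  terms of \<open>skew_value\<close>.\<close>

lemma skew_value_renaming: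
  assumes m: "renaming_sign m \<noteq> 0" and g: "bounded_graph g"
  shows "skew_value \<mu> \<mu>1 \<mu>2 j (map (map ((!) m)) g) = of_int (renaming_sign m) * skew_value \<mu> \<mu>1 \<mu>2 j g"
proof -
  note R = renaming_sign_cases[OF m]
  define h where "h v = (if v < 10 then m ! v else v)" for v
  have inj: "inj h"
  proof (rule injI)
    fix v w assume eq: "h v = h w"
    have lt: "m ! v < 10" if "v < 10" for v using R(1,4) that nth_mem[of v m] by auto
    show "v = w" using eq lt[of v] lt[of w] R(1,2) nth_eq_iff_index_eq[of m v w]
      by (auto simp: h_def split: if_splits)
  qed
  moreover have "surj h"
  proof (rule surjI[of h "\<lambda>w. if w < 10 then (SOME v. v < 10 \<and> m ! v = w) else w"])
    fix w
    have "\<exists>v. v < 10 \<and> m ! v = w" if "w < 10"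
    proof -
      have "w \<in> set m" using that R(4) by simp
      then show ?thesis using R(1) by (auto simp: in_set_conv_nth)
    qed
    then show "h (if w < 10 then (SOME v. v < 10 \<and> m ! v = w) else w) = w"
      using someI_ex[of "\<lambda>v. v < 10 \<and> m ! v = w"] by (auto simp: h_def)
  qed
  ultimately have bij: "bij h" by (simp add: bij_def)
  have gh: "map (map ((!) m)) g = map (map h) g"
    using g by (auto simp: bounded_graph_def h_def)
  have perm: "mset (map h [1..<10]) = mset [1..<10]"
  proof -
    have "[0..<10] = 0 # [1..<10::nat]" by (simp add: upt_conv_Cons)
    then have U: "map h [0..<10] = 0 # map h [1..<10]" using R(3) by (simp add: h_def)
    have "map h [0..<10] = m" by (rule nth_equalityI) (simp_all add: R(1) h_def)
    then have "set (map h [0..<10]) = set [0..<10]" "distinct (map h [0..<10])" using R by simp_all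
    then have "mset (map h [0..<10]) = mset [0..<10]"
      by (subst set_eq_iff_mset_eq_distinct[symmetric]) simp_all
    then have "mset (0 # map h [1..<10]) = mset (0 # [1..<10])"
      unfolding U unfolding \<open>[0..<10] = 0 # [1..<10::nat]\<close> .
    then show ?thesis by (metis add_mset_remove_trivial mset.simps(2))
  qed
  have inv: "(q \<circ> inv h) \<circ> h = q" for q :: "nat \<Rightarrow> real^4"
    using inj by (simp add: fun_eq_iff inv_f_f)
  have L: "multi_integ C [1..<10] (brackets (map (map h) g)) (\<lambda>_. z) = multi_integ (C \<circ> h) [1..<10] (brackets g) (\<lambda>_. z)" for C z
  proof -
    have "multi_integ C [1..<10] (brackets (map (map h) g)) (\<lambda>_. z) =
        multi_integ C (map h [1..<10]) (brackets (map (map h) g)) (\<lambda>_. z)"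
      by (rule multi_integ_perm[OF perm[symmetric]]) simp
    also have "\<dots> = multi_integ (C \<circ> h) [1..<10] (brackets g) (\<lambda>_. z)"
      unfolding multi_integ_relabel[OF bij] brackets_relabel inv by (simp add: comp_def)
    finally show ?thesis .
  qed
  have h: "h v = m ! v" if "v \<in> set [1..<10]" for v using that by (simp add: h_def)
  have D: "multi_integ (class_measure \<mu> \<mu>1 \<mu>2 \<circ> h) [1..<10] F p =
      multi_integ (if renaming_sign m = 1 then class_measure \<mu> \<mu>1 \<mu>2 else class_measure \<mu> \<mu>2 \<mu>1) [1..<10] F p"
    for \<mu> \<mu>1 \<mu>2 F p
    by (rule multi_integ_contents_cong) (use R(5)[of \<mu> \<mu>1 \<mu>2] h in auto)
  show ?thesis
    unfolding skew_value_def gh L D using R(5)[of \<mu> \<mu>1 \<mu>2] by auto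
qed

text \<open>The renaming is supplied as part of a certificate, so no search over the
  \<open>2 * 6^3 = 432\<close> admissible renamings takes place.\<close>

definition canonical_form :: "nat list \<Rightarrow> graph_code \<Rightarrow> int \<times> graph_code" where
  "canonical_form m g = (case normal_form (map (map ((!) m)) g) of (s, h) \<Rightarrow>
     (renaming_sign m * s, foldr insert_row h []))"

lemma canonical_form:
  assumes "canonical_form m g = (c, k)" "renaming_sign m \<noteq> 0" "bounded_graph g"
  shows "skew_value \<mu> \<mu>1 \<mu>2 j g = of_int c * skew_value \<mu> \<mu>1 \<mu>2 j k"
proof -
  obtain s h where N: "normal_form (map (map ((!) m)) g) = (s, h)" by fastforce
  have e: "renaming_sign m = 1 \<or> renaming_sign m = - 1" using renaming_sign_cases(5)[OF assms(2)] by blast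
  have c: "c = renaming_sign m * s" "k = foldr insert_row h []"
    using assms(1) N by (simp_all add: canonical_form_def)
  have "length b = 4" if "b \<in> set (map (map ((!) m)) g)" for b
    using that assms(3) by (auto simp: bounded_graph_def)
  then have B: "brackets (map (map ((!) m)) g) = (\<lambda>p. of_int s * brackets k p)"
    using normal_form_brackets[of "map (map ((!) m)) g"] N
    by (intro ext) (simp add: c(2) brackets_sort_rows)
  have "of_int (renaming_sign m) * skew_value \<mu> \<mu>1 \<mu>2 j g = of_int s * skew_value \<mu> \<mu>1 \<mu>2 j k"
    unfolding skew_value_renaming[OF assms(2,3), symmetric]
    unfolding skew_value_def B multi_integ_linear right_diff_distrib ..
  then show ?thesis using e c(1) by auto
qed

text \<open>A graph vanishes by symmetry if two renamings turn it into the same graph with opposite signs.\<close>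

datatype hint = Vanish "nat list" | Rename "nat list"

type_synonym graph_vector = "(int \<times> graph_code) list"

definition hint_vector :: "int \<Rightarrow> graph_code \<Rightarrow> hint \<Rightarrow> graph_vector option" where
  "hint_vector c g h = (case h of
     Vanish m \<Rightarrow> (case canonical_form [0, 1, 2, 3, 4, 5, 6, 7, 8, 9] g of (s, k) \<Rightarrow>
       if s = 0 \<or> renaming_sign m \<noteq> 0 \<and> canonical_form m g = (- s, k) then Some [] else None)
   | Rename m \<Rightarrow> if renaming_sign m = 0 then None else
       (case canonical_form m g of (s, k) \<Rightarrow> Some [(c * s, k)]))"

definition vector_value :: "('a \<Rightarrow> real) \<Rightarrow> (int \<times> 'a) list \<Rightarrow> real" where
  "vector_value w v = (\<Sum>(c, i)\<leftarrow>v. of_int c * w i)"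

lemma vector_value_simps [simp]:
  "vector_value w [] = 0" "vector_value w ((c, i) # v) = of_int c * w i + vector_value w v"
  "vector_value w (u @ v) = vector_value w u + vector_value w v"
  by (simp_all add: vector_value_def)

text \<open>In the case \<open>Vanish\<close>, either some row has a repeated entry or the two
  canonical forms show that the value equals its own negative.\<close>

lemma hint_vector:
  assumes "hint_vector c g h = Some v" "bounded_graph g"
  shows "of_int c * skew_value \<mu> \<mu>1 \<mu>2 j g = vector_value (skew_value \<mu> \<mu>1 \<mu>2 j) v"
proof (cases h)
  case (Vanish m)
  obtain s k where N: "canonical_form [0, 1, 2, 3, 4, 5, 6, 7, 8, 9] g = (s, k)" by fastforce
  have "renaming_sign [0, 1, 2, 3, 4, 5, 6, 7, 8, 9] \<noteq> 0" by code_simp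
  note s = canonical_form[OF N this assms(2), of \<mu> \<mu>1 \<mu>2 j]
  have v: "v = []" "s = 0 \<or> renaming_sign m \<noteq> 0 \<and> canonical_form m g = (- s, k)"
    using assms(1) N Vanish by (auto simp: hint_vector_def split: if_splits)
  from v(2) have "skew_value \<mu> \<mu>1 \<mu>2 j g = 0"
  proof
    assume "renaming_sign m \<noteq> 0 \<and> canonical_form m g = (- s, k)"
    then show ?thesis using s canonical_form[of m g "- s" k \<mu> \<mu>1 \<mu>2 j] assms(2) by simp
  qed (use s in simp)
  then show ?thesis using v(1) by simp
next
  case (Rename m)
  obtain s k where N: "canonical_form m g = (s, k)" by fastforce
  then have "renaming_sign m \<noteq> 0" "v = [(c * s, k)]"
    using assms(1) Rename by (auto simp: hint_vector_def split: if_splits)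
  then show ?thesis using canonical_form[OF N _ assms(2)] by simp
qed

fun hint_vectors :: "graph_vector \<Rightarrow> hint list \<Rightarrow> graph_vector option" where
  "hint_vectors [] [] = Some []"
| "hint_vectors ((c, g) # ts) (h # hs) = (case hint_vector c g h of None \<Rightarrow> None
     | Some u \<Rightarrow> (case hint_vectors ts hs of None \<Rightarrow> None | Some v \<Rightarrow> Some (u @ v)))"
| "hint_vectors _ _ = None"

lemma hint_vectors:
  assumes "hint_vectors ts hs = Some v" "\<And>c g. (c, g) \<in> set ts \<Longrightarrow> bounded_graph g"
  shows "vector_value (skew_value \<mu> \<mu>1 \<mu>2 j) ts = vector_value (skew_value \<mu> \<mu>1 \<mu>2 j) v"
  using assms
proof (induction ts hs arbitrary: v rule: hint_vectors.induct)
  case (2 c g ts h hs)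
  obtain u w where uw: "hint_vector c g h = Some u" "hint_vectors ts hs = Some w" "v = u @ w"
    using "2.prems"(1) by (auto split: option.splits)
  have b: "bounded_graph g" by (rule "2.prems"(2)[of c g]) simp
  have "vector_value (skew_value \<mu> \<mu>1 \<mu>2 j) ts = vector_value (skew_value \<mu> \<mu>1 \<mu>2 j) w"
    by (rule "2.IH"[OF uw(1,2)]) (use "2.prems"(2) in auto)
  then show ?case using hint_vector[OF uw(1) b, of \<mu> \<mu>1 \<mu>2 j] uw(3) by simp
qed simp_all

text \<open>The Pluecker relation that trades the first entry \<open>e\<close> of the second row
  against each entry of the first row. The given graph must have its rows and entries arranged so
  that the wanted exchange stands in front.\<close>

fun exchange_relation :: "graph_code \<Rightarrow> (int \<times> graph_code) list" where
  "exchange_relation ([a, b, c, d] # (e # t) # g) =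
     [(1, [a, b, c, d] # (e # t) # g), (- 1, [e, b, c, d] # (a # t) # g), (- 1, [a, e, c, d] # (b # t) # g),
      (- 1, [a, b, e, d] # (c # t) # g), (- 1, [a, b, c, e] # (d # t) # g)]"
| "exchange_relation _ = []"

lemma exchange_relation:
  assumes "bounded_graph g"
  shows "vector_value (skew_value \<mu> \<mu>1 \<mu>2 j) (exchange_relation g) = 0"
proof (cases "\<exists>a b c d e f k l r. g = [a, b, c, d] # [e, f, k, l] # r")
  case True
  then obtain a b c d e f k l r where g: "g = [a, b, c, d] # [e, f, k, l] # r" by blast
  have B: "brackets ([a, b, c, d] # [e, f, k, l] # r) = (\<lambda>p. brackets ([e, b, c, d] # [a, f, k, l] # r) p
    + brackets ([a, e, c, d] # [b, f, k, l] # r) p + brackets ([a, b, e, d] # [c, f, k, l] # r) p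
    + brackets ([a, b, c, e] # [d, f, k, l] # r) p)"
    unfolding brackets_Cons bracket_det4 mult.assoc[symmetric] fun_eq_iff
    by (subst det4_exchange) (simp only: distrib_right simp_thms)
  have "skew_value \<mu> \<mu>1 \<mu>2 j ([a, b, c, d] # [e, f, k, l] # r) = skew_value \<mu> \<mu>1 \<mu>2 j ([e, b, c, d] # [a, f, k, l] # r)
    + skew_value \<mu> \<mu>1 \<mu>2 j ([a, e, c, d] # [b, f, k, l] # r) + skew_value \<mu> \<mu>1 \<mu>2 j ([a, b, e, d] # [c, f, k, l] # r)
    + skew_value \<mu> \<mu>1 \<mu>2 j ([a, b, c, e] # [d, f, k, l] # r)"
    unfolding skew_value_def B multi_integ_linear by linarith
  then show ?thesis unfolding g by simp
next
  case False
  then have "exchange_relation g = []"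
    using assms by (cases g rule: exchange_relation.cases)
      (auto simp: bounded_graph_def length_Suc_conv eval_nat_numeral)
  then show ?thesis by simp
qed

lemma exchange_relation_bounded:
  "bounded_graph g \<Longrightarrow> (c, h) \<in> set (exchange_relation g) \<Longrightarrow> bounded_graph h"
  by (cases g rule: exchange_relation.cases) (auto simp: bounded_graph_def)

section \<open>Formal sums of graphs and their span\<close>

fun cancels :: "(int \<times> 'a) list \<Rightarrow> bool" where
  "cancels [] = True"
| "cancels ((c, i) # v) = (c + (\<Sum>(d, k)\<leftarrow>v. if k = i then d else 0) = 0 \<and> cancels (filter (\<lambda>(d, k). k \<noteq> i) v))"

lemma cancels: "cancels v \<Longrightarrow> vector_value w v = 0"
proof (induction v rule: cancels.induct)
  case (2 c i v)
  have "vector_value w v = of_int (\<Sum>(d, k)\<leftarrow>v. if k = i then d else 0) * w i + vector_value w (filter (\<lambda>(d, k). k \<noteq> i) v)"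
    by (induction v) (auto simp: algebra_simps)
  then have "vector_value w ((c, i) # v) =
      of_int (c + (\<Sum>(d, k)\<leftarrow>v. if k = i then d else 0)) * w i + vector_value w (filter (\<lambda>(d, k). k \<noteq> i) v)"
    unfolding of_int_add vector_value_simps distrib_right by linarith
  moreover have "c + (\<Sum>(d, k)\<leftarrow>v. if k = i then d else 0) = 0" "cancels (filter (\<lambda>(d, k). k \<noteq> i) v)"
    using 2(2) by simp_all
  ultimately show ?case using 2(1) by simp
qed simp

definition scale_vector :: "int \<Rightarrow> (int \<times> 'a) list \<Rightarrow> (int \<times> 'a) list" where
  "scale_vector r v = map (\<lambda>(c, i). (r * c, i)) v"

lemma scale_vector: "vector_value w (scale_vector r v) = of_int r * vector_value w v"
  unfolding scale_vector_def by (induction v) (auto simp: algebra_simps)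

text \<open>The coefficients are chosen before the measures and the component, so they serve all
  functions at all points.\<close>

definition spanned :: "graph_code list \<Rightarrow> graph_code \<Rightarrow> bool" where
  "spanned B g \<longleftrightarrow> (\<exists>v::nat \<Rightarrow> real. \<forall>\<mu> \<mu>1 \<mu>2 j. skew_value \<mu> \<mu>1 \<mu>2 j g =
     (\<Sum>b<length B. v b * skew_value \<mu> \<mu>1 \<mu>2 j (B ! b)))"

lemma spanned_basis: "g \<in> set B \<Longrightarrow> spanned B g"
proof -
  assume "g \<in> set B"
  then obtain i where i: "i < length B" "g = B ! i" by (auto simp: in_set_conv_nth)
  show ?thesis unfolding spanned_def
    by (rule exI[of _ "\<lambda>b. if b = i then 1 else 0"])
      (use i in \<open>simp add: if_distrib[where f = "\<lambda>c. c * _"] cong: if_cong\<close>)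
qed

lemma spanned_vector:
  assumes "\<And>c g. (c, g) \<in> set ts \<Longrightarrow> spanned B g"
  shows "\<exists>v::nat \<Rightarrow> real. \<forall>\<mu> \<mu>1 \<mu>2 j. vector_value (skew_value \<mu> \<mu>1 \<mu>2 j) ts =
     (\<Sum>b<length B. v b * skew_value \<mu> \<mu>1 \<mu>2 j (B ! b))"
  using assms
proof (induction ts)
  case Nil
  show ?case by (rule exI[of _ "\<lambda>_. 0"]) simp
next
  case (Cons t ts)
  obtain c g where t: "t = (c, g)" by fastforce
  have "spanned B g" by (rule Cons.prems[of c]) (simp add: t)
  then obtain u where u: "\<And>\<mu> \<mu>1 \<mu>2 j. skew_value \<mu> \<mu>1 \<mu>2 j g = (\<Sum>b<length B. u b * skew_value \<mu> \<mu>1 \<mu>2 j (B ! b))"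
    unfolding spanned_def by blast
  have "\<exists>v::nat \<Rightarrow> real. \<forall>\<mu> \<mu>1 \<mu>2 j. vector_value (skew_value \<mu> \<mu>1 \<mu>2 j) ts =
     (\<Sum>b<length B. v b * skew_value \<mu> \<mu>1 \<mu>2 j (B ! b))"
    by (rule Cons.IH) (use Cons.prems in auto)
  then obtain v where v: "\<And>\<mu> \<mu>1 \<mu>2 j. vector_value (skew_value \<mu> \<mu>1 \<mu>2 j) ts =
     (\<Sum>b<length B. v b * skew_value \<mu> \<mu>1 \<mu>2 j (B ! b))" by blast
  show ?case
    by (rule exI[of _ "\<lambda>b. of_int c * u b + v b"])
      (simp add: t u v sum_distrib_left sum.distrib distrib_right mult.assoc)
qed

lemma spanned_scaled:
  assumes "\<And>\<mu> \<mu>1 \<mu>2 j. of_int d * skew_value \<mu> \<mu>1 \<mu>2 j g = vector_value (skew_value \<mu> \<mu>1 \<mu>2 j) ts" "d \<noteq> 0"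
    and "\<And>c g. (c, g) \<in> set ts \<Longrightarrow> spanned B g"
  shows "spanned B g"
proof -
  obtain v where v: "\<And>\<mu> \<mu>1 \<mu>2 j. vector_value (skew_value \<mu> \<mu>1 \<mu>2 j) ts =
     (\<Sum>b<length B. v b * skew_value \<mu> \<mu>1 \<mu>2 j (B ! b))"
    using spanned_vector[of ts B] assms(3) by blast
  have "skew_value \<mu> \<mu>1 \<mu>2 j g = (\<Sum>b<length B. (v b / of_int d) * skew_value \<mu> \<mu>1 \<mu>2 j (B ! b))" for \<mu> \<mu>1 \<mu>2 j
    using assms(1)[of \<mu> \<mu>1 \<mu>2 j] assms(2) unfolding v
    by (simp add: sum_divide_distrib[symmetric] field_simps)
  then show ?thesis unfolding spanned_def by (intro exI[of _ "\<lambda>b. v b / of_int d"]) blast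
qed

text \<open>Each certificate is an exchange relation in which, after renaming, exactly one graph
  outside \<open>K\<close> remains, with nonzero total coefficient. The relation is solved for this
  graph, which is then added to \<open>K\<close>.\<close>

fun span_closure :: "graph_code list \<Rightarrow> (graph_code \<times> hint list) list \<Rightarrow> graph_code list option" where
  "span_closure K [] = Some K"
| "span_closure K ((g, hs) # cs) = (if \<not> bounded_graph g then None else case hint_vectors (exchange_relation g) hs of
     None \<Rightarrow> None | Some v \<Rightarrow> (case filter (\<lambda>(c, k). k \<notin> set K) v of [] \<Rightarrow> None
       | (c, k) # u \<Rightarrow> if list_all (\<lambda>(d, l). l = k) u \<and> c + (\<Sum>(d, l)\<leftarrow>u. d) \<noteq> 0 then span_closure (k # K) cs else None))"

lemma span_closure:
  assumes "span_closure K cs = Some L" "\<And>k. k \<in> set K \<Longrightarrow> spanned B k" "k \<in> set L"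
  shows "spanned B k"
  using assms
proof (induction K cs arbitrary: L k rule: span_closure.induct)
  case (2 K g hs cs)
  have g: "bounded_graph g" using "2.prems"(1) by (auto split: if_splits)
  obtain v where v: "hint_vectors (exchange_relation g) hs = Some v"
    using "2.prems"(1) g by (auto split: option.splits)
  obtain c h u where u: "filter (\<lambda>(c, k). k \<notin> set K) v = (c, h) # u"
    using "2.prems"(1) g v by (auto split: list.splits)
  have c: "list_all (\<lambda>(d, l). l = h) u" "c + (\<Sum>(d, l)\<leftarrow>u. d) \<noteq> 0" "span_closure (h # K) cs = Some L"
    using "2.prems"(1) g v u by (auto split: if_splits)
  define d where "d = c + (\<Sum>(d, l)\<leftarrow>u. d)"
  define r where "r = scale_vector (- 1) (filter (\<lambda>(c, k). k \<in> set K) v)"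
  have "of_int d * skew_value \<mu> \<mu>1 \<mu>2 j h = vector_value (skew_value \<mu> \<mu>1 \<mu>2 j) r" for \<mu> \<mu>1 \<mu>2 j
  proof -
    let ?w = "skew_value \<mu> \<mu>1 \<mu>2 j"
    have "vector_value ?w (exchange_relation g) = vector_value ?w v"
      by (rule hint_vectors[OF v]) (rule exchange_relation_bounded[OF g])
    then have "vector_value ?w v = 0" using exchange_relation[OF g] by simp
    moreover have "vector_value ?w v = vector_value ?w (filter (\<lambda>(c, k). k \<notin> set K) v)
        + vector_value ?w (filter (\<lambda>(c, k). k \<in> set K) v)"
      by (induction v) auto
    moreover have "vector_value ?w u = of_int (\<Sum>(d, l)\<leftarrow>u. d) * ?w h"
      using c(1) by (induction u) (auto simp: distrib_right)
    ultimately show ?thesis unfolding u d_def r_def scale_vector by (simp add: distrib_right)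
  qed
  moreover have "d \<noteq> 0" using c(2) unfolding d_def .
  moreover have "spanned B k" if "(c, k) \<in> set r" for c k
    using that "2.prems"(2) unfolding r_def scale_vector_def by auto
  ultimately have "spanned B h" by (rule spanned_scaled)
  then have h: "\<And>k. k \<in> set (h # K) \<Longrightarrow> spanned B k" using "2.prems"(2) by auto
  show ?case
    by (rule "2.IH"[OF _ v u refl _ c(3) h "2.prems"(3)]) (use g c in auto)
qed auto

fun relation_vectors :: "(int \<times> graph_code \<times> hint list) list \<Rightarrow> graph_vector option" where
  "relation_vectors [] = Some []"
| "relation_vectors ((c, g, hs) # rs) = (if \<not> bounded_graph g then None else case hint_vectors (exchange_relation g) hs of
     None \<Rightarrow> None | Some v \<Rightarrow> (case relation_vectors rs of None \<Rightarrow> None | Some u \<Rightarrow> Some (scale_vector c v @ u)))"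

lemma relation_vectors: "relation_vectors rs = Some u \<Longrightarrow> vector_value (skew_value \<mu> \<mu>1 \<mu>2 j) u = 0"
proof (induction rs arbitrary: u rule: relation_vectors.induct)
  case (2 c g hs rs)
  have g: "bounded_graph g" using "2.prems" by (auto split: if_splits)
  obtain v w where v: "hint_vectors (exchange_relation g) hs = Some v" "relation_vectors rs = Some w"
    "u = scale_vector c v @ w"
    using "2.prems" g by (auto split: option.splits)
  have "vector_value (skew_value \<mu> \<mu>1 \<mu>2 j) (exchange_relation g) = vector_value (skew_value \<mu> \<mu>1 \<mu>2 j) v"
    by (rule hint_vectors[OF v(1)]) (rule exchange_relation_bounded[OF g])
  then show ?case using exchange_relation[OF g] "2.IH"[OF _ v(1,2)] g by (simp add: v(3) scale_vector)
qed simp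

section \<open>Certificates\<close>

definition shifted_ham :: "graph_code \<Rightarrow> graph_vector" where
  "shifted_ham H = map (\<lambda>v. (1, [0, v, 6, 9] # map (map shift_vertex) H)) [1, 2, 4, 5, 7, 8]"

text \<open>
  A certificate \<open>(H, hs, d, nb, rs, f, e)\<close> expresses \<open>d\<close> times the bracket of \<open>P\<close> with \<open>H\<close> in the basis
  by \<open>nb\<close>, in which the basis graph \<open>f\<close>, absent from the other certificates, has the coefficient \<open>e\<close>.
\<close>

type_synonym ham_cert = "graph_code \<times> hint list \<times> int \<times> (int \<times> nat) list \<times>
  (int \<times> graph_code \<times> hint list) list \<times> nat \<times> int"

text \<open>The coordinates in which the equations of the tests are written. Many entries, as
  written, are not micro-graphs; the reduction by exchange relations leaves that class.\<close>

definition basis_graphs :: "graph_code list" where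
  "basis_graphs =
   [[[0,1,4,7],[1,2,5,8],[1,3,6,9]], [[0,1,4,7],[1,2,5,8],[1,5,6,9]], [[0,1,4,7],[1,2,5,8],[3,4,6,9]], [[0,1,4,7],[1,
   2,5,8],[4,5,6,9]], [[0,1,4,7],[1,2,5,8],[4,6,8,9]], [[0,1,4,7],[1,5,6,8],[1,5,6,9]], [[0,1,4,7],[1,5,6,8],[1,5,8,
   9]], [[0,1,4,7],[1,5,6,8],[2,4,5,9]], [[0,1,4,7],[1,5,6,8],[4,5,8,9]], [[0,1,4,7],[1,5,6,8],[2,5,7,9]], [[0,1,4,7],
   [1,5,6,8],[5,6,7,9]], [[0,1,4,7],[1,5,6,8],[5,7,8,9]], [[0,1,4,7],[2,4,5,8],[3,4,6,9]], [[0,1,4,7],[2,4,5,8],[4,5,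
   6,9]], [[0,1,4,7],[2,4,5,8],[4,6,8,9]], [[0,1,4,7],[2,4,5,8],[3,6,7,9]], [[0,1,4,7],[2,4,5,8],[5,6,7,9]], [[0,1,4,
   7],[2,4,5,8],[6,7,8,9]], [[0,1,4,7],[4,5,6,8],[4,5,6,9]], [[0,1,4,7],[4,5,6,8],[4,5,8,9]], [[0,1,4,7],[4,5,6,8],[5,
   6,7,9]], [[0,1,4,7],[4,5,6,8],[5,7,8,9]], [[0,1,4,7],[4,5,8,9],[4,6,8,9]], [[0,1,4,7],[4,5,8,9],[5,6,7,8]], [[0,1,
   4,7],[1,2,5,8],[2,3,6,9]], [[0,1,4,7],[1,2,5,8],[2,5,6,9]], [[0,1,4,7],[2,3,5,8],[2,5,6,9]], [[0,1,4,7],[2,5,6,8],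
   [2,5,6,9]], [[0,1,4,7],[2,5,6,8],[2,5,8,9]], [[0,1,4,7],[2,4,5,8],[3,5,6,9]], [[0,1,4,7],[2,5,6,8],[4,5,8,9]], [[0,
   1,4,7],[2,4,5,8],[3,6,8,9]], [[0,1,4,7],[2,5,6,8],[5,6,7,9]], [[0,1,4,7],[1,4,5,8],[2,4,6,9]], [[0,1,4,7],[1,4,5,
   8],[4,5,6,9]], [[0,1,4,7],[1,4,5,8],[4,6,8,9]], [[0,1,4,7],[1,4,5,8],[2,6,7,9]], [[0,1,4,7],[1,4,5,8],[6,7,8,9]],
   [[0,4,5,7],[1,2,4,8],[1,3,6,9]], [[0,4,5,7],[1,2,6,8],[1,4,8,9]], [[0,4,5,7],[1,2,4,8],[1,4,6,9]], [[0,4,5,7],[1,4,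
   6,8],[1,4,6,9]], [[0,4,5,7],[1,4,6,8],[1,4,8,9]], [[0,4,5,7],[1,4,5,8],[2,4,6,9]], [[0,4,5,7],[1,4,6,8],[4,5,8,9]],
   [[0,4,5,7],[1,4,6,8],[2,4,7,9]], [[0,4,5,7],[1,4,6,8],[4,6,7,9]], [[0,4,5,7],[1,4,6,8],[4,7,8,9]], [[0,4,5,7],[1,2,
   4,8],[1,6,8,9]], [[0,4,5,7],[1,4,6,8],[1,6,8,9]], [[0,4,5,7],[1,4,5,8],[2,6,8,9]], [[0,4,5,7],[1,6,8,9],[4,6,7,8]],
   [[0,4,5,7],[1,4,8,9],[4,5,6,8]], [[0,4,5,7],[1,4,7,8],[4,5,6,9]], [[0,4,5,7],[4,5,6,8],[4,6,7,9]], [[0,4,5,7],[4,5,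
   6,8],[4,7,8,9]], [[0,4,5,7],[4,5,8,9],[4,6,8,9]], [[0,4,5,7],[1,4,7,8],[2,6,7,9]], [[0,4,5,7],[1,6,7,8],[4,6,7,9]],
   [[0,4,5,7],[1,4,7,8],[4,6,7,9]], [[0,4,5,7],[4,6,7,8],[4,6,7,9]], [[0,4,5,7],[4,6,7,8],[4,7,8,9]], [[0,4,5,7],[1,4,
   7,8],[6,7,8,9]], [[0,4,5,7],[4,6,7,8],[6,7,8,9]]]"

text \<open>The order matters: a relation may use the graphs gained from the earlier ones.\<close>

definition span_certs :: "(graph_code \<times> hint list) list" where
  "span_certs =
   [([[0,1,4,7],[5,1,6,8],[4,5,6,9]], [Rename [0,1,2,3,4,5,6,7,8,9], Rename [0,1,2,3,5,6,4,8,7,9], Vanish [0,1,2,3,4,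
   5,6,7,8,9], Rename [0,1,2,3,5,4,6,7,8,9], Vanish [0,1,2,3,4,5,6,8,7,9]]), ([[0,1,4,7],[5,2,6,8],[4,5,6,9]],
   [Rename [0,1,2,3,4,5,6,7,8,9], Rename [0,2,1,3,5,6,4,8,7,9], Vanish [0,2,1,3,4,5,6,7,8,9], Rename [0,1,2,3,5,4,6,7,
   8,9], Vanish [0,1,2,3,4,5,6,8,7,9]]), ([[4,6,8,9],[7,0,4,5],[5,7,8,9]], [Rename [0,1,2,3,4,5,6,7,8,9], Vanish [0,1,
   2,3,4,5,6,7,8,9], Vanish [0,1,2,3,5,4,6,7,8,9], Rename [0,1,2,3,4,5,6,8,7,9], Rename [0,1,2,3,4,5,6,8,9,7]]), ([[0,
   4,5,7],[6,7,8,9],[4,5,6,8]], [Rename [0,1,2,3,4,5,6,7,8,9], Vanish [0,1,2,3,4,5,6,8,7,9], Rename [0,1,2,3,6,4,5,7,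
   8,9], Rename [0,1,2,3,4,6,5,7,8,9], Vanish [0,1,2,3,4,5,6,7,8,9]]), ([[0,4,5,7],[8,4,5,9],[6,7,8,9]], [Rename [0,1,
   2,3,4,5,6,7,8,9], Rename [0,1,2,3,4,5,6,8,9,7], Vanish [0,1,2,3,4,5,6,7,8,9], Vanish [0,1,2,3,4,5,6,7,8,9],
   Rename [0,1,2,3,4,5,6,8,7,9]]), ([[0,1,4,7],[5,1,6,8],[5,7,8,9]], [Rename [0,1,2,3,4,5,6,7,8,9], Rename [0,1,2,3,6,
   5,4,8,7,9], Vanish [0,1,2,3,4,5,6,7,8,9], Vanish [0,1,2,3,6,5,4,7,8,9], Rename [0,1,2,3,5,4,6,7,8,9]]), ([[0,1,4,
   7],[5,4,6,8],[4,5,6,9]], [Rename [0,1,2,3,4,5,6,7,8,9], Rename [0,1,2,3,4,6,5,8,7,9], Rename [0,1,2,3,4,5,6,7,8,9],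
   Vanish [0,1,2,3,4,5,6,7,8,9], Vanish [0,1,2,3,4,5,6,8,7,9]]), ([[5,6,7,9],[4,0,1,7],[4,5,6,8]], [Rename [0,1,2,3,4,
   5,6,7,8,9], Rename [0,1,2,3,5,4,6,7,8,9], Rename [0,1,2,3,5,6,4,7,8,9], Vanish [0,1,2,3,4,5,6,7,8,9], Rename [0,1,
   2,3,7,8,9,4,6,5]]), ([[1,4,5,8],[6,2,8,9],[0,4,5,7]], [Rename [0,1,2,3,4,5,6,7,8,9], Vanish [0,2,1,3,4,5,6,7,8,9],
   Rename [0,1,2,3,5,4,6,7,8,9], Rename [0,1,2,3,4,5,6,7,8,9], Vanish [0,1,2,3,4,5,6,7,8,9]]), ([[0,4,5,7],[6,1,8,9],
   [4,5,6,8]], [Rename [0,1,2,3,4,5,6,7,8,9], Rename [0,1,2,3,7,8,9,6,4,5], Rename [0,1,2,3,6,4,5,7,8,9], Rename [0,1,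
   2,3,4,6,5,7,8,9], Vanish [0,1,2,3,4,5,6,9,8,7]]), ([[1,6,8,9],[4,5,6,8],[0,4,5,7]], [Rename [0,1,2,3,4,5,6,7,8,9],
   Rename [0,1,2,3,5,4,6,7,8,9], Vanish [0,1,2,3,4,5,6,7,8,9], Vanish [0,1,2,3,4,5,6,7,8,9], Rename [0,1,2,3,4,5,6,7,
   8,9]]), ([[1,6,8,9],[7,0,4,5],[4,7,8,9]], [Rename [0,1,2,3,4,5,6,7,8,9], Rename [0,1,2,3,4,5,6,7,8,9], Vanish [0,1,
   2,3,4,6,5,7,8,9], Rename [0,1,2,3,4,5,6,8,7,9], Rename [0,1,2,3,4,5,6,8,9,7]]), ([[0,4,5,7],[8,4,7,9],[1,6,8,9]],
   [Rename [0,1,2,3,4,5,6,7,8,9], Rename [0,1,2,3,7,9,8,5,6,4], Vanish [0,1,2,3,4,5,6,7,8,9], Rename [0,1,2,3,7,9,8,5,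
   4,6], Vanish [0,1,2,3,4,5,6,7,8,9]]), ([[1,4,6,8],[5,6,7,9],[0,4,5,7]], [Rename [0,1,2,3,4,5,6,7,8,9], Rename [0,1,
   2,3,4,5,6,7,9,8], Rename [0,1,2,3,5,4,6,7,8,9], Vanish [0,1,2,3,4,5,6,7,8,9], Vanish [0,1,2,3,4,5,6,7,9,8]]), ([[0,
   4,5,7],[6,4,5,8],[4,6,7,9]], [Rename [0,1,2,3,4,5,6,7,8,9], Rename [0,1,2,3,4,5,6,8,7,9], Vanish [0,1,2,3,4,5,6,7,
   8,9], Vanish [0,1,2,3,4,5,6,7,8,9], Vanish [0,1,2,3,4,6,5,7,9,8]]), ([[0,4,5,7],[6,4,7,9],[4,5,6,8]], [Rename [0,1,
   2,3,4,5,6,7,8,9], Rename [0,1,2,3,7,8,9,4,6,5], Vanish [0,1,2,3,4,5,6,7,8,9], Rename [0,1,2,3,4,6,5,7,8,9],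
   Vanish [0,1,2,3,4,5,6,7,8,9]]), ([[0,4,5,7],[6,5,8,9],[1,4,6,8]], [Rename [0,1,2,3,4,5,6,7,8,9], Rename [0,1,2,3,8,
   7,9,6,4,5], Rename [0,1,2,3,6,5,4,7,8,9], Vanish [0,1,2,3,4,5,6,7,8,9], Vanish [0,1,2,3,4,5,6,9,8,7]]), ([[0,4,5,
   7],[8,4,5,9],[4,6,8,9]], [Rename [0,1,2,3,4,5,6,7,8,9], Rename [0,1,2,3,4,5,6,9,8,7], Vanish [0,1,2,3,4,5,6,7,8,9],
   Vanish [0,1,2,3,4,5,6,7,8,9], Rename [0,1,2,3,4,5,6,9,7,8]]), ([[0,4,5,7],[6,4,7,8],[5,6,8,9]], [Rename [0,1,2,3,4,
   5,6,7,8,9], Rename [0,1,2,3,7,8,9,5,4,6], Vanish [0,1,2,3,4,5,6,7,8,9], Rename [0,1,2,3,4,6,5,7,8,9], Vanish [0,1,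
   2,3,4,5,6,7,8,9]]), ([[1,2,5,8],[4,5,6,9],[0,1,4,7]], [Rename [0,1,2,3,4,5,6,7,8,9], Rename [0,1,2,3,4,5,6,7,9,8],
   Rename [0,1,2,3,4,5,6,7,8,9], Vanish [0,1,2,3,4,5,6,7,8,9], Vanish [0,1,2,3,4,5,6,7,9,8]]), ([[1,2,5,8],[4,6,8,9],
   [0,1,4,7]], [Rename [0,1,2,3,4,5,6,7,8,9], Rename [0,1,2,3,7,9,8,4,5,6], Rename [0,1,2,3,4,5,6,7,8,9], Vanish [0,1,
   2,3,4,6,5,7,8,9], Vanish [0,1,2,3,4,5,6,7,8,9]]), ([[5,6,7,9],[4,0,1,7],[1,5,6,8]], [Rename [0,1,2,3,4,5,6,7,8,9],
   Rename [0,1,2,3,6,4,5,7,8,9], Rename [0,1,2,3,6,5,4,7,8,9], Vanish [0,1,2,3,4,5,6,7,8,9], Rename [0,1,2,3,9,7,8,4,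
   6,5]]), ([[5,6,7,9],[4,0,1,7],[2,4,5,8]], [Rename [0,1,2,3,4,5,6,7,8,9], Rename [0,1,2,3,5,4,6,7,8,9], Rename [0,1,
   2,3,5,6,4,7,8,9], Vanish [0,1,2,3,4,5,6,7,8,9], Rename [0,1,2,3,7,8,9,4,6,5]]), ([[0,1,4,7],[5,2,6,8],[5,7,8,9]],
   [Rename [0,1,2,3,4,5,6,7,8,9], Rename [0,2,1,3,6,5,4,8,7,9], Vanish [0,2,1,3,4,5,6,7,8,9], Vanish [0,1,2,3,6,5,4,7,
   8,9], Rename [0,1,2,3,5,4,6,7,8,9]]), ([[0,1,4,7],[6,7,8,9],[2,4,5,8]], [Rename [0,1,2,3,4,5,6,7,8,9], Vanish [0,2,
   1,3,4,6,5,8,7,9], Rename [0,2,1,3,4,6,5,7,8,9], Rename [0,1,2,3,5,6,4,7,8,9], Vanish [0,1,2,3,4,5,6,7,8,9]]), ([[0,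
   4,5,7],[1,4,6,8],[2,7,8,9]], [Rename [0,1,2,3,4,5,6,7,8,9], Rename [0,1,2,3,4,6,5,8,7,9], Vanish [0,1,2,3,4,5,6,7,
   8,9], Vanish [0,1,2,3,4,6,5,7,8,9], Rename [0,1,2,3,4,5,6,7,8,9]]), ([[0,1,4,7],[5,4,8,9],[4,5,6,8]], [Rename [0,1,
   2,3,4,5,6,7,8,9], Rename [0,1,2,3,7,8,9,6,4,5], Rename [0,1,2,3,4,5,6,7,8,9], Vanish [0,1,2,3,4,5,6,7,8,9],
   Vanish [0,1,2,3,4,5,6,9,8,7]]), ([[4,5,6,8],[7,5,8,9],[0,1,4,7]], [Rename [0,1,2,3,4,5,6,7,8,9], Rename [0,1,2,3,4,
   5,6,7,8,9], Vanish [0,1,2,3,4,5,6,7,8,9], Rename [0,1,2,3,4,5,6,7,8,9], Vanish [0,1,2,3,4,5,6,7,8,9]]), ([[0,4,5,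
   7],[1,4,7,8],[5,6,8,9]], [Rename [0,1,2,3,4,5,6,7,8,9], Rename [0,1,2,3,7,8,9,4,5,6], Vanish [0,1,2,3,4,5,6,7,8,9],
   Rename [0,1,2,3,4,5,6,7,8,9], Vanish [0,1,2,3,4,5,6,7,8,9]]), ([[2,5,6,8],[0,1,4,7],[2,5,6,9]], [Rename [0,1,2,3,4,
   5,6,7,8,9], Rename [0,2,1,3,6,4,5,8,7,9], Rename [0,2,1,3,6,5,4,9,7,8], Rename [0,2,1,3,6,4,5,9,7,8], Vanish [0,1,
   2,3,4,5,6,8,7,9]]), ([[1,2,4,8],[5,1,6,9],[0,4,5,7]], [Rename [0,1,2,3,4,5,6,7,8,9], Vanish [0,1,2,3,4,5,6,7,8,9],
   Rename [0,1,2,3,4,5,6,7,9,8], Rename [0,1,2,3,5,4,6,7,8,9], Vanish [0,1,2,3,4,5,6,7,9,8]]), ([[0,1,4,7],[5,4,6,9],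
   [1,2,5,8]], [Rename [0,1,2,3,4,5,6,7,8,9], Rename [0,1,2,3,4,6,5,9,8,7], Rename [0,1,2,3,5,4,6,7,8,9], Vanish [0,1,
   2,3,4,5,6,7,8,9], Vanish [0,1,2,3,4,5,6,9,8,7]]), ([[0,1,4,7],[5,4,8,9],[2,5,6,8]], [Rename [0,1,2,3,4,5,6,7,8,9],
   Rename [0,2,1,3,7,8,9,6,4,5], Rename [0,2,1,3,5,4,6,7,8,9], Vanish [0,1,2,3,4,5,6,7,8,9], Vanish [0,1,2,3,4,5,6,9,
   8,7]]), ([[2,5,6,8],[4,0,1,7],[4,5,8,9]], [Rename [0,1,2,3,4,5,6,7,8,9], Vanish [0,2,1,3,4,5,6,7,8,9], Rename [0,1,
   2,3,5,4,6,7,8,9], Rename [0,1,2,3,5,6,4,7,8,9], Rename [0,1,2,3,7,8,9,5,4,6]]), ([[5,6,7,9],[0,1,4,7],[2,5,6,8]],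
   [Rename [0,1,2,3,4,5,6,7,8,9], Rename [0,1,2,3,9,8,7,4,6,5], Rename [0,1,2,3,9,7,8,4,6,5], Vanish [0,1,2,3,4,5,6,7,
   8,9], Rename [0,2,1,3,6,4,5,7,8,9]]), ([[1,4,6,8],[5,2,7,9],[0,4,5,7]], [Rename [0,1,2,3,4,5,6,7,8,9], Vanish [0,2,
   1,3,4,5,6,7,8,9], Rename [0,1,2,3,5,4,6,7,8,9], Rename [0,1,2,3,4,5,6,7,8,9], Vanish [0,1,2,3,4,5,6,7,9,8]]), ([[0,
   1,4,7],[5,6,7,9],[2,4,5,8]], [Rename [0,1,2,3,4,5,6,7,8,9], Rename [0,1,2,3,8,9,7,4,6,5], Rename [0,2,1,3,4,5,6,7,
   8,9], Rename [0,1,2,3,5,4,6,7,8,9], Vanish [0,1,2,3,4,5,6,7,8,9]]), ([[5,6,7,9],[1,0,4,7],[2,5,6,8]], [Rename [0,1,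
   2,3,4,5,6,7,8,9], Rename [0,2,1,3,5,4,6,7,8,9], Rename [0,2,1,3,5,6,4,7,8,9], Vanish [0,1,2,3,4,5,6,7,8,9],
   Rename [0,1,2,3,7,8,9,4,6,5]]), ([[6,7,8,9],[0,1,4,7],[1,4,5,8]], [Rename [0,1,2,3,4,5,6,7,8,9], Vanish [0,1,2,3,4,
   6,5,8,7,9], Vanish [0,1,2,3,4,5,6,7,8,9], Rename [0,1,2,3,8,9,7,4,6,5], Rename [0,1,2,3,8,9,7,4,5,6]]), ([[0,1,4,
   7],[5,4,8,9],[1,5,6,8]], [Rename [0,1,2,3,4,5,6,7,8,9], Rename [0,1,2,3,7,8,9,6,4,5], Rename [0,1,2,3,5,4,6,7,8,9],
   Vanish [0,1,2,3,4,5,6,7,8,9], Vanish [0,1,2,3,4,5,6,9,8,7]]), ([[5,6,7,9],[0,1,4,7],[1,5,6,8]], [Rename [0,1,2,3,4,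
   5,6,7,8,9], Rename [0,1,2,3,9,8,7,4,6,5], Rename [0,1,2,3,9,7,8,4,6,5], Vanish [0,1,2,3,4,5,6,7,8,9], Rename [0,1,
   2,3,6,4,5,7,8,9]]), ([[1,4,5,8],[6,1,7,9],[0,4,5,7]], [Rename [0,1,2,3,4,5,6,7,8,9], Vanish [0,1,2,3,4,5,6,7,8,9],
   Rename [0,1,2,3,5,4,6,7,8,9], Rename [0,1,2,3,4,5,6,7,8,9], Vanish [0,1,2,3,4,5,6,7,9,8]]), ([[5,7,8,9],[0,1,4,7],
   [1,5,6,8]], [Rename [0,1,2,3,4,5,6,7,8,9], Vanish [0,1,2,3,6,5,4,8,7,9], Vanish [0,1,2,3,4,5,6,7,8,9], Rename [0,1,
   2,3,8,7,9,4,6,5], Rename [0,1,2,3,8,7,9,4,5,6]]), ([[5,6,7,9],[1,0,4,7],[1,5,6,8]], [Rename [0,1,2,3,4,5,6,7,8,9],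
   Rename [0,1,2,3,5,4,6,7,8,9], Rename [0,1,2,3,5,6,4,7,8,9], Vanish [0,1,2,3,4,5,6,7,8,9], Rename [0,1,2,3,7,8,9,4,
   6,5]]), ([[1,4,6,8],[5,4,8,9],[0,4,5,7]], [Rename [0,1,2,3,4,5,6,7,8,9], Rename [0,1,2,3,4,5,6,7,8,9], Vanish [0,1,
   2,3,4,5,6,7,8,9], Rename [0,1,2,3,4,5,6,7,8,9], Vanish [0,1,2,3,4,5,6,7,8,9]]), ([[0,4,5,7],[6,4,7,9],[1,4,6,8]],
   [Rename [0,1,2,3,4,5,6,7,8,9], Rename [0,1,2,3,7,9,8,4,6,5], Vanish [0,1,2,3,4,5,6,7,8,9], Rename [0,1,2,3,4,6,5,7,
   8,9], Vanish [0,1,2,3,4,5,6,7,8,9]]), ([[0,4,5,7],[8,4,7,9],[1,4,6,8]], [Rename [0,1,2,3,4,5,6,7,8,9], Rename [0,1,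
   2,3,7,9,8,4,6,5], Vanish [0,1,2,3,4,5,6,7,8,9], Rename [0,1,2,3,7,9,8,5,4,6], Vanish [0,1,2,3,4,5,6,7,8,9]]), ([[1,
   6,7,8],[4,5,7,9],[0,4,5,7]], [Rename [0,1,2,3,4,5,6,7,8,9], Rename [0,1,2,3,5,4,6,7,9,8], Rename [0,1,2,3,4,5,6,7,
   8,9], Vanish [0,1,2,3,4,5,6,7,8,9], Vanish [0,1,2,3,4,5,6,7,9,8]]), ([[4,5,8,9],[0,1,4,7],[4,6,8,9]], [Rename [0,1,
   2,3,4,5,6,7,8,9], Vanish [0,1,2,3,4,5,6,7,8,9], Rename [0,1,2,3,7,8,9,6,4,5], Rename [0,1,2,3,4,5,6,9,8,7],
   Rename [0,1,2,3,4,5,6,9,7,8]]), ([[0,4,5,7],[8,2,6,9],[1,4,5,8]], [Rename [0,1,2,3,4,5,6,7,8,9], Rename [0,2,1,3,5,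
   6,4,9,8,7], Rename [0,1,2,3,8,7,9,5,4,6], Rename [0,1,2,3,7,8,9,5,4,6], Vanish [0,1,2,3,4,5,6,9,8,7]]), ([[0,4,5,
   7],[9,1,6,8],[4,6,7,8]], [Rename [0,1,2,3,4,5,6,7,8,9], Rename [0,1,2,3,5,6,4,8,7,9], Rename [0,1,2,3,8,7,9,4,6,5],
   Rename [0,1,2,3,7,9,8,4,6,5], Rename [0,1,2,3,4,5,6,8,9,7]]), ([[1,6,8,9],[4,0,5,7],[4,6,8,9]], [Rename [0,1,2,3,4,
   5,6,7,8,9], Rename [0,1,2,3,5,4,6,7,8,9], Rename [0,1,2,3,6,5,4,7,8,9], Rename [0,1,2,3,8,7,9,5,4,6], Rename [0,1,
   2,3,8,7,9,5,6,4]]), ([[0,4,5,7],[8,1,6,9],[4,5,7,8]], [Rename [0,1,2,3,4,5,6,7,8,9], Rename [0,1,2,3,5,6,4,8,9,7],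
   Rename [0,1,2,3,8,7,9,4,5,6], Rename [0,1,2,3,7,8,9,4,5,6], Rename [0,1,2,3,4,5,6,8,7,9]]), ([[0,4,5,7],[8,5,6,9],
   [1,4,7,8]], [Rename [0,1,2,3,4,5,6,7,8,9], Rename [0,1,2,3,6,4,5,8,9,7], Rename [0,1,2,3,8,7,9,4,5,6], Vanish [0,1,
   2,3,4,5,6,7,8,9], Rename [0,1,2,3,4,5,6,8,7,9]]), ([[0,4,5,7],[1,4,5,8],[6,7,8,9]], [Rename [0,1,2,3,4,5,6,7,8,9],
   Rename [0,1,2,3,4,5,6,8,7,9], Vanish [0,1,2,3,4,5,6,7,8,9], Vanish [0,1,2,3,4,5,6,7,8,9], Rename [0,1,2,3,4,5,6,7,
   8,9]]), ([[4,6,7,8],[5,7,8,9],[0,1,4,5]], [Rename [0,1,2,3,4,5,6,7,8,9], Rename [0,1,2,3,5,4,6,7,8,9], Rename [0,1,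
   2,3,4,5,6,7,8,9], Vanish [0,1,2,3,4,5,6,7,8,9], Vanish [0,1,2,3,4,5,6,7,8,9]]), ([[4,5,8,9],[7,0,1,4],[5,6,7,8]],
   [Rename [0,1,2,3,4,5,6,7,8,9], Vanish [0,1,2,3,4,5,6,7,8,9], Rename [0,1,2,3,5,4,6,7,8,9], Rename [0,1,2,3,4,5,6,8,
   7,9], Rename [0,1,2,3,4,5,6,8,9,7]]), ([[0,4,5,7],[1,6,8,9],[4,5,8,9]], [Rename [0,1,2,3,4,5,6,7,8,9], Rename [0,1,
   2,3,8,9,7,6,4,5], Rename [0,1,2,3,5,4,6,7,8,9], Rename [0,1,2,3,4,5,6,7,8,9], Rename [0,1,2,3,4,5,6,9,7,8]]), ([[0,
   4,5,7],[8,4,5,9],[1,6,8,9]], [Rename [0,1,2,3,4,5,6,7,8,9], Rename [0,1,2,3,4,5,6,9,8,7], Vanish [0,1,2,3,4,5,6,7,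
   8,9], Vanish [0,1,2,3,4,5,6,7,8,9], Rename [0,1,2,3,4,5,6,9,7,8]]), ([[1,6,8,9],[4,5,8,9],[0,4,5,7]], [Rename [0,1,
   2,3,4,5,6,7,8,9], Rename [0,1,2,3,5,4,6,7,8,9], Rename [0,1,2,3,4,5,6,7,8,9], Vanish [0,1,2,3,4,5,6,7,8,9],
   Vanish [0,1,2,3,4,5,6,7,8,9]]), ([[5,7,8,9],[4,1,6,8],[0,4,5,7]], [Rename [0,1,2,3,4,5,6,7,8,9], Rename [0,1,2,3,5,
   4,6,7,8,9], Rename [0,1,2,3,4,5,6,7,8,9], Vanish [0,1,2,3,4,5,6,7,8,9], Rename [0,1,2,3,4,5,6,7,8,9]]), ([[1,4,8,
   9],[5,0,4,7],[5,6,8,9]], [Rename [0,1,2,3,4,5,6,7,8,9], Rename [0,1,2,3,4,5,6,7,8,9], Vanish [0,1,2,3,4,5,6,7,8,9],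
   Rename [0,1,2,3,7,8,9,5,4,6], Rename [0,1,2,3,7,8,9,5,6,4]]), ([[1,6,8,9],[4,6,7,8],[0,4,5,7]], [Rename [0,1,2,3,4,
   5,6,7,8,9], Rename [0,1,2,3,4,5,6,7,8,9], Vanish [0,1,2,3,4,5,6,7,8,9], Vanish [0,1,2,3,4,5,6,7,8,9], Rename [0,1,
   2,3,4,5,6,7,8,9]])]"

text \<open>In the reverse order of \<open>span_certs\<close>, since \<open>span_closure\<close>
  puts each new graph in front.\<close>

definition further_graphs :: "graph_code list" where
  "further_graphs =
   [[[0,4,5,7],[1,4,6,8],[6,7,8,9]], [[0,4,5,7],[1,6,7,8],[4,6,8,9]], [[0,4,5,7],[1,4,6,8],[5,7,8,9]], [[0,4,5,7],[1,
   4,8,9],[5,6,8,9]], [[0,4,5,7],[1,6,7,8],[4,5,8,9]], [[0,4,5,7],[1,6,8,9],[4,5,8,9]], [[0,1,4,7],[4,5,8,9],[5,6,8,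
   9]], [[0,1,4,5],[4,6,7,8],[5,7,8,9]], [[0,1,4,5],[4,5,7,8],[6,7,8,9]], [[0,4,5,7],[1,4,5,8],[6,7,8,9]], [[0,4,5,7],
   [1,6,8,9],[4,5,7,8]], [[0,1,4,7],[5,6,8,9],[5,6,8,9]], [[0,4,5,7],[1,6,8,9],[4,6,8,9]], [[0,4,5,7],[1,4,7,8],[2,6,
   8,9]], [[0,4,5,7],[1,4,8,9],[4,6,7,8]], [[0,4,5,7],[1,6,7,8],[4,5,7,9]], [[0,4,5,7],[1,4,7,8],[5,6,7,9]], [[0,4,5,
   7],[1,4,5,8],[4,6,7,9]], [[0,4,5,7],[1,4,5,8],[4,6,8,9]], [[0,4,5,7],[1,4,8,9],[1,6,8,9]], [[0,4,5,7],[1,4,6,8],[1,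
   6,7,9]], [[0,4,5,7],[1,4,6,8],[1,5,7,9]], [[0,4,5,7],[1,4,5,8],[1,6,7,9]], [[0,4,5,7],[1,4,8,9],[1,6,7,8]], [[0,4,
   5,7],[1,4,6,8],[1,5,8,9]], [[0,4,5,7],[1,4,6,8],[2,6,7,9]], [[0,4,5,7],[1,4,8,9],[2,6,8,9]], [[0,4,5,7],[1,4,6,8],
   [2,5,7,9]], [[0,4,5,7],[1,4,5,8],[2,6,7,9]], [[0,1,4,7],[2,5,6,8],[5,6,8,9]], [[0,4,5,7],[1,4,8,9],[2,6,7,8]], [[0,
   4,5,7],[1,2,6,8],[1,4,6,9]], [[0,4,5,7],[1,2,4,8],[1,5,6,9]], [[0,4,5,7],[1,2,6,8],[1,4,5,9]], [[0,4,5,7],[1,4,7,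
   8],[5,6,8,9]], [[0,1,4,7],[4,5,7,8],[5,6,8,9]], [[0,4,5,7],[1,6,7,8],[4,7,8,9]], [[0,1,4,5],[2,7,8,9],[4,6,7,8]],
   [[0,4,5,7],[1,4,6,8],[2,7,8,9]], [[0,1,4,7],[2,5,6,8],[5,7,8,9]], [[0,1,4,5],[2,6,7,8],[4,7,8,9]], [[0,1,4,7],[1,4,
   5,8],[5,6,7,9]], [[0,1,4,7],[1,4,5,8],[2,6,8,9]], [[0,1,4,7],[1,4,5,8],[2,5,6,9]], [[0,4,5,7],[4,6,7,8],[5,6,8,9]],
   [[0,4,5,7],[4,5,8,9],[4,6,7,8]], [[0,4,5,7],[1,4,8,9],[6,7,8,9]], [[0,4,5,7],[4,7,8,9],[6,7,8,9]], [[0,4,5,7],[4,5,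
   6,8],[4,6,8,9]], [[0,4,5,7],[1,6,7,8],[4,5,6,9]], [[0,4,5,7],[1,4,6,8],[5,6,7,9]], [[0,4,5,7],[1,6,8,9],[4,7,8,9]],
   [[0,4,5,7],[1,4,6,8],[5,6,8,9]], [[0,4,5,7],[1,6,8,9],[4,5,6,8]], [[0,4,5,7],[1,4,6,8],[2,5,8,9]], [[0,1,4,5],[4,7,
   8,9],[6,7,8,9]], [[0,4,5,7],[1,4,6,8],[4,5,6,9]], [[0,1,4,5],[1,6,7,8],[4,7,8,9]], [[0,4,5,7],[4,5,8,9],[6,7,8,9]],
   [[0,4,5,7],[4,5,6,8],[6,7,8,9]], [[0,4,5,7],[4,6,8,9],[5,7,8,9]], [[0,1,4,7],[2,5,6,8],[4,5,6,9]], [[0,1,4,7],[1,5,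
   6,8],[4,5,6,9]]]"

text \<open>Aligned with \<open>field_descendants\<close>, to which the two given graphs contribute
  81 and 243 entries.\<close>

definition descendant_hints :: "hint list" where
  "descendant_hints =
   [Rename [0,1,2,3,4,6,5,7,9,8], Rename [0,1,3,2,4,5,6,7,8,9], Rename [0,1,3,2,7,8,9,4,5,6], Rename [0,1,3,2,4,5,6,7,
   8,9], Rename [0,1,3,2,4,5,6,7,8,9], Rename [0,1,3,2,4,5,6,7,8,9], Rename [0,1,3,2,7,8,9,4,5,6], Rename [0,1,3,2,7,
   8,9,4,5,6], Rename [0,1,3,2,7,8,9,4,5,6], Rename [0,1,2,3,4,6,5,7,9,8], Rename [0,1,2,3,4,5,6,7,8,9], Rename [0,1,
   2,3,4,6,5,7,8,9], Rename [0,1,2,3,4,6,5,7,8,9], Rename [0,1,2,3,4,5,6,7,8,9], Rename [0,1,2,3,4,6,5,7,8,9],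
   Rename [0,1,2,3,4,6,5,7,8,9], Rename [0,1,2,3,4,5,6,7,8,9], Rename [0,1,2,3,4,6,5,7,8,9], Rename [0,1,2,3,7,9,8,4,
   6,5], Rename [0,1,2,3,4,5,6,7,9,8], Rename [0,1,2,3,7,8,9,4,5,6], Rename [0,1,2,3,7,8,9,4,6,5], Rename [0,1,2,3,7,
   8,9,4,6,5], Rename [0,1,2,3,7,8,9,4,5,6], Rename [0,1,2,3,7,8,9,4,6,5], Rename [0,1,2,3,7,8,9,4,6,5], Rename [0,1,
   2,3,7,8,9,4,5,6], Rename [0,1,2,3,4,6,5,7,9,8], Rename [0,1,3,2,4,5,6,7,9,8], Rename [0,1,3,2,7,9,8,4,5,6],
   Rename [0,1,2,3,4,6,5,7,9,8], Rename [0,1,3,2,4,5,6,7,8,9], Rename [0,1,3,2,4,5,6,7,8,9], Rename [0,1,2,3,7,9,8,4,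
   6,5], Rename [0,1,3,2,4,5,6,7,8,9], Rename [0,1,3,2,4,5,6,7,8,9], Rename [0,1,2,3,4,6,5,7,9,8], Rename [0,1,2,3,4,
   5,6,7,9,8], Rename [0,1,2,3,7,9,8,4,5,6], Rename [0,1,2,3,4,6,5,7,9,8], Rename [0,1,2,3,4,5,6,7,8,9], Rename [0,1,
   2,3,4,6,5,7,8,9], Rename [0,1,2,3,7,9,8,4,6,5], Rename [0,1,2,3,4,5,6,7,8,9], Rename [0,1,2,3,4,6,5,7,8,9],
   Rename [0,1,2,3,4,6,5,7,9,8], Rename [0,1,2,3,4,5,6,7,9,8], Rename [0,1,2,3,7,9,8,4,5,6], Rename [0,1,2,3,4,6,5,7,
   9,8], Rename [0,1,2,3,4,5,6,7,9,8], Rename [0,1,2,3,4,5,6,7,8,9], Rename [0,1,2,3,7,9,8,4,6,5], Rename [0,1,2,3,4,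
   5,6,7,9,8], Rename [0,1,2,3,7,9,8,4,5,6], Rename [0,1,2,3,7,9,8,4,6,5], Rename [0,1,3,2,4,5,6,7,9,8], Rename [0,1,
   3,2,7,9,8,4,5,6], Rename [0,1,2,3,4,6,5,7,9,8], Rename [0,1,3,2,7,8,9,4,5,6], Rename [0,1,3,2,7,8,9,4,5,6],
   Rename [0,1,2,3,7,9,8,4,6,5], Rename [0,1,3,2,7,8,9,4,5,6], Rename [0,1,3,2,7,8,9,4,5,6], Rename [0,1,2,3,7,9,8,4,
   6,5], Rename [0,1,2,3,4,5,6,7,9,8], Rename [0,1,2,3,7,9,8,4,5,6], Rename [0,1,2,3,4,6,5,7,9,8], Rename [0,1,2,3,4,
   5,6,7,9,8], Rename [0,1,2,3,4,6,5,7,8,9], Rename [0,1,2,3,7,9,8,4,6,5], Rename [0,1,2,3,7,8,9,4,5,6], Rename [0,1,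
   2,3,7,9,8,4,5,6], Rename [0,1,2,3,7,9,8,4,6,5], Rename [0,1,2,3,4,5,6,7,9,8], Rename [0,1,2,3,7,9,8,4,5,6],
   Rename [0,1,2,3,4,6,5,7,9,8], Rename [0,1,2,3,4,5,6,7,9,8], Rename [0,1,2,3,7,8,9,4,5,6], Rename [0,1,2,3,7,9,8,4,
   6,5], Rename [0,1,2,3,7,8,9,4,6,5], Rename [0,1,2,3,7,8,9,4,5,6], Rename [0,2,3,1,4,5,6,7,8,9], Rename [0,2,3,1,4,
   5,6,7,8,9], Rename [0,2,3,1,7,8,9,4,5,6], Rename [0,2,3,1,4,5,6,7,8,9], Rename [0,2,3,1,4,5,6,7,8,9], Rename [0,2,
   3,1,4,5,6,7,8,9], Rename [0,2,3,1,7,8,9,4,5,6], Rename [0,2,3,1,7,8,9,4,5,6], Rename [0,2,3,1,7,8,9,4,5,6],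
   Rename [0,2,3,1,4,6,5,7,9,8], Rename [0,2,3,1,4,5,6,7,8,9], Rename [0,2,3,1,4,6,5,7,8,9], Rename [0,3,2,1,4,6,5,7,
   9,8], Rename [0,2,3,1,4,5,6,7,8,9], Rename [0,2,3,1,4,6,5,7,8,9], Rename [0,3,2,1,7,9,8,4,6,5], Rename [0,2,3,1,4,
   5,6,7,8,9], Rename [0,2,3,1,4,6,5,7,8,9], Rename [0,2,3,1,7,9,8,4,6,5], Rename [0,2,3,1,4,5,6,7,9,8], Rename [0,2,
   3,1,7,8,9,4,5,6], Rename [0,3,2,1,4,6,5,7,9,8], Rename [0,2,3,1,7,8,9,4,6,5], Rename [0,2,3,1,7,8,9,4,5,6],
   Rename [0,3,2,1,7,9,8,4,6,5], Rename [0,2,3,1,7,8,9,4,6,5], Rename [0,2,3,1,7,8,9,4,5,6], Vanish [0,2,1,3,4,5,6,7,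
   8,9], Rename [0,2,3,1,4,5,6,7,8,9], Rename [0,2,3,1,4,5,6,7,8,9], Rename [0,3,2,1,4,5,6,7,8,9], Rename [0,2,3,1,4,
   5,6,7,8,9], Rename [0,2,3,1,4,5,6,7,8,9], Rename [0,3,2,1,4,5,6,7,8,9], Rename [0,2,3,1,4,5,6,7,8,9], Rename [0,2,
   3,1,4,5,6,7,8,9], Vanish [0,2,1,3,4,5,6,7,8,9], Rename [0,2,3,1,4,5,6,7,9,8], Rename [0,2,3,1,7,9,8,4,5,6],
   Rename [0,3,2,1,4,6,5,7,9,8], Rename [0,2,3,1,4,5,6,7,8,9], Rename [0,2,3,1,4,6,5,7,8,9], Rename [0,3,2,1,7,9,8,4,
   6,5], Rename [0,2,3,1,4,5,6,7,8,9], Rename [0,2,3,1,4,6,5,7,8,9], Vanish [0,2,1,3,4,5,6,7,8,9], Rename [0,2,3,1,4,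
   5,6,7,9,8], Rename [0,2,3,1,7,9,8,4,5,6], Rename [0,3,2,1,4,6,5,7,9,8], Rename [0,2,3,1,4,5,6,7,9,8], Rename [0,2,
   3,1,4,5,6,7,8,9], Rename [0,3,2,1,7,9,8,4,6,5], Rename [0,2,3,1,4,5,6,7,9,8], Rename [0,2,3,1,7,9,8,4,5,6],
   Vanish [0,2,1,3,4,5,6,7,8,9], Rename [0,2,3,1,7,8,9,4,5,6], Rename [0,2,3,1,7,8,9,4,5,6], Rename [0,3,2,1,7,8,9,4,
   5,6], Rename [0,2,3,1,7,8,9,4,5,6], Rename [0,2,3,1,7,8,9,4,5,6], Rename [0,3,2,1,7,8,9,4,5,6], Rename [0,2,3,1,7,
   8,9,4,5,6], Rename [0,2,3,1,7,8,9,4,5,6], Vanish [0,2,1,3,4,5,6,7,8,9], Rename [0,2,3,1,4,5,6,7,9,8], Rename [0,2,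
   3,1,7,9,8,4,5,6], Rename [0,3,2,1,4,6,5,7,9,8], Rename [0,2,3,1,4,5,6,7,9,8], Rename [0,2,3,1,4,6,5,7,8,9],
   Rename [0,3,2,1,7,9,8,4,6,5], Rename [0,2,3,1,7,8,9,4,5,6], Rename [0,2,3,1,7,9,8,4,5,6], Vanish [0,2,1,3,4,5,6,7,
   8,9], Rename [0,2,3,1,4,5,6,7,9,8], Rename [0,2,3,1,7,9,8,4,5,6], Rename [0,3,2,1,4,6,5,7,9,8], Rename [0,2,3,1,4,
   5,6,7,9,8], Rename [0,2,3,1,7,8,9,4,5,6], Rename [0,3,2,1,7,9,8,4,6,5], Rename [0,2,3,1,7,8,9,4,6,5], Rename [0,2,
   3,1,7,8,9,4,5,6], Rename [0,1,2,3,5,6,4,7,9,8], Rename [0,1,3,2,5,6,4,7,8,9], Rename [0,1,3,2,5,6,4,7,8,9],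
   Vanish [0,3,2,1,4,5,6,7,8,9], Vanish [0,3,2,1,4,5,6,7,8,9], Vanish [0,3,2,1,4,5,6,7,8,9], Vanish [0,3,2,1,4,5,6,7,
   8,9], Vanish [0,3,2,1,4,5,6,7,8,9], Vanish [0,3,2,1,4,5,6,7,8,9], Rename [0,1,2,3,5,6,4,7,9,8], Rename [0,1,2,3,5,
   6,4,7,8,9], Rename [0,1,2,3,5,6,4,7,8,9], Rename [0,2,1,3,5,6,4,7,9,8], Rename [0,1,2,3,5,6,4,7,8,9], Rename [0,1,
   2,3,5,6,4,7,8,9], Rename [0,1,2,3,5,6,4,7,8,9], Rename [0,1,2,3,5,6,4,7,8,9], Rename [0,1,2,3,5,6,4,7,8,9],
   Rename [0,1,2,3,5,6,4,7,9,8], Rename [0,1,2,3,5,6,4,7,9,8], Rename [0,1,2,3,5,6,4,7,8,9], Rename [0,2,1,3,4,6,5,7,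
   9,8], Rename [0,1,2,3,4,6,5,7,9,8], Rename [0,1,2,3,4,6,5,7,8,9], Rename [0,2,1,3,5,6,4,7,9,8], Rename [0,1,2,3,5,
   6,4,7,9,8], Rename [0,1,2,3,5,6,4,7,8,9], Vanish [0,2,1,3,4,5,6,7,8,9], Vanish [0,3,2,1,6,5,4,7,9,8], Rename [0,2,
   3,1,4,6,5,7,8,9], Rename [0,3,1,2,4,6,5,7,9,8], Rename [0,2,3,1,4,6,5,7,8,9], Rename [0,2,3,1,4,6,5,7,8,9],
   Rename [0,3,2,1,4,6,5,7,8,9], Rename [0,2,3,1,4,6,5,7,8,9], Rename [0,2,3,1,4,6,5,7,8,9], Vanish [0,2,1,3,4,5,6,7,
   8,9], Rename [0,1,2,3,5,6,4,7,9,8], Rename [0,1,2,3,5,6,4,7,8,9], Vanish [0,1,2,3,6,5,4,7,8,9], Vanish [0,1,2,3,6,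
   5,4,7,8,9], Vanish [0,1,2,3,6,5,4,7,8,9], Rename [0,2,1,3,5,6,4,7,9,8], Rename [0,1,2,3,5,6,4,7,8,9], Rename [0,1,
   2,3,5,6,4,7,8,9], Vanish [0,2,1,3,4,5,6,7,8,9], Rename [0,1,2,3,5,6,4,7,9,8], Rename [0,1,2,3,5,6,4,7,8,9],
   Rename [0,2,1,3,4,6,5,7,9,8], Rename [0,1,2,3,4,6,5,7,9,8], Rename [0,1,2,3,4,6,5,7,8,9], Rename [0,2,1,3,5,6,4,7,
   9,8], Rename [0,1,2,3,5,6,4,7,9,8], Rename [0,1,2,3,4,6,5,7,8,9], Vanish [0,2,1,3,4,5,6,7,8,9], Rename [0,1,3,2,5,
   6,4,7,9,8], Rename [0,1,3,2,5,6,4,7,8,9], Rename [0,3,1,2,4,6,5,7,9,8], Rename [0,2,3,1,4,6,5,7,8,9], Rename [0,2,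
   3,1,4,6,5,7,8,9], Rename [0,3,1,2,5,6,4,7,9,8], Rename [0,2,3,1,5,6,4,7,8,9], Rename [0,2,3,1,5,6,4,7,8,9],
   Vanish [0,2,1,3,4,5,6,7,8,9], Rename [0,1,2,3,5,6,4,7,9,8], Rename [0,1,2,3,5,6,4,7,8,9], Rename [0,2,1,3,5,6,4,7,
   9,8], Rename [0,1,2,3,5,6,4,7,9,8], Rename [0,1,2,3,5,6,4,7,8,9], Rename [0,2,1,3,5,6,4,7,9,8], Rename [0,1,2,3,5,
   6,4,7,8,9], Rename [0,1,2,3,5,6,4,7,8,9], Vanish [0,2,1,3,4,5,6,7,8,9], Rename [0,1,2,3,5,6,4,7,9,8], Rename [0,1,
   2,3,5,6,4,7,8,9], Rename [0,2,1,3,4,6,5,7,9,8], Rename [0,1,2,3,4,6,5,7,9,8], Rename [0,1,2,3,4,6,5,7,8,9],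
   Rename [0,2,1,3,5,6,4,7,9,8], Rename [0,1,2,3,5,6,4,7,9,8], Rename [0,1,2,3,5,6,4,7,8,9], Rename [0,1,2,3,7,9,8,5,
   6,4], Rename [0,1,3,2,7,8,9,5,6,4], Rename [0,1,3,2,7,8,9,5,6,4], Vanish [0,3,2,1,4,5,6,7,8,9], Vanish [0,3,2,1,4,
   5,6,7,8,9], Vanish [0,3,2,1,4,5,6,7,8,9], Vanish [0,3,2,1,4,5,6,7,8,9], Vanish [0,3,2,1,4,5,6,7,8,9], Vanish [0,3,
   2,1,4,5,6,7,8,9], Rename [0,1,2,3,7,9,8,5,6,4], Rename [0,1,2,3,7,8,9,5,6,4], Rename [0,1,2,3,7,9,8,5,6,4],
   Rename [0,2,1,3,7,9,8,5,6,4], Rename [0,1,2,3,7,8,9,5,6,4], Rename [0,1,2,3,7,9,8,5,6,4], Rename [0,2,1,3,7,9,8,4,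
   6,5], Rename [0,1,2,3,7,8,9,4,6,5], Rename [0,1,2,3,7,9,8,4,6,5], Rename [0,1,2,3,7,9,8,5,6,4], Rename [0,1,2,3,7,
   8,9,5,6,4], Rename [0,1,2,3,7,8,9,5,6,4], Rename [0,1,2,3,7,8,9,5,6,4], Rename [0,1,2,3,7,8,9,5,6,4], Rename [0,1,
   2,3,7,8,9,5,6,4], Rename [0,2,1,3,7,9,8,5,6,4], Rename [0,1,2,3,7,8,9,5,6,4], Rename [0,1,2,3,7,8,9,5,6,4],
   Vanish [0,2,1,3,4,5,6,7,8,9], Rename [0,1,3,2,7,8,9,5,6,4], Rename [0,1,3,2,7,9,8,5,6,4], Rename [0,3,1,2,7,9,8,5,
   6,4], Rename [0,2,3,1,7,8,9,5,6,4], Rename [0,2,3,1,7,8,9,5,6,4], Rename [0,3,1,2,7,9,8,4,6,5], Rename [0,2,3,1,7,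
   8,9,4,6,5], Rename [0,2,3,1,7,8,9,4,6,5], Vanish [0,2,1,3,4,5,6,7,8,9], Rename [0,1,2,3,7,8,9,5,6,4], Rename [0,1,
   2,3,7,9,8,5,6,4], Rename [0,2,1,3,7,9,8,5,6,4], Rename [0,1,2,3,7,8,9,5,6,4], Rename [0,1,2,3,7,9,8,5,6,4],
   Rename [0,2,1,3,7,9,8,4,6,5], Rename [0,1,2,3,7,8,9,4,6,5], Rename [0,1,2,3,7,9,8,4,6,5], Vanish [0,2,1,3,4,5,6,7,
   8,9], Rename [0,1,2,3,7,8,9,5,6,4], Rename [0,1,2,3,7,9,8,5,6,4], Rename [0,2,1,3,7,9,8,5,6,4], Rename [0,1,2,3,7,
   8,9,5,6,4], Rename [0,1,2,3,7,8,9,5,6,4], Rename [0,2,1,3,7,9,8,5,6,4], Rename [0,1,2,3,7,8,9,5,6,4], Rename [0,1,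
   2,3,7,9,8,5,6,4], Vanish [0,2,1,3,4,5,6,7,8,9], Rename [0,2,3,1,7,8,9,4,6,5], Vanish [0,3,2,1,4,6,5,9,8,7],
   Rename [0,3,2,1,7,8,9,4,6,5], Rename [0,2,3,1,7,8,9,4,6,5], Rename [0,2,3,1,7,8,9,4,6,5], Rename [0,3,1,2,7,9,8,4,
   6,5], Rename [0,2,3,1,7,8,9,4,6,5], Rename [0,2,3,1,7,8,9,4,6,5], Vanish [0,2,1,3,4,5,6,7,8,9], Rename [0,1,2,3,7,
   8,9,5,6,4], Rename [0,1,2,3,7,9,8,5,6,4], Rename [0,2,1,3,7,9,8,5,6,4], Rename [0,1,2,3,7,8,9,4,6,5], Rename [0,1,
   2,3,7,9,8,5,6,4], Rename [0,2,1,3,7,9,8,4,6,5], Rename [0,1,2,3,7,8,9,4,6,5], Rename [0,1,2,3,7,9,8,4,6,5],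
   Vanish [0,2,1,3,4,5,6,7,8,9], Rename [0,1,2,3,7,8,9,5,6,4], Rename [0,1,2,3,7,9,8,5,6,4], Rename [0,2,1,3,7,9,8,5,
   6,4], Rename [0,1,2,3,7,8,9,5,6,4], Rename [0,1,2,3,7,8,9,5,6,4], Vanish [0,1,2,3,4,5,6,9,8,7], Vanish [0,1,2,3,4,
   5,6,9,8,7], Vanish [0,1,2,3,4,5,6,9,8,7]]"

text \<open>The pivots 1, 5, 6, 43, 57, 22, 56 serve as the free coordinates of the linear
  system.\<close>

definition ham_certs :: "ham_cert list" where
  "ham_certs =
   [([[1,2,3,5],[1,3,4,6]], [Rename [0,1,2,3,5,6,4,8,9,7], Rename [0,2,1,3,5,6,4,8,9,7], Rename [0,1,2,3,4,6,5,8,9,7],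
   Rename [0,1,2,3,6,4,5,8,9,7], Rename [0,1,2,3,8,9,7,4,6,5], Rename [0,1,2,3,8,9,7,6,4,5]], 2, [(2,1), (-2,7), (-2,
   25), (-1,27), (-2,39), (2,40), (-2,48)], [(1, [[1,2,6,8],[4,0,5,7],[1,4,6,9]], [Rename [0,1,2,3,4,5,6,7,8,9],
   Rename [0,1,2,3,5,4,6,7,9,8], Rename [0,2,1,3,5,4,6,7,8,9], Rename [0,1,2,3,6,5,4,7,8,9], Vanish [0,1,2,3,4,5,6,8,
   7,9]]), (-1, [[0,1,4,7],[5,1,6,8],[2,4,5,9]], [Rename [0,1,2,3,4,5,6,7,8,9], Rename [0,1,2,3,5,6,4,8,7,9],
   Vanish [0,1,2,3,4,5,6,7,8,9], Rename [0,1,2,3,5,4,6,7,8,9], Vanish [0,1,2,3,4,5,6,8,7,9]])], 1, 2), ([[1,4,3,5],[1,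
   3,4,6]], [Rename [0,1,2,3,5,6,4,8,9,7], Rename [0,2,1,3,5,6,4,8,9,7], Rename [0,1,2,3,4,6,5,8,9,7], Rename [0,1,2,
   3,6,4,5,8,9,7], Rename [0,1,2,3,8,9,7,4,6,5], Rename [0,1,2,3,8,9,7,6,4,5]], 1, [(-1,5), (4,8), (4,11), (-1,27),
   (-4,37), (-2,41), (4,49)], [(-2, [[5,6,7,9],[1,0,4,7],[1,5,6,8]], [Rename [0,1,2,3,4,5,6,7,8,9], Rename [0,1,2,3,5,
   4,6,7,8,9], Rename [0,1,2,3,5,6,4,7,8,9], Vanish [0,1,2,3,4,5,6,7,8,9], Rename [0,1,2,3,7,8,9,4,6,5]]), (-4, [[5,7,
   8,9],[0,1,4,7],[1,5,6,8]], [Rename [0,1,2,3,4,5,6,7,8,9], Vanish [0,1,2,3,6,5,4,8,7,9], Vanish [0,1,2,3,4,5,6,7,8,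
   9], Rename [0,1,2,3,8,7,9,4,6,5], Rename [0,1,2,3,8,7,9,4,5,6]]), (2, [[0,1,4,7],[5,1,6,8],[4,5,8,9]], [Rename [0,
   1,2,3,4,5,6,7,8,9], Rename [0,1,2,3,5,6,4,8,7,9], Vanish [0,1,2,3,4,5,6,7,8,9], Rename [0,1,2,3,5,4,6,7,8,9],
   Rename [0,1,2,3,4,5,6,8,7,9]]), (2, [[0,4,5,7],[1,4,5,8],[1,6,7,9]], [Rename [0,1,2,3,4,5,6,7,8,9], Rename [0,1,2,
   3,4,5,6,8,7,9], Vanish [0,1,2,3,4,5,6,7,8,9], Vanish [0,1,2,3,4,5,6,7,8,9], Rename [0,1,2,3,4,5,6,7,9,8]]), (2,
   [[1,4,5,8],[6,1,7,9],[0,4,5,7]], [Rename [0,1,2,3,4,5,6,7,8,9], Vanish [0,1,2,3,4,5,6,7,8,9], Rename [0,1,2,3,5,4,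
   6,7,8,9], Rename [0,1,2,3,4,5,6,7,8,9], Vanish [0,1,2,3,4,5,6,7,9,8]]), (2, [[0,4,5,7],[6,1,8,9],[1,4,6,8]],
   [Rename [0,1,2,3,4,5,6,7,8,9], Rename [0,1,2,3,7,9,8,6,4,5], Rename [0,1,2,3,6,5,4,7,8,9], Rename [0,1,2,3,4,6,5,7,
   8,9], Vanish [0,1,2,3,4,5,6,9,8,7]]), (2, [[0,1,4,7],[5,1,4,8],[6,7,8,9]], [Rename [0,1,2,3,4,5,6,7,8,9],
   Rename [0,1,2,3,4,5,6,8,7,9], Vanish [0,1,2,3,4,5,6,7,8,9], Vanish [0,1,2,3,4,5,6,7,8,9], Rename [0,1,2,3,4,5,6,7,
   8,9]])], 5, -1), ([[1,4,3,5],[1,5,4,6]], [Rename [0,1,2,3,6,5,4,8,9,7], Rename [0,2,1,3,6,5,4,8,9,7], Rename [0,1,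
   2,3,4,6,5,8,9,7], Rename [0,1,2,3,6,4,5,8,9,7], Rename [0,1,2,3,9,8,7,4,6,5], Rename [0,1,2,3,9,8,7,6,4,5]], 1,
   [(-1,6), (-1,28), (-2,42), (2,49)], [], 6, -1), ([[1,4,3,5],[2,3,4,6]], [Rename [0,1,2,3,5,6,4,8,9,7], Rename [0,2,
   1,3,5,6,4,9,8,7], Rename [0,1,2,3,4,6,5,8,9,7], Rename [0,1,2,3,6,4,5,8,9,7], Rename [0,1,2,3,8,9,7,4,6,5],
   Rename [0,2,1,3,8,9,7,6,4,5]], 1, [(4,7), (2,13), (4,16), (4,30), (2,32), (-2,43), (2,50)], [(-4, [[1,4,6,8],[7,0,
   4,5],[2,5,7,9]], [Rename [0,1,2,3,4,5,6,7,8,9], Rename [0,1,2,3,5,4,6,7,9,8], Vanish [0,1,2,3,4,5,6,7,8,9],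
   Vanish [0,2,1,3,5,4,6,7,9,8], Rename [0,1,2,3,4,5,6,8,7,9]]), (2, [[1,4,6,8],[5,2,7,9],[0,4,5,7]], [Rename [0,1,2,
   3,4,5,6,7,8,9], Vanish [0,2,1,3,4,5,6,7,8,9], Rename [0,1,2,3,5,4,6,7,8,9], Rename [0,1,2,3,4,5,6,7,8,9],
   Vanish [0,1,2,3,4,5,6,7,9,8]]), (2, [[1,4,5,8],[6,2,8,9],[0,4,5,7]], [Rename [0,1,2,3,4,5,6,7,8,9], Vanish [0,2,1,
   3,4,5,6,7,8,9], Rename [0,1,2,3,5,4,6,7,8,9], Rename [0,1,2,3,4,5,6,7,8,9], Vanish [0,1,2,3,4,5,6,7,8,9]]), (2,
   [[0,1,4,7],[5,2,6,8],[4,5,8,9]], [Rename [0,1,2,3,4,5,6,7,8,9], Rename [0,2,1,3,5,6,4,8,7,9], Vanish [0,2,1,3,4,5,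
   6,7,8,9], Rename [0,1,2,3,5,4,6,7,8,9], Rename [0,1,2,3,4,5,6,8,7,9]]), (-2, [[2,4,7,8],[5,6,7,9],[0,1,4,5]],
   [Rename [0,1,2,3,4,5,6,7,8,9], Rename [0,1,2,3,4,5,6,7,9,8], Rename [0,1,2,3,5,4,6,7,8,9], Vanish [0,1,2,3,4,5,6,7,
   8,9], Vanish [0,1,2,3,4,5,6,7,9,8]]), (2, [[0,1,4,7],[5,1,6,8],[2,4,5,9]], [Rename [0,1,2,3,4,5,6,7,8,9],
   Rename [0,1,2,3,5,6,4,8,7,9], Vanish [0,1,2,3,4,5,6,7,8,9], Rename [0,1,2,3,5,4,6,7,8,9], Vanish [0,1,2,3,4,5,6,8,
   7,9]]), (2, [[0,4,5,7],[2,4,6,9],[1,4,5,8]], [Rename [0,1,2,3,4,5,6,7,8,9], Rename [0,1,2,3,4,6,5,9,8,7],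
   Vanish [0,1,2,3,4,5,6,7,8,9], Rename [0,2,1,3,4,5,6,7,8,9], Vanish [0,1,2,3,4,5,6,9,8,7]]), (-2, [[0,1,4,7],[5,6,7,
   9],[2,4,5,8]], [Rename [0,1,2,3,4,5,6,7,8,9], Rename [0,1,2,3,8,9,7,4,6,5], Rename [0,2,1,3,4,5,6,7,8,9],
   Rename [0,1,2,3,5,4,6,7,8,9], Vanish [0,1,2,3,4,5,6,7,8,9]])], 43, -2), ([[1,4,3,5],[2,5,4,6]], [Rename [0,1,2,3,6,
   5,4,8,9,7], Rename [0,2,1,3,9,8,7,5,6,4], Rename [0,1,2,3,4,6,5,8,9,7], Rename [0,1,2,3,6,4,5,8,9,7], Rename [0,2,
   1,3,9,8,7,4,6,5], Rename [0,2,1,3,9,8,7,6,4,5]], 1, [(-2,14), (2,17), (-2,28), (4,39), (-2,48), (1,50), (2,57)],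
   [(-2, [[1,4,6,8],[7,0,4,5],[2,5,7,9]], [Rename [0,1,2,3,4,5,6,7,8,9], Rename [0,1,2,3,5,4,6,7,9,8], Vanish [0,1,2,
   3,4,5,6,7,8,9], Vanish [0,2,1,3,5,4,6,7,9,8], Rename [0,1,2,3,4,5,6,8,7,9]]), (1, [[1,4,6,8],[5,2,7,9],[0,4,5,7]],
   [Rename [0,1,2,3,4,5,6,7,8,9], Vanish [0,2,1,3,4,5,6,7,8,9], Rename [0,1,2,3,5,4,6,7,8,9], Rename [0,1,2,3,4,5,6,7,
   8,9], Vanish [0,1,2,3,4,5,6,7,9,8]]), (1, [[1,4,5,8],[6,2,8,9],[0,4,5,7]], [Rename [0,1,2,3,4,5,6,7,8,9],
   Vanish [0,2,1,3,4,5,6,7,8,9], Rename [0,1,2,3,5,4,6,7,8,9], Rename [0,1,2,3,4,5,6,7,8,9], Vanish [0,1,2,3,4,5,6,7,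
   8,9]]), (1, [[0,4,5,7],[6,2,7,9],[1,4,5,8]], [Rename [0,1,2,3,4,5,6,7,8,9], Rename [0,2,1,3,7,8,9,4,6,5],
   Rename [0,1,2,3,6,4,5,7,8,9], Rename [0,1,2,3,4,6,5,7,8,9], Vanish [0,1,2,3,4,5,6,7,8,9]]), (-1, [[0,1,4,7],[5,2,4,
   8],[6,7,8,9]], [Rename [0,1,2,3,4,5,6,7,8,9], Rename [0,2,1,3,4,5,6,8,7,9], Vanish [0,2,1,3,4,5,6,7,8,9],
   Vanish [0,1,2,3,4,5,6,7,8,9], Rename [0,1,2,3,4,5,6,7,8,9]]), (2, [[0,4,5,7],[1,4,6,9],[1,2,7,8]], [Rename [0,1,2,
   3,4,5,6,7,8,9], Rename [0,1,2,3,4,6,5,8,9,7], Vanish [0,1,2,3,4,5,6,7,8,9], Vanish [0,1,2,3,4,6,5,7,8,9],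
   Rename [0,1,2,3,4,5,6,7,8,9]]), (2, [[1,2,6,8],[4,1,8,9],[0,4,5,7]], [Rename [0,1,2,3,4,5,6,7,8,9], Vanish [0,1,2,
   3,4,5,6,7,8,9], Rename [0,1,2,3,4,5,6,7,8,9], Rename [0,1,2,3,4,5,6,7,8,9], Vanish [0,1,2,3,4,5,6,7,8,9]]), (2,
   [[0,1,4,7],[8,2,6,9],[2,4,5,8]], [Rename [0,1,2,3,4,5,6,7,8,9], Rename [0,2,1,3,5,6,4,9,8,7], Rename [0,2,1,3,7,9,
   8,5,4,6], Rename [0,1,2,3,7,8,9,5,4,6], Vanish [0,1,2,3,4,5,6,9,8,7]]), (-2, [[2,6,8,9],[4,0,1,7],[2,4,5,8]],
   [Rename [0,1,2,3,4,5,6,7,8,9], Rename [0,2,1,3,7,8,9,4,5,6], Rename [0,1,2,3,5,6,4,7,8,9], Rename [0,1,2,3,7,8,9,5,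
   4,6], Vanish [0,1,2,3,4,5,6,9,8,7]]), (-2, [[0,1,4,7],[5,1,2,8],[4,6,8,9]], [Rename [0,1,2,3,4,5,6,7,8,9],
   Rename [0,1,2,3,7,8,9,5,4,6], Vanish [0,1,2,3,4,5,6,7,8,9], Vanish [0,1,2,3,8,7,9,5,4,6], Rename [0,1,2,3,4,5,6,8,
   7,9]]), (2, [[0,1,2,4],[5,1,7,8],[5,6,7,9]], [Rename [0,1,2,3,4,5,6,7,8,9], Rename [0,1,2,3,8,7,9,4,5,6],
   Vanish [0,1,2,3,4,5,6,7,8,9], Rename [0,1,2,3,5,4,6,7,8,9], Rename [0,1,2,3,5,4,6,7,8,9]]), (-2, [[0,4,5,7],[1,4,8,
   9],[1,2,6,8]], [Rename [0,1,2,3,4,5,6,7,8,9], Rename [0,1,2,3,7,9,8,6,4,5], Vanish [0,1,2,3,4,5,6,7,8,9],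
   Rename [0,1,2,3,4,6,5,7,8,9], Vanish [0,1,2,3,4,5,6,9,8,7]]), (-2, [[1,2,6,8],[4,1,7,9],[0,4,5,7]], [Rename [0,1,2,
   3,4,5,6,7,8,9], Vanish [0,1,2,3,4,5,6,7,8,9], Rename [0,1,2,3,4,5,6,7,9,8], Rename [0,1,2,3,4,5,6,7,8,9],
   Vanish [0,1,2,3,4,5,6,7,9,8]]), (2, [[0,1,4,5],[6,5,7,9],[2,4,7,8]], [Rename [0,1,2,3,4,5,6,7,8,9], Rename [0,2,1,
   3,8,7,9,4,6,5], Vanish [0,2,1,3,5,4,6,7,9,8], Rename [0,1,2,3,6,4,5,7,8,9], Vanish [0,1,2,3,4,5,6,7,8,9]]), (-2,
   [[1,4,6,8],[7,0,4,5],[2,6,8,9]], [Rename [0,1,2,3,4,5,6,7,8,9], Rename [0,1,2,3,4,5,6,9,7,8], Vanish [0,1,2,3,4,5,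
   6,7,8,9], Vanish [0,2,1,3,6,5,4,9,8,7], Rename [0,1,2,3,4,5,6,8,7,9]]), (1, [[2,6,7,8],[4,7,8,9],[0,1,4,5]],
   [Rename [0,1,2,3,4,5,6,7,8,9], Rename [0,1,2,3,4,5,6,7,8,9], Rename [0,1,2,3,4,5,6,7,8,9], Vanish [0,1,2,3,4,5,6,7,
   8,9], Vanish [0,1,2,3,4,5,6,7,8,9]]), (1, [[0,1,4,5],[7,4,6,8],[2,7,8,9]], [Rename [0,1,2,3,4,5,6,7,8,9],
   Rename [0,1,2,3,4,6,5,8,7,9], Rename [0,1,2,3,4,5,6,7,8,9], Vanish [0,1,2,3,4,5,6,7,8,9], Vanish [0,1,2,3,4,6,5,7,
   8,9]]), (-2, [[0,4,5,7],[2,6,7,9],[1,4,7,8]], [Rename [0,1,2,3,4,5,6,7,8,9], Rename [0,1,2,3,8,9,7,4,6,5],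
   Rename [0,2,1,3,8,7,9,4,5,6], Vanish [0,1,2,3,4,6,5,7,8,9], Vanish [0,1,2,3,4,5,6,7,8,9]])], 57, 2), ([[1,4,3,5],
   [3,5,4,6]], [Rename [0,1,2,3,5,6,4,8,9,7], Rename [0,2,1,3,5,6,4,8,9,7], Rename [0,1,2,3,4,6,5,8,9,7], Rename [0,1,
   2,3,6,4,5,8,9,7], Rename [0,1,2,3,8,9,7,4,6,5], Rename [0,1,2,3,8,9,7,6,4,5]], 8, [(-16,8), (-16,11), (-16,16),
   (16,17), (-4,21), (8,22), (-4,23), (-16,30), (-8,32), (16,37), (16,44), (8,51), (-16,52), (-16,58), (16,62)], [(-8,
   [[0,1,4,7],[5,2,6,8],[4,5,8,9]], [Rename [0,1,2,3,4,5,6,7,8,9], Rename [0,2,1,3,5,6,4,8,7,9], Vanish [0,2,1,3,4,5,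
   6,7,8,9], Rename [0,1,2,3,5,4,6,7,8,9], Rename [0,1,2,3,4,5,6,8,7,9]]), (8, [[2,4,7,8],[5,6,7,9],[0,1,4,5]],
   [Rename [0,1,2,3,4,5,6,7,8,9], Rename [0,1,2,3,4,5,6,7,9,8], Rename [0,1,2,3,5,4,6,7,8,9], Vanish [0,1,2,3,4,5,6,7,
   8,9], Vanish [0,1,2,3,4,5,6,7,9,8]]), (1, [[0,4,5,7],[8,4,5,9],[1,6,8,9]], [Rename [0,1,2,3,4,5,6,7,8,9],
   Rename [0,1,2,3,4,5,6,9,8,7], Vanish [0,1,2,3,4,5,6,7,8,9], Vanish [0,1,2,3,4,5,6,7,8,9], Rename [0,1,2,3,4,5,6,9,
   7,8]]), (2, [[0,1,4,7],[8,4,5,9],[5,6,7,8]], [Rename [0,1,2,3,4,5,6,7,8,9], Rename [0,1,2,3,4,5,6,8,9,7],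
   Rename [0,1,2,3,7,8,9,4,5,6], Vanish [0,1,2,3,4,5,6,7,8,9], Rename [0,1,2,3,4,5,6,8,7,9]]), (-1, [[1,6,8,9],[4,5,8,
   9],[0,4,5,7]], [Rename [0,1,2,3,4,5,6,7,8,9], Rename [0,1,2,3,5,4,6,7,8,9], Rename [0,1,2,3,4,5,6,7,8,9],
   Vanish [0,1,2,3,4,5,6,7,8,9], Vanish [0,1,2,3,4,5,6,7,8,9]]), (-2, [[4,5,6,8],[7,0,1,4],[5,7,8,9]], [Rename [0,1,2,
   3,4,5,6,7,8,9], Vanish [0,1,2,3,4,5,6,7,8,9], Rename [0,1,2,3,4,5,6,7,8,9], Rename [0,1,2,3,4,6,5,7,8,9],
   Rename [0,1,2,3,4,5,6,8,7,9]]), (1, [[4,5,7,8],[6,7,8,9],[0,1,4,5]], [Rename [0,1,2,3,4,5,6,7,8,9], Rename [0,1,2,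
   3,5,4,6,7,8,9], Rename [0,1,2,3,4,5,6,7,8,9], Vanish [0,1,2,3,4,5,6,7,8,9], Vanish [0,1,2,3,4,5,6,7,8,9]]), (-1,
   [[0,1,4,5],[6,7,8,9],[4,5,7,8]], [Rename [0,1,2,3,4,5,6,7,8,9], Rename [0,1,2,3,7,8,9,4,5,6], Rename [0,1,2,3,4,5,
   6,7,8,9], Rename [0,1,2,3,6,4,5,7,8,9], Rename [0,1,2,3,4,6,5,7,8,9]]), (2, [[0,4,5,7],[6,4,5,8],[1,7,8,9]],
   [Rename [0,1,2,3,4,5,6,7,8,9], Rename [0,1,2,3,4,5,6,8,7,9], Vanish [0,1,2,3,4,5,6,7,8,9], Vanish [0,1,2,3,4,5,6,7,
   8,9], Rename [0,1,2,3,4,5,6,7,8,9]]), (4, [[1,4,5,8],[6,7,8,9],[0,4,5,7]], [Rename [0,1,2,3,4,5,6,7,8,9],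
   Rename [0,1,2,3,4,5,6,7,8,9], Rename [0,1,2,3,5,4,6,7,8,9], Rename [0,1,2,3,4,5,6,7,8,9], Vanish [0,1,2,3,4,5,6,7,
   8,9]]), (-8, [[0,4,5,7],[6,4,7,8],[1,6,8,9]], [Rename [0,1,2,3,4,5,6,7,8,9], Rename [0,1,2,3,7,9,8,5,4,6],
   Vanish [0,1,2,3,4,5,6,7,8,9], Rename [0,1,2,3,5,6,4,7,8,9], Vanish [0,1,2,3,4,5,6,7,8,9]]), (-4, [[1,4,5,8],[9,6,7,
   8],[0,4,5,7]], [Rename [0,1,2,3,4,5,6,7,8,9], Rename [0,1,2,3,4,5,6,7,8,9], Rename [0,1,2,3,5,4,6,7,8,9],
   Rename [0,1,2,3,4,5,6,7,8,9], Vanish [0,1,2,3,4,5,6,7,8,9]]), (16, [[0,1,4,7],[5,2,4,8],[5,6,7,9]], [Rename [0,1,2,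
   3,4,5,6,7,8,9], Rename [0,2,1,3,4,5,6,8,7,9], Vanish [0,2,1,3,4,5,6,7,8,9], Vanish [0,1,2,3,4,5,6,7,8,9],
   Rename [0,1,2,3,4,5,6,7,8,9]]), (-8, [[4,7,8,9],[5,0,1,4],[4,6,7,8]], [Rename [0,1,2,3,4,5,6,7,8,9], Vanish [0,1,2,
   3,4,5,6,7,8,9], Rename [0,1,2,3,4,6,5,7,8,9], Rename [0,1,2,3,4,6,5,8,7,9], Rename [0,1,2,3,4,5,6,8,9,7]]), (8,
   [[0,4,5,7],[1,6,7,8],[4,5,7,9]], [Rename [0,1,2,3,4,5,6,7,8,9], Rename [0,1,2,3,8,9,7,4,5,6], Rename [0,1,2,3,8,7,
   9,4,6,5], Rename [0,1,2,3,7,8,9,4,6,5], Vanish [0,1,2,3,4,5,6,7,8,9]]), (8, [[0,4,5,7],[6,1,7,8],[4,5,7,9]],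
   [Rename [0,1,2,3,4,5,6,7,8,9], Rename [0,1,2,3,7,8,9,4,5,6], Rename [0,1,2,3,6,4,5,7,8,9], Rename [0,1,2,3,4,6,5,7,
   8,9], Vanish [0,1,2,3,4,5,6,7,8,9]]), (16, [[1,4,6,8],[5,4,8,9],[0,4,5,7]], [Rename [0,1,2,3,4,5,6,7,8,9],
   Rename [0,1,2,3,4,5,6,7,8,9], Vanish [0,1,2,3,4,5,6,7,8,9], Rename [0,1,2,3,4,5,6,7,8,9], Vanish [0,1,2,3,4,5,6,7,
   8,9]]), (-8, [[6,7,8,9],[4,0,1,5],[2,4,7,8]], [Rename [0,1,2,3,4,5,6,7,8,9], Vanish [0,1,2,3,4,6,5,7,8,9],
   Rename [0,1,2,3,8,7,9,4,5,6], Rename [0,1,2,3,8,7,9,5,4,6], Rename [0,1,2,3,8,7,9,5,6,4]]), (-8, [[0,1,4,7],[5,2,4,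
   8],[6,7,8,9]], [Rename [0,1,2,3,4,5,6,7,8,9], Rename [0,2,1,3,4,5,6,8,7,9], Vanish [0,2,1,3,4,5,6,7,8,9],
   Vanish [0,1,2,3,4,5,6,7,8,9], Rename [0,1,2,3,4,5,6,7,8,9]]), (8, [[5,6,7,9],[1,0,4,7],[1,5,6,8]], [Rename [0,1,2,
   3,4,5,6,7,8,9], Rename [0,1,2,3,5,4,6,7,8,9], Rename [0,1,2,3,5,6,4,7,8,9], Vanish [0,1,2,3,4,5,6,7,8,9],
   Rename [0,1,2,3,7,8,9,4,6,5]]), (16, [[5,7,8,9],[0,1,4,7],[1,5,6,8]], [Rename [0,1,2,3,4,5,6,7,8,9], Vanish [0,1,2,
   3,6,5,4,8,7,9], Vanish [0,1,2,3,4,5,6,7,8,9], Rename [0,1,2,3,8,7,9,4,6,5], Rename [0,1,2,3,8,7,9,4,5,6]]), (-8,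
   [[0,1,4,7],[5,1,6,8],[4,5,8,9]], [Rename [0,1,2,3,4,5,6,7,8,9], Rename [0,1,2,3,5,6,4,8,7,9], Vanish [0,1,2,3,4,5,
   6,7,8,9], Rename [0,1,2,3,5,4,6,7,8,9], Rename [0,1,2,3,4,5,6,8,7,9]]), (-8, [[0,4,5,7],[1,4,5,8],[1,6,7,9]],
   [Rename [0,1,2,3,4,5,6,7,8,9], Rename [0,1,2,3,4,5,6,8,7,9], Vanish [0,1,2,3,4,5,6,7,8,9], Vanish [0,1,2,3,4,5,6,7,
   8,9], Rename [0,1,2,3,4,5,6,7,9,8]]), (-8, [[1,4,5,8],[6,1,7,9],[0,4,5,7]], [Rename [0,1,2,3,4,5,6,7,8,9],
   Vanish [0,1,2,3,4,5,6,7,8,9], Rename [0,1,2,3,5,4,6,7,8,9], Rename [0,1,2,3,4,5,6,7,8,9], Vanish [0,1,2,3,4,5,6,7,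
   9,8]]), (-8, [[0,1,4,7],[5,1,4,8],[6,7,8,9]], [Rename [0,1,2,3,4,5,6,7,8,9], Rename [0,1,2,3,4,5,6,8,7,9],
   Vanish [0,1,2,3,4,5,6,7,8,9], Vanish [0,1,2,3,4,5,6,7,8,9], Rename [0,1,2,3,4,5,6,7,8,9]]), (-8, [[1,4,7,8],[5,6,8,
   9],[0,4,5,7]], [Rename [0,1,2,3,4,5,6,7,8,9], Rename [0,1,2,3,4,5,6,7,8,9], Rename [0,1,2,3,5,4,6,7,8,9],
   Rename [0,1,2,3,4,5,6,7,8,9], Vanish [0,1,2,3,4,5,6,7,8,9]]), (2, [[0,4,5,7],[8,1,6,9],[4,5,7,8]], [Rename [0,1,2,
   3,4,5,6,7,8,9], Rename [0,1,2,3,5,6,4,8,9,7], Rename [0,1,2,3,8,7,9,4,5,6], Rename [0,1,2,3,7,8,9,4,5,6],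
   Rename [0,1,2,3,4,5,6,8,7,9]]), (2, [[5,6,8,9],[1,0,4,7],[5,6,8,9]], [Rename [0,1,2,3,4,5,6,7,8,9], Rename [0,1,2,
   3,5,4,6,7,8,9], Rename [0,1,2,3,5,6,4,7,8,9], Rename [0,1,2,3,7,8,9,5,4,6], Rename [0,1,2,3,7,8,9,5,6,4]]), (8,
   [[0,4,5,7],[9,1,6,8],[4,6,7,8]], [Rename [0,1,2,3,4,5,6,7,8,9], Rename [0,1,2,3,5,6,4,8,7,9], Rename [0,1,2,3,8,7,
   9,4,6,5], Rename [0,1,2,3,7,9,8,4,6,5], Rename [0,1,2,3,4,5,6,8,9,7]]), (8, [[0,1,4,7],[5,4,7,8],[5,6,8,9]],
   [Rename [0,1,2,3,4,5,6,7,8,9], Rename [0,1,2,3,7,8,9,4,5,6], Rename [0,1,2,3,4,5,6,7,8,9], Vanish [0,1,2,3,4,5,6,7,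
   8,9], Vanish [0,1,2,3,4,5,6,7,8,9]]), (-8, [[1,6,8,9],[0,4,5,7],[1,4,8,9]], [Rename [0,1,2,3,4,5,6,7,8,9],
   Rename [0,1,2,3,8,9,7,6,4,5], Vanish [0,1,2,3,4,6,5,7,8,9], Rename [0,1,2,3,8,9,7,6,5,4], Rename [0,1,2,3,8,9,7,6,
   4,5]]), (-8, [[6,7,8,9],[4,0,1,5],[1,4,7,8]], [Rename [0,1,2,3,4,5,6,7,8,9], Vanish [0,1,2,3,4,6,5,7,8,9],
   Rename [0,1,2,3,8,7,9,4,5,6], Rename [0,1,2,3,8,7,9,5,4,6], Rename [0,1,2,3,8,7,9,5,6,4]]), (16, [[0,4,5,7],[6,4,8,
   9],[1,4,5,8]], [Rename [0,1,2,3,4,5,6,7,8,9], Rename [0,1,2,3,7,8,9,6,4,5], Vanish [0,1,2,3,4,5,6,7,8,9],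
   Rename [0,1,2,3,4,6,5,7,8,9], Vanish [0,1,2,3,4,5,6,9,8,7]])], 22, 8), ([[4,6,3,5],[3,5,4,6]], [Rename [0,1,2,3,5,
   6,4,8,9,7], Rename [0,2,1,3,5,6,4,8,9,7], Rename [0,1,2,3,4,6,5,8,9,7], Rename [0,1,2,3,6,4,5,8,9,7], Rename [0,1,
   2,3,8,9,7,4,6,5], Rename [0,1,2,3,8,9,7,6,4,5]], 1, [(4,21), (4,23), (-8,51), (4,56), (8,63)], [(-1, [[0,4,5,7],[8,
   4,5,9],[1,6,8,9]], [Rename [0,1,2,3,4,5,6,7,8,9], Rename [0,1,2,3,4,5,6,9,8,7], Vanish [0,1,2,3,4,5,6,7,8,9],
   Vanish [0,1,2,3,4,5,6,7,8,9], Rename [0,1,2,3,4,5,6,9,7,8]]), (-2, [[0,1,4,7],[8,4,5,9],[5,6,7,8]], [Rename [0,1,2,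
   3,4,5,6,7,8,9], Rename [0,1,2,3,4,5,6,8,9,7], Rename [0,1,2,3,7,8,9,4,5,6], Vanish [0,1,2,3,4,5,6,7,8,9],
   Rename [0,1,2,3,4,5,6,8,7,9]]), (1, [[1,6,8,9],[4,5,8,9],[0,4,5,7]], [Rename [0,1,2,3,4,5,6,7,8,9], Rename [0,1,2,
   3,5,4,6,7,8,9], Rename [0,1,2,3,4,5,6,7,8,9], Vanish [0,1,2,3,4,5,6,7,8,9], Vanish [0,1,2,3,4,5,6,7,8,9]]), (2,
   [[4,5,6,8],[7,0,1,4],[5,7,8,9]], [Rename [0,1,2,3,4,5,6,7,8,9], Vanish [0,1,2,3,4,5,6,7,8,9], Rename [0,1,2,3,4,5,
   6,7,8,9], Rename [0,1,2,3,4,6,5,7,8,9], Rename [0,1,2,3,4,5,6,8,7,9]]), (-1, [[4,5,7,8],[6,7,8,9],[0,1,4,5]],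
   [Rename [0,1,2,3,4,5,6,7,8,9], Rename [0,1,2,3,5,4,6,7,8,9], Rename [0,1,2,3,4,5,6,7,8,9], Vanish [0,1,2,3,4,5,6,7,
   8,9], Vanish [0,1,2,3,4,5,6,7,8,9]]), (1, [[0,1,4,5],[6,7,8,9],[4,5,7,8]], [Rename [0,1,2,3,4,5,6,7,8,9],
   Rename [0,1,2,3,7,8,9,4,5,6], Rename [0,1,2,3,4,5,6,7,8,9], Rename [0,1,2,3,6,4,5,7,8,9], Rename [0,1,2,3,4,6,5,7,
   8,9]]), (-2, [[0,4,5,7],[6,4,5,8],[1,7,8,9]], [Rename [0,1,2,3,4,5,6,7,8,9], Rename [0,1,2,3,4,5,6,8,7,9],
   Vanish [0,1,2,3,4,5,6,7,8,9], Vanish [0,1,2,3,4,5,6,7,8,9], Rename [0,1,2,3,4,5,6,7,8,9]]), (-4, [[1,4,5,8],[6,7,8,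
   9],[0,4,5,7]], [Rename [0,1,2,3,4,5,6,7,8,9], Rename [0,1,2,3,4,5,6,7,8,9], Rename [0,1,2,3,5,4,6,7,8,9],
   Rename [0,1,2,3,4,5,6,7,8,9], Vanish [0,1,2,3,4,5,6,7,8,9]]), (8, [[0,4,5,7],[6,4,7,8],[1,6,8,9]], [Rename [0,1,2,
   3,4,5,6,7,8,9], Rename [0,1,2,3,7,9,8,5,4,6], Vanish [0,1,2,3,4,5,6,7,8,9], Rename [0,1,2,3,5,6,4,7,8,9],
   Vanish [0,1,2,3,4,5,6,7,8,9]]), (4, [[1,4,5,8],[9,6,7,8],[0,4,5,7]], [Rename [0,1,2,3,4,5,6,7,8,9], Rename [0,1,2,
   3,4,5,6,7,8,9], Rename [0,1,2,3,5,4,6,7,8,9], Rename [0,1,2,3,4,5,6,7,8,9], Vanish [0,1,2,3,4,5,6,7,8,9]]), (8,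
   [[1,4,7,8],[5,6,8,9],[0,4,5,7]], [Rename [0,1,2,3,4,5,6,7,8,9], Rename [0,1,2,3,4,5,6,7,8,9], Rename [0,1,2,3,5,4,
   6,7,8,9], Rename [0,1,2,3,4,5,6,7,8,9], Vanish [0,1,2,3,4,5,6,7,8,9]]), (-2, [[0,4,5,7],[8,1,6,9],[4,5,7,8]],
   [Rename [0,1,2,3,4,5,6,7,8,9], Rename [0,1,2,3,5,6,4,8,9,7], Rename [0,1,2,3,8,7,9,4,5,6], Rename [0,1,2,3,7,8,9,4,
   5,6], Rename [0,1,2,3,4,5,6,8,7,9]]), (-4, [[5,6,8,9],[1,0,4,7],[5,6,8,9]], [Rename [0,1,2,3,4,5,6,7,8,9],
   Rename [0,1,2,3,5,4,6,7,8,9], Rename [0,1,2,3,5,6,4,7,8,9], Rename [0,1,2,3,7,8,9,5,4,6], Rename [0,1,2,3,7,8,9,5,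
   6,4]]), (-8, [[0,4,5,7],[9,1,6,8],[4,6,7,8]], [Rename [0,1,2,3,4,5,6,7,8,9], Rename [0,1,2,3,5,6,4,8,7,9],
   Rename [0,1,2,3,8,7,9,4,6,5], Rename [0,1,2,3,7,9,8,4,6,5], Rename [0,1,2,3,4,5,6,8,9,7]]), (-8, [[0,1,4,7],[5,4,7,
   8],[5,6,8,9]], [Rename [0,1,2,3,4,5,6,7,8,9], Rename [0,1,2,3,7,8,9,4,5,6], Rename [0,1,2,3,4,5,6,7,8,9],
   Vanish [0,1,2,3,4,5,6,7,8,9], Vanish [0,1,2,3,4,5,6,7,8,9]]), (4, [[4,6,8,9],[5,0,4,7],[4,6,8,9]], [Rename [0,1,2,
   3,4,5,6,7,8,9], Vanish [0,1,2,3,4,5,6,7,8,9], Rename [0,1,2,3,4,6,5,7,8,9], Rename [0,1,2,3,7,9,8,5,4,6],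
   Rename [0,1,2,3,7,9,8,5,6,4]])], 56, 4)]"

text \<open>Stored so that the in-degrees are not computed anew in each test; their agreement with
  \<open>with_degrees\<close> is checked once.\<close>

definition basis_degrees :: "nat list list" where
  "basis_degrees =
   [[0,3,1,1,1,1,1,1,1,1,0,1,1], [0,3,1,0,1,2,1,1,1,1,0,1,1], [0,2,1,1,2,1,1,1,1,1,0,1,1], [0,2,1,0,2,2,1,1,1,1,0,1,
   1], [0,2,1,0,2,1,1,1,2,1,0,1,1], [0,3,0,0,1,2,2,1,1,1,0,1,1], [0,3,0,0,1,2,1,1,2,1,0,1,1], [0,2,1,0,2,2,1,1,1,1,0,
   1,1], [0,2,0,0,2,2,1,1,2,1,0,1,1], [0,2,1,0,1,2,1,2,1,1,0,1,1], [0,2,0,0,1,2,2,2,1,1,0,1,1], [0,2,0,0,1,2,1,2,2,1,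
   0,1,1], [0,1,1,1,3,1,1,1,1,1,0,1,1], [0,1,1,0,3,2,1,1,1,1,0,1,1], [0,1,1,0,3,1,1,1,2,1,0,1,1], [0,1,1,1,2,1,1,2,1,
   1,0,1,1], [0,1,1,0,2,2,1,2,1,1,0,1,1], [0,1,1,0,2,1,1,2,2,1,0,1,1], [0,1,0,0,3,2,2,1,1,1,0,1,1], [0,1,0,0,3,2,1,1,
   2,1,0,1,1], [0,1,0,0,2,2,2,2,1,1,0,1,1], [0,1,0,0,2,2,1,2,2,1,0,1,1], [0,1,0,0,3,1,1,1,2,2,0,1,1], [0,1,0,0,2,2,1,
   2,2,1,0,1,1], [0,2,2,1,1,1,1,1,1,1,0,1,1], [0,2,2,0,1,2,1,1,1,1,0,1,1], [0,1,2,1,1,2,1,1,1,1,0,1,1], [0,1,2,0,1,2,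
   2,1,1,1,0,1,1], [0,1,2,0,1,2,1,1,2,1,0,1,1], [0,1,1,1,2,2,1,1,1,1,0,1,1], [0,1,1,0,2,2,1,1,2,1,0,1,1], [0,1,1,1,2,
   1,1,1,2,1,0,1,1], [0,1,1,0,1,2,2,2,1,1,0,1,1], [0,2,1,0,3,1,1,1,1,1,0,1,1], [0,2,0,0,3,2,1,1,1,1,0,1,1], [0,2,0,0,
   3,1,1,1,2,1,0,1,1], [0,2,1,0,2,1,1,2,1,1,0,1,1], [0,2,0,0,2,1,1,2,2,1,0,1,1], [0,2,1,1,2,1,1,1,1,1,0,1,1], [0,2,1,
   0,2,1,1,1,2,1,0,1,1], [0,2,1,0,3,1,1,1,1,1,0,1,1], [0,2,0,0,3,1,2,1,1,1,0,1,1], [0,2,0,0,3,1,1,1,2,1,0,1,1], [0,1,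
   1,0,3,2,1,1,1,1,0,1,1], [0,1,0,0,3,2,1,1,2,1,0,1,1], [0,1,1,0,3,1,1,2,1,1,0,1,1], [0,1,0,0,3,1,2,2,1,1,0,1,1], [0,
   1,0,0,3,1,1,2,2,1,0,1,1], [0,2,1,0,2,1,1,1,2,1,0,1,1], [0,2,0,0,2,1,2,1,2,1,0,1,1], [0,1,1,0,2,2,1,1,2,1,0,1,1],
   [0,1,0,0,2,1,2,2,2,1,0,1,1], [0,1,0,0,3,2,1,1,2,1,0,1,1], [0,1,0,0,3,2,1,2,1,1,0,1,1], [0,0,0,0,3,2,2,2,1,1,0,1,1],
   [0,0,0,0,3,2,1,2,2,1,0,1,1], [0,0,0,0,3,2,1,1,2,2,0,1,1], [0,1,1,0,2,1,1,3,1,1,0,1,1], [0,1,0,0,2,1,2,3,1,1,0,1,1],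
   [0,1,0,0,3,1,1,3,1,1,0,1,1], [0,0,0,0,3,1,2,3,1,1,0,1,1], [0,0,0,0,3,1,1,3,2,1,0,1,1], [0,1,0,0,2,1,1,3,2,1,0,1,1],
   [0,0,0,0,2,1,2,3,2,1,0,1,1]]"

lemma further_graphs: "span_closure basis_graphs span_certs = Some (further_graphs @ basis_graphs)"
  by code_simp

text \<open>The first condition says that \<open>e\<close> divides 24, so the solution over the
  common denominator 24 stays among integers. The last one compares both sides modulo a combination
  of exchange relations.\<close>

fun ham_cert_valid :: "ham_cert \<Rightarrow> bool" where
  "ham_cert_valid (H, hs, d, nb, rs, f, e) \<longleftrightarrow> e * (24 div e) = 24 \<and> list_all (\<lambda>(c, b). b < 64) nb \<and>
     (case (hint_vectors (shifted_ham H) hs, relation_vectors rs) of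
        (Some v, Some u) \<Rightarrow> cancels (scale_vector d v @ scale_vector (- 1) (map (\<lambda>(c, b). (c, basis_graphs ! b)) nb @ u))
      | _ \<Rightarrow> False)"

lemma ham_certs: "list_all ham_cert_valid ham_certs"
  by code_simp

text \<open>Every edge that avoids the sink has three lifts, except the edge from 1 to itself in the
  first graph: its lifts 4 and 7 are already targets of the same row.\<close>

definition field_descendants :: "graph_code list" where
  "field_descendants =
     [[[0, 1, 4, 7], [c, d, 5, 8], [e, f, 6, 9]]. c \<leftarrow> [1, 4, 7], d \<leftarrow> [3, 6, 9], e \<leftarrow> [1, 4, 7], f \<leftarrow> [2, 5, 8]] @
     [[[0, b, 4, 7], [c, d, 5, 8], [e, f, 6, 9]]. b \<leftarrow> [3, 6, 9], c \<leftarrow> [1, 4, 7], d \<leftarrow> [3, 6, 9], e \<leftarrow> [1, 4, 7], f \<leftarrow> [2, 5, 8]]"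

text \<open>
  Membership in a list in a form that the simplifier evaluates in linear time: without a logical connective
  on the right-hand side it does not visit the normalized tail of the list again after each step.
\<close>

fun occurs :: "bool \<Rightarrow> 'a \<Rightarrow> 'a list \<Rightarrow> bool" where
  "occurs True k K \<longleftrightarrow> True"
| "occurs False k [] \<longleftrightarrow> False"
| "occurs False k (g # K) \<longleftrightarrow> occurs (g = k) k K"

lemma occurs: "occurs b k K \<longleftrightarrow> b \<or> k \<in> set K"
  by (induction b k K rule: occurs.induct) auto

fun supported :: "graph_code list \<Rightarrow> graph_vector \<Rightarrow> bool" where
  "supported K [] \<longleftrightarrow> True"
| "supported K ((c, k) # v) \<longleftrightarrow> occurs False k K \<and> supported K v"

fun reducible :: "graph_code list \<Rightarrow> graph_code list \<Rightarrow> hint list \<Rightarrow> bool" where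
  "reducible K [] hs \<longleftrightarrow> True"
| "reducible K (g # gs) (h # hs) \<longleftrightarrow> bounded_graph g \<and>
     (case hint_vector 1 g h of None \<Rightarrow> False | Some v \<Rightarrow> supported K v) \<and> reducible K gs hs"
| "reducible K (g # gs) [] \<longleftrightarrow> False"

lemma descendant_hints: "reducible (further_graphs @ basis_graphs) field_descendants descendant_hints"
  by code_simp

fun is_field_graph :: "graph_code \<Rightarrow> bool" where
  "is_field_graph [a # p, r, s] \<longleftrightarrow> a = 0 \<and> length p = 3 \<and> length r = 4 \<and> length s = 4 \<and>
     list_all (\<lambda>v. v \<noteq> 0 \<and> v < 10) (p @ r @ s)"
| "is_field_graph _ \<longleftrightarrow> False"

lemma field_descendants_wf: "list_all is_field_graph field_descendants"
  by code_simp

text \<open>An easily checked sufficient condition for a sinkless micro-graph: keeping 3 and 5 out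
  of the first pair and 4 and 6 out of the second makes targets distinct, and an edge from 1 to 2 or
  to 4 connects the two copies.\<close>

fun is_ham_graph :: "graph_code \<Rightarrow> bool" where
  "is_ham_graph [[a, b, p, q], [c, d, r, s]] \<longleftrightarrow> p = 3 \<and> q = 5 \<and> r = 4 \<and> s = 6 \<and>
     a \<in> set [1, 2, 4, 6] \<and> b \<in> set [1, 2, 4, 6] \<and> c \<in> set [1, 2, 3, 5] \<and> d \<in> set [1, 2, 3, 5] \<and>
     a \<noteq> b \<and> c \<noteq> d \<and> (a = 2 \<or> a = 4 \<or> b = 2 \<or> b = 4)"
| "is_ham_graph _ \<longleftrightarrow> False"

lemma ham_certs_wf: "list_all (\<lambda>q. is_ham_graph (fst q)) ham_certs"
  by code_simp

lemma distinct_ham_certs: "distinct (map fst ham_certs)"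
  by (simp add: ham_certs_def)

lemma basis_graphs: "list_all is_field_graph basis_graphs" "length basis_graphs = 64"
  by code_simp+

lemma basis_degrees:
  "map (\<lambda>\<Gamma>. snd (with_degrees \<Gamma>)) basis_graphs = basis_degrees" "list_all (list_all (\<lambda>k. k \<le> 12)) basis_degrees"
  by code_simp+

text \<open>A list such as \<open>[[], [I2]]\<close> prescribes the jet of \<open>1 + x2\<close>,
  and the entry \<open>[I1,I1,I2,I4]\<close> stands for \<open>x1^2 x2 x4 / 2\<close>. The row
  paired with a test is the left-hand side of its linear equation, as coefficients with basis
  indices.\<close>

definition jet_tests1 :: "(jet_test \<times> (int \<times> nat) list) list" where
  "jet_tests1 =
   [((I1, I3, [[], [I2]], [[I1,I1,I2,I4], [I3]], [[I1], [I4]]), [(3,12)]), ((I1, I3, [[]], [[I1,I3,I3], [I2,I2], [I3],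
   [I4]], [[I1,I1,I2,I2], [I4]]), [(-1,60), (-1,61)]), ((I1, I2, [[I1,I1,I2], [I3]], [[I3], [I4]], [[I1], [I2],
   [I4]]), [(-6,0)]), ((I1, I3, [[], [I2,I2,I3]], [[I2,I2,I4], [I3], [I4,I4]], [[I1], [I4]]), [(1,34)]), ((I1, I3,
   [[], [I2], [I4,I4]], [[I2,I2,I2,I4], [I3]], [[I1], [I4]]), [(1,33)]), ((I1, I2, [[I3,I3], [I4]], [[I2], [I2,I3],
   [I3]], [[I1], [I4]]), [(1,2), (-1,38)]), ((I1, I3, [[]], [[I1,I1,I2,I2], [I2], [I3]], [[I1,I2], [I3], [I4], [I4,I4,
   I4]]), [(2,60)]), ((I1, I3, [[]], [[I1,I4], [I2,I2,I3,I3], [I2,I4], [I3]], [[I1,I1], [I2], [I4]]), [(1,54)]), ((I1,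
   I2, [[], [I2,I2,I2]], [[I3], [I3,I3,I4], [I4,I4]], [[I1], [I4]]), [(-2,5), (1,41)]), ((I1, I3, [[]], [[I2,I3], [I2,
   I4,I4,I4], [I3]], [[I1], [I1,I1], [I2,I2], [I4]]), [(-2,56), (1,63)]), ((I1, I3, [[], [I4]], [[I1,I1], [I1,I2,I2,
   I3], [I3]], [[I2], [I4]]), [(1,13), (1,43)]), ((I1, I3, [[], [I2]], [[I2,I2], [I2,I3,I3,I4], [I3], [I4,I4]], [[I1],
   [I4]]), [(2,18)]), ((I1, I3, [[]], [[I2], [I2,I4], [I3], [I4,I4]], [[I1,I1,I1,I2], [I2], [I3,I3], [I4]]), [(-1,
   55)])]"

definition jet_tests2 :: "(jet_test \<times> (int \<times> nat) list) list" where
  "jet_tests2 =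
   [((I1, I3, [[], [I1,I1,I1]], [[I2], [I3], [I4,I4]], [[I2,I2,I2], [I3], [I4]]), [(-2,6), (1,42)]), ((I1, I3, [[],
   [I1,I1]], [[I2,I2,I2,I4], [I3]], [[I1], [I2], [I4], [I4,I4]]), [(2,35)]), ((I1, I3, [[], [I3]], [[I1,I1,I4], [I2],
   [I3]], [[I1], [I2,I2,I2,I4], [I4]]), [(1,59)]), ((I1, I3, [[], [I2,I2], [I4,I4]], [[I1,I3], [I2,I2], [I3]], [[I1],
   [I4]]), [(-1,3)]), ((I1, I3, [[], [I1], [I1,I4,I4]], [[I1], [I2], [I2,I2,I2], [I3]], [[I3], [I4]]), [(-2,1), (2,
   40)]), ((I1, I2, [[], [I3]], [[I1,I2], [I2], [I3]], [[I1,I1,I2,I4], [I4]]), [(-2,14), (-2,57)]), ((I1, I3, [[],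
   [I1]], [[I1], [I2,I4], [I3], [I4,I4]], [[I1,I2,I2,I2], [I3], [I4]]), [(1,45)]), ((I1, I3, [[], [I4]], [[I1], [I1,
   I2,I2,I2], [I3]], [[I2], [I3,I4], [I4]]), [(-2,22), (-1,58)]), ((I1, I3, [[], [I1,I3], [I2,I2,I4]], [[I1,I1], [I2],
   [I3]], [[I2], [I4]]), [(-3,1), (-3,25)]), ((I1, I3, [[], [I1], [I1,I1,I2], [I4,I4]], [[I3], [I4]], [[I2], [I4]]),
   [(4,0), (2,24)]), ((I1, I3, [[], [I4]], [[I1], [I1,I4], [I3], [I3,I3]], [[I1], [I2,I2,I2,I2], [I4]]), [(-1,47)])]"

definition jet_tests3 :: "(jet_test \<times> (int \<times> nat) list) list" where
  "jet_tests3 =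
   [((I1, I3, [[], [I1,I1], [I2], [I3]], [[I1], [I2,I2,I2], [I3]], [[I4]]), [(-1,2), (-1,33)]), ((I1, I2, [[], [I2]],
   [[I1,I1,I4], [I1,I3], [I3]], [[I3], [I4]]), [(-1,12), (-2,29)]), ((I1, I3, [[], [I3,I3]], [[I2], [I3], [I4,I4,I4]],
   [[I1], [I1,I1], [I2,I2], [I4]]), [(1,37), (1,42), (1,49), (1,58)]), ((I1, I3, [[], [I1,I4]], [[I2,I2,I4], [I3]],
   [[I1,I2], [I4]]), [(-2,10)]), ((I1, I2, [[], [I1,I4], [I2]], [[I1,I1,I2], [I3]], [[I3], [I4]]), [(1,12), (1,26)]),
   ((I1, I2, [[], [I1], [I2,I2,I2]], [[I1,I1], [I3], [I4,I4]], [[I3], [I4]]), [(-2,0), (-1,1), (2,5), (-2,27)]), ((I1,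
   I3, [[], [I3,I4,I4]], [[I1,I2], [I3]], [[I1,I4], [I2], [I4]]), [(1,11), (1,37)]), ((I1, I3, [[], [I2,I2,I2]],
   [[I1], [I1,I1], [I3], [I4,I4]], [[I2,I3], [I3], [I4]]), [(1,8), (-1,11)]), ((I1, I3, [[], [I1]], [[I1,I2,I2], [I3],
   [I4]], [[I3,I3], [I4]]), [(2,19), (2,44), (2,52)])]"

definition jet_tests4 :: "(jet_test \<times> (int \<times> nat) list) list" where
  "jet_tests4 =
   [((I1, I3, [[], [I3]], [[I1,I1], [I3], [I4]], [[I1], [I2,I2,I2], [I2,I4,I4], [I4]]), [(2,44), (-2,53), (-2,62)]),
   ((I1, I3, [[], [I1,I1,I1]], [[I2], [I2,I4], [I3]], [[I2,I3], [I2,I4], [I4]]), [(4,5), (2,6), (1,49)]), ((I1, I3,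
   [[], [I1], [I4]], [[I1,I1], [I2,I2], [I3]], [[I2,I2,I3], [I4]]), [(-1,17), (-1,30), (-3,45), (2,50)]), ((I1, I3,
   [[], [I4]], [[I2,I4], [I3], [I3,I3]], [[I1], [I1,I2,I2], [I4]]), [(2,20), (1,47)]), ((I1, I3, [[], [I2]], [[I1],
   [I1,I4], [I3], [I3,I3]], [[I1,I2,I2], [I4]]), [(-1,16), (1,30), (-2,47)]), ((I1, I3, [[], [I1], [I4]], [[I1,I1,I4],
   [I3]], [[I2], [I2,I2], [I4]]), [(-9,12), (2,15), (1,31)]), ((I1, I3, [[], [I2]], [[I1], [I3], [I4,I4]], [[I1,I2,
   I3], [I2,I2,I3], [I4]]), [(-2,53)])]"

definition jet_tests5 :: "(jet_test \<times> (int \<times> nat) list) list" where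
  "jet_tests5 =
   [((I1, I2, [[], [I1], [I2]], [[I1,I3,I3], [I3], [I4]], [[I2,I2], [I4]]), [(2,12), (-1,31)]), ((I1, I3, [[], [I2,
   I2]], [[I1,I4], [I3], [I4,I4]], [[I1], [I1,I2], [I2,I3], [I4]]), [(1,8), (-1,11), (-2,21), (-1,51)]), ((I1, I3,
   [[], [I2]], [[I1], [I1,I1,I2], [I3], [I3,I3,I4]], [[I2,I2], [I4]]), [(1,19)]), ((I1, I3, [[], [I3]], [[I2,I2,I3],
   [I2,I2,I4], [I3], [I4]], [[I1], [I1,I4], [I4]]), [(4,46)]), ((I1, I2, [[], [I1,I3], [I3]], [[I2,I2,I2], [I3], [I4,
   I4]], [[I1], [I4]]), [(-1,3), (1,7), (-2,13), (1,33), (-1,34), (1,40)]), ((I1, I2, [[], [I1], [I2]], [[I2,I4,I4],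
   [I3]], [[I1,I2], [I1,I3], [I4]]), [(1,14), (1,17), (3,45), (1,58)])]"

definition jet_tests6 :: "(jet_test \<times> (int \<times> nat) list) list" where
  "jet_tests6 =
   [((I1, I3, [[], [I2,I3]], [[I1,I1], [I3], [I4]], [[I1], [I2,I2], [I4]]), [(-1,4)]), ((I1, I2, [[], [I4]], [[I1,I1,
   I1], [I3]], [[I2,I2,I4], [I2,I3], [I4]]), [(1,19), (-1,47), (1,52), (-1,58), (-1,61)]), ((I1, I2, [[], [I2,I3]],
   [[I1,I4], [I2], [I3]], [[I1,I1], [I4]]), [(-2,9), (-4,36)]), ((I1, I3, [[], [I4]], [[I1,I4], [I3]], [[I1,I3], [I2,
   I2], [I4]]), [(2,23), (1,51)]), ((I1, I3, [[], [I4]], [[I1], [I1,I1], [I3]], [[I2,I2], [I2,I3], [I2,I4], [I4]]),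
   [(1,16), (-2,32)])]"

definition jet_tests7 :: "(jet_test \<times> (int \<times> nat) list) list" where
  "jet_tests7 =
   [((I1, I3, [[], [I2], [I4,I4]], [[I1], [I1,I1], [I3]], [[I2,I2,I2], [I3], [I4]]), [(1,36)]), ((I1, I3, [[], [I3],
   [I4,I4]], [[I2], [I2,I2,I2], [I3]], [[I1], [I1,I1], [I4]]), [(-1,2), (-1,9), (1,14), (-1,35), (-1,36), (1,38), (1,
   39), (2,40), (1,48)]), ((I1, I3, [[], [I1], [I4,I4]], [[I1,I3,I3], [I2], [I3]], [[I1], [I2,I2], [I4]]), [(-1,9),
   (-2,28), (-1,33), (1,40), (1,42), (1,48), (-1,57)]), ((I1, I3, [[], [I1,I1], [I2]], [[I1], [I2], [I3], [I4,I4,I4]],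
   [[I2], [I3,I3], [I4]]), [(-1,9), (1,33), (-2,35), (-1,40), (-1,48), (-1,57)])]"

definition jet_tests8 :: "(jet_test \<times> (int \<times> nat) list) list" where
  "jet_tests8 =
   [((I1, I3, [[], [I3]], [[I1,I1,I1], [I2], [I2,I4], [I3]], [[I2,I2], [I4]]), [(-1,16), (-1,17), (-2,43), (1,52), (1,
   53), (1,57), (1,62)]), ((I1, I3, [[], [I2]], [[I2], [I3], [I3,I3], [I4,I4]], [[I1,I1], [I1,I2,I2], [I4]]), [(2,51),
   (-3,55), (1,58), (2,63)])]"

definition jet_tests :: "(jet_test \<times> (int \<times> nat) list) list" where
  "jet_tests = jet_tests1 @ jet_tests2 @ jet_tests3 @ jet_tests4 @ jet_tests5 @ jet_tests6 @ jet_tests7 @ jet_tests8"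

definition sparse_row :: "int list \<Rightarrow> (int \<times> nat) list" where
  "sparse_row vs = filter (\<lambda>(c, i). c \<noteq> 0) (zip vs [0..<64])"

definition test_row :: "jet_test \<Rightarrow> (int \<times> nat) list" where
  "test_row t = sparse_row (map (test_value t) (zip basis_graphs basis_degrees))"

lemma jet_tests1: "list_all (\<lambda>(t, row). test_row t = row) jet_tests1"
  by code_simp

lemma jet_tests2: "list_all (\<lambda>(t, row). test_row t = row) jet_tests2"
  by code_simp

lemma jet_tests3: "list_all (\<lambda>(t, row). test_row t = row) jet_tests3"
  by code_simp

lemma jet_tests4: "list_all (\<lambda>(t, row). test_row t = row) jet_tests4"
  by code_simp

lemma jet_tests5: "list_all (\<lambda>(t, row). test_row t = row) jet_tests5"
  by code_simp

lemma jet_tests6: "list_all (\<lambda>(t, row). test_row t = row) jet_tests6"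
  by code_simp

lemma jet_tests7: "list_all (\<lambda>(t, row). test_row t = row) jet_tests7"
  by code_simp

lemma jet_tests8: "list_all (\<lambda>(t, row). test_row t = row) jet_tests8"
  by code_simp

text \<open>Entry \<open>b\<close> holds the multipliers of the test rows that eliminate all but the
  7 pivot coordinates from 24 times coordinate \<open>b\<close>. It is empty exactly at the
  pivots.\<close>

definition solution_certs :: "(int \<times> nat) list list" where
  "solution_certs =
   [[(4,2)], [], [(24,4), (24,24)], [(24,16)], [(24,46)], [], [], [(-24,3), (24,4), (-48,10), (24,16), (12,17), (-24,
   44)], [(-24,13), (24,20), (24,26), (-24,30), (-24,31), (-24,34)], [(12,48), (48,51)], [(12,27)], [(-24,13), (24,
   20), (24,26), (-24,30), (-24,34)], [(-8,0)], [(-24,10)], [(12,18)], [(-28,0), (-12,38), (-12,40)], [(12,18), (-72,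
   19), (24,20), (-12,32), (12,33), (24,42), (24,45), (24,55)], [(-12,18), (72,19), (-24,20), (-24,45)], [(-12,11)],
   [(-24,42)], [(-12,23), (-12,36)], [(-12,9), (-18,12), (6,20), (-12,31), (12,41), (6,56)], [], [(-12,9), (-18,12),
   (6,20), (-12,49), (6,56)], [(-8,2), (-12,22)], [(8,21)], [(8,0), (-24,28)], [(-4,2), (12,29)], [(-12,13), (12,14),
   (-12,48), (-48,51), (12,53), (12,54)], [(4,0), (12,25)], [(12,18), (-72,19), (24,20), (48,23), (-12,32), (12,33),
   (-24,37), (24,42), (24,45), (24,55)], [(-16,0), (24,40)], [(6,18), (-36,19), (12,20), (-6,32), (6,33), (12,42),
   (12,45), (12,50), (12,55)], [(-24,4)], [(-24,3)], [(-12,14)], [(-24,51)], [(24,13), (-24,20), (-24,26), (24,34)],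
   [(24,4), (24,5), (24,24)], [(24,4), (-24,5), (-36,14), (12,17), (-12,18), (24,48), (72,51), (-24,52), (-24,54)],
   [(-12,17)], [(-24,8)], [(-24,13)], [], [(-24,1), (-12,6), (-24,20), (-24,23), (-12,32), (24,47)], [(-24,19)], [(-6,
   43)], [(24,23)], [(-24,4), (24,14), (12,17), (-12,48), (-48,51), (24,54)], [(-24,34)], [(-36,19), (24,23), (-6,32),
   (6,33), (-12,35), (-12,37), (12,42), (12,55)], [(24,9), (36,12), (-12,20), (-12,56)], [(24,1), (12,6), (24,20),
   (24,23), (24,42), (-24,47)], [(12,39)], [(-24,7)], [(24,12)], [], [], [(24,20)], [(-24,15)], [(-12,6)], [(24,1),
   (12,6)], [(-24,1), (-12,6), (-24,20), (-24,23), (-12,32), (12,33), (-12,39), (24,47)], [(-24,9)]]"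

lemma jet_tests_wf: "list_all (\<lambda>((a, b, _), _). a = I1 \<and> (b = I2 \<or> b = I3)) jet_tests" "length jet_tests = 57"
  by code_simp+

definition coefficient :: "(int \<times> nat) list \<Rightarrow> nat \<Rightarrow> int" where
  "coefficient v i = (\<Sum>(c, k)\<leftarrow>v. if k = i then c else 0)"

definition row_combination :: "(int \<times> nat) list \<Rightarrow> (int \<times> nat) list" where
  "row_combination rs = concat (map (\<lambda>(c, r). scale_vector c (map snd jet_tests ! r)) rs)"

definition kernel_vectors :: "((int \<times> nat) list \<times> nat \<times> int) list" where
  "kernel_vectors = map (\<lambda>(H, hs, d, nb, rs, f, e). (nb, f, e)) ham_certs"

text \<open>Once the rows vanish, 24 times coordinate \<open>b\<close> is the sum of
  \<open>(24 / e) * coefficient nb b * u f\<close> over the kernel vectors. So every solution is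
  their combination with weights \<open>u f / e\<close>, read off at the pivots.\<close>

lemma solution_certs:
  "list_all2 (\<lambda>b rs. list_all (\<lambda>(c, r). r < 57) rs \<and>
     cancels ((24, b) # map (\<lambda>(nb, f, e). (- ((24 div e) * coefficient nb b), f)) kernel_vectors @ row_combination rs))
     [0..<64] solution_certs"
  by code_simp

section \<open>The space of skew-symmetrized vector fields\<close>

lemma is_field_graph: "is_field_graph g \<Longrightarrow> field_graph g"
proof -
  assume g: "is_field_graph g"
  then obtain a p r s where gs: "g = [a # p, r, s]" by (cases g rule: is_field_graph.cases) auto
  then have c: "a = 0" "length p = 3" "length r = 4" "length s = 4" "\<forall>v\<in>set (p @ r @ s). v \<noteq> 0 \<and> v < 10"
    using g by (auto simp: list_all_iff)
  then obtain b d e where p: "p = [b, d, e]" by (auto simp: length_Suc_conv eval_nat_numeral)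
  have "set ([b, d, e] @ r @ s) \<subseteq> {1..9}"
  proof
    fix v assume "v \<in> set ([b, d, e] @ r @ s)"
    then have "v \<noteq> 0 \<and> v < 10" using c(5) p by blast
    then show "v \<in> {1..9}" by auto
  qed
  then show ?thesis unfolding field_graph_def using gs c p by blast
qed

lemma basis_field_graph: "b < 64 \<Longrightarrow> field_graph (basis_graphs ! b)"
  using basis_graphs by (simp add: list_all_length is_field_graph)

section \<open>Listing the descendants and reducing them to coordinates\<close>

lemma target_simps:
  "target [r, s, t] 1 q = r ! (q - 1)" "target [r, s, t] 2 q = s ! (q - 1)" "target [r, s, t] 3 q = t ! (q - 1)"
  by (simp_all add: target_def)

lemma in_field_graph_list:
  "b \<in> set as \<Longrightarrow> c \<in> set bs \<Longrightarrow> d \<in> set cs \<Longrightarrow> e \<in> set ds \<Longrightarrow> f \<in> set es \<Longrightarrow>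
   [[0, b, 4, 7], [c, d, 5, 8], [e, f, 6, 9::nat]] \<in>
     set [[[0, b, 4, 7], [c, d, 5, 8], [e, f, 6, 9]]. b \<leftarrow> as, c \<leftarrow> bs, d \<leftarrow> cs, e \<leftarrow> ds, f \<leftarrow> es]"
  by (auto simp: image_iff)

lemma in_field_graph_list':
  "c \<in> set bs \<Longrightarrow> d \<in> set cs \<Longrightarrow> e \<in> set ds \<Longrightarrow> f \<in> set es \<Longrightarrow>
   [[0, 1, 4, 7], [c, d, 5, 8], [e, f, 6, 9::nat]] \<in>
     set [[[0, 1, 4, 7], [c, d, 5, 8], [e, f, 6, 9]]. c \<leftarrow> bs, d \<leftarrow> cs, e \<leftarrow> ds, f \<leftarrow> es]"
  by auto

text \<open>The last two entries of each row are prescribed, and distinctness of the first row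
  excludes 4 and 7 for \<open>b\<close>; for \<open>t = 1\<close> this leaves only one lift.\<close>

lemma descendants_rows:
  assumes "\<Gamma> \<in> descendants [[0, t], [1, 3], [1, 2]]" "t \<noteq> 0"
  shows "\<exists>b c d e f. \<Gamma> = [[0, b, 4, 7], [c, d, 5, 8], [e, f, 6, 9]] \<and> b \<in> {t, t + 3, t + 6} \<and> b \<noteq> 4 \<and> b \<noteq> 7 \<and>
    c \<in> set [1, 4, 7] \<and> d \<in> set [3, 6, 9] \<and> e \<in> set [1, 4, 7] \<and> f \<in> set [2, 5, 8]"
proof -
  have "length \<Gamma> = 3" and rows: "\<And>k. k \<in> {1..3} \<Longrightarrow> length (\<Gamma> ! (k - 1)) = 4 \<and> distinct (\<Gamma> ! (k - 1))"
    using assms unfolding descendants_def nambu_micrograph_def by auto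
  then obtain r s u where \<Gamma>: "\<Gamma> = [r, s, u]" by (auto simp: length_Suc_conv eval_nat_numeral)
  have "length r = 4" "distinct r" "length s = 4" "length u = 4"
    using rows[of 1] rows[of 2] rows[of 3] unfolding \<Gamma> by simp_all
  then obtain r1 r2 r3 r4 s1 s2 s3 s4 u1 u2 u3 u4 where
    L: "r = [r1, r2, r3, r4]" "s = [s1, s2, s3, s4]" "u = [u1, u2, u3, u4]"
    by (auto simp: length_Suc_conv eval_nat_numeral)
  have T: "target \<Gamma> k 1 \<in> target_lifts (target [[0, t], [1, 3], [1, 2]] k 1) \<and>
      target \<Gamma> k 2 \<in> target_lifts (target [[0, t], [1, 3], [1, 2]] k 2) \<and>
      target \<Gamma> k 3 = 3 + k \<and> target \<Gamma> k 4 = 6 + k" if "k \<in> {1..3}" for k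
    using assms(1) that unfolding descendants_def by blast
  have "r1 = 0" "r2 \<in> {t, t + 3, t + 6}" "r3 = 4" "r4 = 7" using T[of 1] assms(2)
    unfolding \<Gamma> L target_simps by (simp_all add: target_lifts_def)
  moreover have "s1 \<in> set [1, 4, 7]" "s2 \<in> set [3, 6, 9]" "s3 = 5" "s4 = 8" using T[of 2]
    unfolding \<Gamma> L target_simps by (simp_all add: target_lifts_def)
  moreover have "u1 \<in> set [1, 4, 7]" "u2 \<in> set [2, 5, 8]" "u3 = 6" "u4 = 9" using T[of 3]
    unfolding \<Gamma> L target_simps by (simp_all add: target_lifts_def)
  moreover have "r2 \<noteq> r3" "r2 \<noteq> r4" using \<open>distinct r\<close> L by auto
  ultimately show ?thesis unfolding \<Gamma> L by blast
qed

lemma descendants_listed: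
  assumes "\<Gamma> \<in> descendants [[0, 1], [1, 3], [1, 2]] \<union> descendants [[0, 3], [1, 3], [1, 2]]"
  shows "\<Gamma> \<in> set field_descendants"
  using assms
proof
  assume "\<Gamma> \<in> descendants [[0, 1], [1, 3], [1, 2]]"
  from descendants_rows[OF this] obtain b c d e f where
    g: "\<Gamma> = [[0, b, 4, 7], [c, d, 5, 8], [e, f, 6, 9]]" and b: "b \<in> {1, 1 + 3, 1 + 6}" "b \<noteq> 4" "b \<noteq> 7" and
    m: "c \<in> set [1, 4, 7]" "d \<in> set [3, 6, 9]" "e \<in> set [1, 4, 7]" "f \<in> set [2, 5, 8]" by auto
  have "b = 1" using b by auto
  then show ?thesis using in_field_graph_list'[OF m] unfolding g field_descendants_def by simp
next
  assume "\<Gamma> \<in> descendants [[0, 3], [1, 3], [1, 2]]"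
  from descendants_rows[OF this] obtain b c d e f where
    g: "\<Gamma> = [[0, b, 4, 7], [c, d, 5, 8], [e, f, 6, 9]]" and b: "b \<in> {3, 3 + 3, 3 + 6}" and
    m: "c \<in> set [1, 4, 7]" "d \<in> set [3, 6, 9]" "e \<in> set [1, 4, 7]" "f \<in> set [2, 5, 8]" by auto
  have "b \<in> set [3, 6, 9]" using b by auto
  from in_field_graph_list[OF this m] show ?thesis unfolding g field_descendants_def set_append by (rule UnI2)
qed

lemma supported_spanned:
  assumes "supported (further_graphs @ basis_graphs) v" "(c, k) \<in> set v"
  shows "spanned basis_graphs k"
proof (rule span_closure[OF further_graphs])
  show "k \<in> set (further_graphs @ basis_graphs)"
    using assms by (induction v rule: supported.induct) (auto simp: occurs)
qed (rule spanned_basis)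

lemma reducible_spanned:
  "reducible (further_graphs @ basis_graphs) gs hs \<Longrightarrow> g \<in> set gs \<Longrightarrow> spanned basis_graphs g"
proof (induction gs arbitrary: hs)
  case (Cons g' gs)
  obtain h hs' where hs: "hs = h # hs'" using Cons.prems(1) by (cases hs) auto
  show ?case
  proof (cases "g = g'")
    case True
    have "bounded_graph g \<and> (case hint_vector 1 g h of None \<Rightarrow> False | Some v \<Rightarrow> supported (further_graphs @ basis_graphs) v)"
      using Cons.prems(1) unfolding hs True reducible.simps by blast
    then obtain v where v: "bounded_graph g" "hint_vector 1 g h = Some v" "supported (further_graphs @ basis_graphs) v"
      by (auto split: option.splits)
    show ?thesis
    proof (rule spanned_scaled[of 1])
      show "of_int 1 * skew_value \<mu> \<mu>1 \<mu>2 j g = vector_value (skew_value \<mu> \<mu>1 \<mu>2 j) v" for \<mu> \<mu>1 \<mu>2 j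
        by (rule hint_vector[OF v(2,1)])
    qed (use supported_spanned[OF v(3)] in auto)
  next
    case False
    then show ?thesis using Cons unfolding hs by auto
  qed
qed simp

lemma phi_minus_skew_value:
  assumes \<Gamma>: "field_graph \<Gamma>" and smooth: "smooth \<rho>" "smooth a1" "smooth a2"
    and mom: "has_moments 13 \<mu> \<rho> x" "has_moments 13 \<mu>1 a1 x" "has_moments 13 \<mu>2 a2 x"
  shows "phi_minus \<Gamma> \<rho> a1 a2 {j} x = 1 / 2 * skew_value \<mu> \<mu>1 \<mu>2 j \<Gamma>"
proof -
  have *: "phi \<Gamma> \<rho> b1 b2 {j} x = multi_integ (class_measure \<mu> \<nu>1 \<nu>2) [1..<10] (brackets \<Gamma>) (\<lambda>_. axis j 1)"
    if "smooth b1" "smooth b2" "has_moments 13 \<nu>1 b1 x" "has_moments 13 \<nu>2 b2 x" for b1 b2 \<nu>1 \<nu>2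
  proof -
    have "\<forall>v\<in>{1..9}. has_moments 13 (class_measure \<mu> \<nu>1 \<nu>2 v) (vertex_content 3 \<rho> b1 b2 v) x"
      using that mom by (auto simp: class_measure_def vertex_content_def)
    note V = phi_vector_jets(1)[OF \<Gamma> smooth(1) that(1,2) this, where i = j and ?p0.0 = "\<lambda>_. axis j 1"]
    show ?thesis unfolding V
    proof (rule multi_integ_cong)
      fix p :: "nat \<Rightarrow> real^4" assume "\<And>w. w \<notin> set [1..<10] \<Longrightarrow> p w = axis j 1"
      then have "p 0 = axis j 1" by simp
      then show "brackets \<Gamma> (p(0 := axis j 1)) = brackets \<Gamma> p" by (metis fun_upd_triv)
    qed
  qed
  show ?thesis unfolding phi_minus_def skew_value_def
    using *[OF smooth(2,3) mom(2,3)] *[OF smooth(3,2) mom(3,2)] by simp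
qed

lemma phi_field:
  assumes \<Gamma>: "field_graph \<Gamma>" and smooth: "smooth \<rho>" "smooth a1" "smooth a2"
  shows "phi \<Gamma> \<rho> a1 a2 I differentiable (at x)"
    and "(\<And>j. I \<noteq> {j}) \<Longrightarrow> phi \<Gamma> \<rho> a1 a2 I = (\<lambda>x. 0)"
proof -
  obtain \<mu> \<mu>1 \<mu>2 where mom: "has_moments 13 \<mu> \<rho> x" "has_moments 13 \<mu>1 a1 x" "has_moments 13 \<mu>2 a2 x"
    using has_moments_exists smooth by metis
  then have "\<forall>v\<in>{1..9}. has_moments 13 (class_measure \<mu> \<mu>1 \<mu>2 v) (vertex_content 3 \<rho> a1 a2 v) x"
    by (auto simp: class_measure_def vertex_content_def)
  note V = phi_vector_jets[OF \<Gamma> smooth this]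
  show "phi \<Gamma> \<rho> a1 a2 I differentiable (at x)" by (rule V(2))
  show "phi \<Gamma> \<rho> a1 a2 I = (\<lambda>x. 0)" if "\<And>j. I \<noteq> {j}" by (rule V(4)) (rule that)
qed

lemma phi_minus_differentiable:
  assumes "field_graph \<Gamma>" "smooth \<rho>" "smooth a1" "smooth a2"
  shows "phi_minus \<Gamma> \<rho> a1 a2 I differentiable (at x)"
  unfolding phi_minus_def
  by (intro derivative_intros phi_field(1) assms)

text \<open>At each point there are measures that represent the three jets, so an identity of
  \<open>skew_value\<close> carries over with the same coefficients; components of degree other than
  1 vanish on both sides.\<close>

lemma phi_minus_spanned:
  assumes \<Gamma>: "field_graph \<Gamma>"
    and v: "\<And>\<mu> \<mu>1 \<mu>2 j. skew_value \<mu> \<mu>1 \<mu>2 j \<Gamma> = (\<Sum>b<64. v b * skew_value \<mu> \<mu>1 \<mu>2 j (basis_graphs ! b))"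
    and smooth: "smooth \<rho>" "smooth a1" "smooth a2"
  shows "phi_minus \<Gamma> \<rho> a1 a2 I x = (\<Sum>b<64. v b * phi_minus (basis_graphs ! b) \<rho> a1 a2 I x)"
proof (cases "\<exists>j. I = {j}")
  case True
  then obtain j where I: "I = {j}" by blast
  obtain \<mu> \<mu>1 \<mu>2 where mom: "has_moments 13 \<mu> \<rho> x" "has_moments 13 \<mu>1 a1 x" "has_moments 13 \<mu>2 a2 x"
    using has_moments_exists smooth by metis
  show ?thesis unfolding I phi_minus_skew_value[OF \<Gamma> smooth mom] v sum_distrib_left
    by (rule sum.cong[OF refl]) (simp add: phi_minus_skew_value[OF basis_field_graph smooth mom])
next
  case False
  then have "phi_minus g \<rho> a1 a2 I x = 0" if "field_graph g" for g
    using phi_field(2)[OF that] smooth by (simp add: phi_minus_def)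
  then show ?thesis using \<Gamma> basis_field_graph by simp
qed

text \<open>The coordinates of each descendant depend on the graph only, so summing over
  \<open>T\<close> gives constant coordinates for the field.\<close>

lemma W_minus_coordinates:
  assumes "X \<in> W_minus"
  shows "\<exists>u::nat \<Rightarrow> real. \<forall>\<rho> a1 a2. smooth \<rho> \<and> smooth a1 \<and> smooth a2 \<longrightarrow>
    X \<rho> a1 a2 = (\<lambda>I x. \<Sum>b<64. u b * phi_minus (basis_graphs ! b) \<rho> a1 a2 I x)"
proof -
  obtain T c where T: "finite T" "T \<subseteq> descendants [[0, 1], [1, 3], [1, 2]] \<union> descendants [[0, 3], [1, 3], [1, 2]]"
    and X: "\<And>\<rho> a1 a2. smooth \<rho> \<and> smooth a1 \<and> smooth a2 \<Longrightarrow> X \<rho> a1 a2 = (\<lambda>I x. \<Sum>\<Gamma>\<in>T. c \<Gamma> * phi_minus \<Gamma> \<rho> a1 a2 I x)"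
    using assms unfolding W_minus_def real_span_def by blast
  have d: "\<Gamma> \<in> set field_descendants" if "\<Gamma> \<in> T" for \<Gamma>
    using descendants_listed T(2) that by blast
  then have "\<forall>\<Gamma>\<in>T. \<exists>v::nat \<Rightarrow> real. \<forall>\<mu> \<mu>1 \<mu>2 j. skew_value \<mu> \<mu>1 \<mu>2 j \<Gamma> = (\<Sum>b<64. v b * skew_value \<mu> \<mu>1 \<mu>2 j (basis_graphs ! b))"
    using reducible_spanned[OF descendant_hints] unfolding spanned_def basis_graphs(2) by blast
  from bchoice[OF this] obtain v :: "graph_code \<Rightarrow> nat \<Rightarrow> real" where
    v: "\<And>\<Gamma> \<mu> \<mu>1 \<mu>2 j. \<Gamma> \<in> T \<Longrightarrow> skew_value \<mu> \<mu>1 \<mu>2 j \<Gamma> = (\<Sum>b<64. v \<Gamma> b * skew_value \<mu> \<mu>1 \<mu>2 j (basis_graphs ! b))"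
    by blast
  show ?thesis
  proof (intro exI[of _ "\<lambda>b. \<Sum>\<Gamma>\<in>T. c \<Gamma> * v \<Gamma> b"] allI impI)
    fix \<rho> a1 a2 assume s: "smooth \<rho> \<and> smooth a1 \<and> smooth a2"
    have "phi_minus \<Gamma> \<rho> a1 a2 I x = (\<Sum>b<64. v \<Gamma> b * phi_minus (basis_graphs ! b) \<rho> a1 a2 I x)" if "\<Gamma> \<in> T" for \<Gamma> I x
    proof (rule phi_minus_spanned)
      show "field_graph \<Gamma>"
        using field_descendants_wf d[OF that] by (auto simp: list_all_iff intro: is_field_graph)
    qed (use v[OF that] s in auto)
    then have "(\<Sum>\<Gamma>\<in>T. c \<Gamma> * phi_minus \<Gamma> \<rho> a1 a2 I x) =
        (\<Sum>\<Gamma>\<in>T. \<Sum>b<64. c \<Gamma> * v \<Gamma> b * phi_minus (basis_graphs ! b) \<rho> a1 a2 I x)" for I x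
      by (simp add: sum_distrib_left mult.assoc)
    then show "X \<rho> a1 a2 = (\<lambda>I x. \<Sum>b<64. (\<Sum>\<Gamma>\<in>T. c \<Gamma> * v \<Gamma> b) * phi_minus (basis_graphs ! b) \<rho> a1 a2 I x)"
      unfolding X[OF s] sum_distrib_right by (simp only: sum.swap[of _ "{..<64}"])
  qed
qed

section \<open>Fields that commute with the Poisson bivector\<close>

lemma schouten_phi_minus:
  assumes "field_graph \<Gamma>" "smooth \<rho>" "smooth a1" "smooth a2"
  shows "schouten F (phi_minus \<Gamma> \<rho> a1 a2) I x =
    1 / 2 * (schouten F (phi \<Gamma> \<rho> a1 a2) I x - schouten F (phi \<Gamma> \<rho> a2 a1) I x)"
proof -
  have "schouten F (phi_minus \<Gamma> \<rho> a1 a2) I x = (\<Sum>s\<in>(UNIV::bool set). (if s then 1 / 2 else - 1 / 2) *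
      schouten F (if s then phi \<Gamma> \<rho> a1 a2 else phi \<Gamma> \<rho> a2 a1) I x)"
    by (rule schouten_sum)
      (auto simp: fun_eq_iff phi_minus_def UNIV_bool field_simps intro!: phi_field(1) assms)
  then show ?thesis by (simp add: UNIV_bool field_simps)
qed

text \<open>In this type \<open>4 = 0\<close> is the least element, so the order of indices needs
  care; the tests use only the components 12 and 13.\<close>

lemma less_4: "(1::4) < 2" "(1::4) < 3"
  by (simp_all add: less_bit0_def bit0.Rep_numeral bit0.Rep_1)

text \<open>One triple of functions serves all graphs at once, which makes a test a linear
  functional of the coordinates.\<close>

lemma jet_test_value:
  assumes "a = I1" "b = I2 \<or> b = I3"
  shows "\<exists>\<rho> a1 a2. smooth \<rho> \<and> smooth a1 \<and> smooth a2 \<and> (\<forall>\<Gamma>. field_graph \<Gamma> \<longrightarrow>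
    (\<forall>w\<in>{1..12}. in_degree \<Gamma> w \<le> 12) \<longrightarrow>
    schouten (nambu \<rho> a1 a2) (phi_minus \<Gamma> \<rho> a1 a2) {coord_of a, coord_of b} 0 =
      1 / 2 * real_of_int (test_value (a, b, r, m1, m2) (with_degrees \<Gamma>)))"
proof -
  have ab: "coord_of a < coord_of b" using assms less_4 by auto
  let ?mom = "\<lambda>\<mu> ms. \<forall>is. length is \<le> 13 \<longrightarrow>
     integ \<mu> (coord_prod (map coord_of is)) = real (length (filter (\<lambda>m. mset m = mset is) ms))"
  obtain \<rho> \<mu> where \<rho>: "smooth \<rho>" "has_moments 13 \<mu> \<rho> 0" "?mom \<mu> r" using smooth_with_jets by blast
  obtain a1 \<mu>1 where a1: "smooth a1" "has_moments 13 \<mu>1 a1 0" "?mom \<mu>1 m1" using smooth_with_jets by blast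
  obtain a2 \<mu>2 where a2: "smooth a2" "has_moments 13 \<mu>2 a2 0" "?mom \<mu>2 m2" using smooth_with_jets by blast
  have val: "schouten (nambu \<rho> a1 a2) (phi \<Gamma> \<rho> b1 b2) {coord_of a, coord_of b} 0 =
      real_of_int (schouten_value a b [[[]], r, r, r, n1, n1, n1, n2, n2, n2, r, m1, m2] (with_degrees \<Gamma>))"
    if \<Gamma>: "field_graph \<Gamma>" "\<forall>w\<in>{1..12}. in_degree \<Gamma> w \<le> 12"
      and b1: "smooth b1" "has_moments 13 \<nu>1 b1 0" "?mom \<nu>1 n1"
      and b2: "smooth b2" "has_moments 13 \<nu>2 b2 0" "?mom \<nu>2 n2" for \<Gamma> b1 b2 \<nu>1 \<nu>2 n1 n2
  proof -
    \<comment> \<open>The entry at position 0 is a dummy for the sink and is never integrated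
      over.\<close>
    define C where "C v = [[], \<mu>, \<mu>, \<mu>, \<nu>1, \<nu>1, \<nu>1, \<nu>2, \<nu>2, \<nu>2, \<mu>, \<mu>1, \<mu>2] ! v" for v
    let ?cs = "[[[]], r, r, r, n1, n1, n1, n2, n2, n2, r, m1, m2]"
    have V: "{1..9} = {1, 2, 3, 4, 5, 6, 7, 8, 9::nat}" "{1..12} = {1, 2, 3, 4, 5, 6, 7, 8, 9, 10, 11, 12::nat}"
      by (auto simp: eval_nat_numeral le_Suc_eq)
    have C9: "\<forall>v\<in>{1..9}. has_moments 13 (C v) (vertex_content 3 \<rho> b1 b2 v) 0"
      unfolding V C_def using \<rho> b1 b2 by (simp add: vertex_content_def)
    have Cm: "\<forall>v\<in>{1..12}. ?mom (C v) (?cs ! v)"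
      unfolding V C_def using \<rho>(3) a1(3) a2(3) b1(3) b2(3) by simp
    have "real_of_int (schouten_value a b ?cs (with_degrees \<Gamma>)) =
      (\<Sum>v\<in>{1..12}. \<Sum>(s, g)\<leftarrow>schouten_graphs a b \<Gamma> v. of_int s * multi_integ C [1..<13] (slot_brackets g) (\<lambda>_. 0))"
      by (rule schouten_value_correct[OF \<Gamma>(1)]) (use \<Gamma>(2) Cm in auto)
    also have "\<dots> = schouten (nambu \<rho> a1 a2) (phi \<Gamma> \<rho> b1 b2) {coord_of a, coord_of b} 0"
      by (rule schouten_phi[symmetric, OF \<Gamma>(1) \<rho>(1) a1(1) a2(1) b1(1) b2(1) C9 _ _ _ ab])
        (use \<rho> a1 a2 in \<open>simp_all add: C_def\<close>)
    finally show ?thesis by simp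
  qed
  show ?thesis
  proof (rule exI[of _ \<rho>], rule exI[of _ a1], rule exI[of _ a2], intro conjI allI impI)
    fix \<Gamma> assume \<Gamma>: "field_graph \<Gamma>" "\<forall>w\<in>{1..12}. in_degree \<Gamma> w \<le> 12"
    show "schouten (nambu \<rho> a1 a2) (phi_minus \<Gamma> \<rho> a1 a2) {coord_of a, coord_of b} 0 =
      1 / 2 * real_of_int (test_value (a, b, r, m1, m2) (with_degrees \<Gamma>))"
      unfolding schouten_phi_minus[OF \<Gamma>(1) \<rho>(1) a1(1) a2(1)] val[OF \<Gamma> a1 a2] val[OF \<Gamma> a2 a1] test_value_def
      by simp
  qed (use \<rho> a1 a2 in auto)
qed

lemma vector_value_coefficient:
  assumes "list_all (\<lambda>(c, b). b < n) v"
  shows "vector_value w v = (\<Sum>b<n. of_int (coefficient v b) * w b)"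
  using assms
proof (induction v)
  case (Cons t v)
  obtain c k where t: "t = (c, k)" by fastforce
  then have k: "k < n" using Cons.prems by simp
  have "(\<Sum>b<n. of_int (if k = b then c else 0) * w b) = (\<Sum>b<n. if k = b then of_int c * w b else 0)"
    by (rule sum.cong) auto
  also have "\<dots> = of_int c * w k" using k by simp
  finally show ?case using Cons
    by (simp add: t coefficient_def distrib_right sum.distrib)
qed (simp add: coefficient_def)

lemma vector_value_sparse_row:
  assumes "length vs = 64"
  shows "vector_value w (sparse_row vs) = (\<Sum>b<64. of_int (vs ! b) * w b)"
proof -
  have "vector_value w (filter (\<lambda>(c, i). c \<noteq> 0) ts) = vector_value w ts" for ts :: "(int \<times> nat) list"
    by (induction ts) auto
  then have "vector_value w (sparse_row vs) = vector_value w (zip vs [0..<64])"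
    unfolding sparse_row_def .
  also have "\<dots> = (\<Sum>b<64. of_int (vs ! b) * w b)"
    unfolding vector_value_def sum_list_sum_nth using assms by (simp add: atLeast0LessThan)
  finally show ?thesis .
qed

lemma jet_tests: "(t, eqn) \<in> set jet_tests \<Longrightarrow> test_row t = eqn"
proof -
  assume t: "(t, eqn) \<in> set jet_tests"
  have "list_all (\<lambda>(t, eqn). test_row t = eqn) jet_tests"
    unfolding jet_tests_def list_all_append
    by (intro conjI jet_tests1 jet_tests2 jet_tests3 jet_tests4 jet_tests5 jet_tests6 jet_tests7 jet_tests8)
  then have "(\<lambda>(t, eqn). test_row t = eqn) (t, eqn)" using t unfolding list_all_iff by (rule bspec)
  then show ?thesis unfolding prod.case .
qed

lemma basis_in_degree:
  assumes "b < 64" "w \<in> {1..12}"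
  shows "in_degree (basis_graphs ! b) w \<le> 12"
proof -
  have "basis_degrees ! b = snd (with_degrees (basis_graphs ! b))"
    unfolding basis_degrees(1)[symmetric] using assms(1) basis_graphs(2) by simp
  moreover have "basis_degrees ! b \<in> set basis_degrees"
    using assms(1) basis_graphs(2) basis_degrees(1) by (metis length_map nth_mem)
  moreover have "w \<in> set [0, 1, 2, 3, 4, 5, 6, 7, 8, 9, 10, 11, 12]"
    using assms(2) by (auto simp: eval_nat_numeral le_Suc_eq)
  then have "in_degree (basis_graphs ! b) w \<in> set (snd (with_degrees (basis_graphs ! b)))"
    unfolding with_degrees_def snd_conv set_map by (rule imageI)
  ultimately show ?thesis using basis_degrees(2) unfolding list_all_iff by metis
qed

text \<open>The combination of bracket values vanishes at the origin in particular; a factor 2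
  clears the half in \<open>phi_minus\<close>.\<close>

lemma commuting_field_tests:
  fixes u :: "nat \<Rightarrow> real"
  assumes commutes: "\<And>\<rho> a1 a2 I x. smooth \<rho> \<Longrightarrow> smooth a1 \<Longrightarrow> smooth a2 \<Longrightarrow>
     (\<Sum>b<64. u b * schouten (nambu \<rho> a1 a2) (phi_minus (basis_graphs ! b) \<rho> a1 a2) I x) = 0"
    and eqn: "eqn \<in> set (map snd jet_tests)"
  shows "vector_value u eqn = 0"
proof -
  obtain a b r m1 m2 where t: "((a, b, r, m1, m2), eqn) \<in> set jet_tests"
    using eqn by auto
  let ?t = "(a, b, r, m1, m2)"
  have ab: "a = I1" "b = I2 \<or> b = I3" using jet_tests_wf(1) t unfolding list_all_iff by blast+
  obtain \<rho> a1 a2 where s: "smooth \<rho>" "smooth a1" "smooth a2" and V: "\<And>\<Gamma>. field_graph \<Gamma> \<Longrightarrow>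
    (\<forall>w\<in>{1..12}. in_degree \<Gamma> w \<le> 12) \<Longrightarrow>
    schouten (nambu \<rho> a1 a2) (phi_minus \<Gamma> \<rho> a1 a2) {coord_of a, coord_of b} 0 =
      1 / 2 * real_of_int (test_value ?t (with_degrees \<Gamma>))"
    using jet_test_value[OF ab] by blast
  have zip: "zip basis_graphs basis_degrees = map with_degrees basis_graphs"
  proof -
    have "zip xs (map (\<lambda>\<Gamma>. snd (with_degrees \<Gamma>)) xs) = map with_degrees xs" for xs
      by (induction xs) (auto simp: with_degrees_def)
    then show ?thesis unfolding basis_degrees(1)[symmetric] .
  qed
  have "eqn = sparse_row (map (test_value ?t) (map with_degrees basis_graphs))"
    using jet_tests[OF t] unfolding test_row_def zip ..
  then have "vector_value u eqn =
      (\<Sum>b<64. of_int (map (test_value ?t) (map with_degrees basis_graphs) ! b) * u b)"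
    using vector_value_sparse_row basis_graphs(2) by simp
  also have "\<dots> = (\<Sum>c<64. 2 * (u c * schouten (nambu \<rho> a1 a2) (phi_minus (basis_graphs ! c) \<rho> a1 a2)
      {coord_of a, coord_of b} 0))"
  proof (rule sum.cong[OF refl])
    fix c :: nat assume "c \<in> {..<64}"
    then have c: "c < 64" by simp
    have "of_int (test_value ?t (with_degrees (basis_graphs ! c))) =
        2 * schouten (nambu \<rho> a1 a2) (phi_minus (basis_graphs ! c) \<rho> a1 a2) {coord_of a, coord_of b} 0"
      using V[OF basis_field_graph[OF c]] basis_in_degree[OF c] by simp
    then show "of_int (map (test_value ?t) (map with_degrees basis_graphs) ! c) * u c =
        2 * (u c * schouten (nambu \<rho> a1 a2) (phi_minus (basis_graphs ! c) \<rho> a1 a2) {coord_of a, coord_of b} 0)"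
      using c basis_graphs(2) by simp
  qed
  also have "\<dots> = 0" unfolding sum_distrib_left[symmetric] commutes[OF s] by simp
  finally show ?thesis .
qed

lemma commuting_field_coordinates:
  fixes u :: "nat \<Rightarrow> real"
  assumes u: "\<And>eqn. eqn \<in> set (map snd jet_tests) \<Longrightarrow> vector_value u eqn = 0" and b: "b < 64"
  shows "24 * u b = (\<Sum>(H, hs, d, nb, rs, f, e)\<leftarrow>ham_certs. of_int ((24 div e) * coefficient nb b) * u f)"
proof -
  let ?rs = "solution_certs ! b" and ?k = "map (\<lambda>(nb, f, e). (- ((24 div e) * coefficient nb b), f)) kernel_vectors"
  have *: "list_all (\<lambda>(c, r). r < 57) ?rs" "cancels ((24, b) # ?k @ row_combination ?rs)"
    using list_all2_nthD[OF solution_certs, of b] b by simp_all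
  have "vector_value u (row_combination rs) = 0" if "list_all (\<lambda>(c, r). r < 57) rs" for rs
    using that
  proof (induction rs)
    case (Cons p rs)
    obtain c r where p: "p = (c, r)" by fastforce
    then have "map snd jet_tests ! r \<in> set (map snd jet_tests)"
      using Cons.prems jet_tests_wf(2) by (intro nth_mem) simp
    then show ?case using Cons p u by (simp add: row_combination_def scale_vector del: nth_map)
  qed (simp add: row_combination_def)
  then have "24 * u b + vector_value u ?k = 0"
    using cancels[OF *(2), of u] *(1) by simp
  moreover have "vector_value u (map (\<lambda>(nb, f, e). (- ((24 div e) * coefficient nb b), f)) (map (\<lambda>(H, hs, d, nb, rs, f, e). (nb, f, e)) cs)) =
    - (\<Sum>(H, hs, d, nb, rs, f, e)\<leftarrow>cs. of_int ((24 div e) * coefficient nb b) * u f)" for cs :: "ham_cert list"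
    by (induction cs) auto
  ultimately show ?thesis unfolding kernel_vectors_def by simp
qed

section \<open>Hamiltonian vector fields\<close>

text \<open>Exchanging the Casimirs exchanges the last two indices of the Levi-Civita symbol. Since
  \<open>P\<close> is skew in this sense, its bracket with a symmetric Hamiltonian is skew.\<close>

lemma nambu_coeff_swap: "nambu_coeff \<rho> a2 a1 i j x = - nambu_coeff \<rho> a1 a2 i j x"
proof -
  have "nambu_coeff \<rho> a2 a1 i j x = (\<Sum>l\<in>UNIV. \<Sum>k\<in>UNIV. \<rho> x * levi_civita i j k l * pd k a2 x * pd l a1 x)"
    unfolding nambu_coeff_def by (rule sum.swap)
  also have "\<dots> = - nambu_coeff \<rho> a1 a2 i j x"
    unfolding nambu_coeff_def sum_negf[symmetric]
    by (intro sum.cong refl) (subst levi_civita_swap(3), simp)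
  finally show ?thesis .
qed

lemma is_ham_graph:
  assumes "is_ham_graph H"
  shows "ham_graph H" "bounded_graph (map (map shift_vertex) H)" "nambu_micrograph 2 H"
proof -
  have "\<exists>a b p q c d r s. H = [[a, b, p, q], [c, d, r, s]]"
    using assms by (cases H rule: is_ham_graph.cases) (simp_all del: is_ham_graph.simps(1))
  then obtain a b p q c d r s where H0: "H = [[a, b, p, q], [c, d, r, s]]" by blast
  have S: "p = 3" "q = 5" "r = 4" "s = 6" "a \<in> set [1, 2, 4, 6]" "b \<in> set [1, 2, 4, 6]"
    "c \<in> set [1, 2, 3, 5]" "d \<in> set [1, 2, 3, 5]" "a \<noteq> b" "c \<noteq> d" "a = 2 \<or> a = 4 \<or> b = 2 \<or> b = 4"
    using assms unfolding H0 is_ham_graph.simps by simp_all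
  have H: "H = [[a, b, 3, 5], [c, d, 4, 6]]" using S(1-4) H0 by simp
  have in1: "v \<in> {1..6} \<and> v \<noteq> 3 \<and> v \<noteq> 5" if "v \<in> set [1, 2, 4, 6]" for v :: nat using that by auto
  have in2: "v \<in> {1..6} \<and> v \<noteq> 4 \<and> v \<noteq> 6" if "v \<in> set [1, 2, 3, 5]" for v :: nat using that by auto
  have le: "a \<in> {1..6}" "b \<in> {1..6}" "c \<in> {1..6}" "d \<in> {1..6}"
    and ne: "a \<noteq> 3" "a \<noteq> 5" "b \<noteq> 3" "b \<noteq> 5" "c \<noteq> 4" "c \<noteq> 6" "d \<noteq> 4" "d \<noteq> 6"
    using in1[OF S(5)] in1[OF S(6)] in2[OF S(7)] in2[OF S(8)] by blast+
  show h: "ham_graph H" unfolding ham_graph_def H using le by simp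
  have shift: "shift_vertex v < 10" if "v \<in> {1..6}" for v using that by (simp add: shift_vertex_def)
  show "bounded_graph (map (map shift_vertex) H)"
    unfolding H bounded_graph_def using shift le by simp
  define E where "E = {(k, target H k p) |k p. k \<in> {1..2} \<and> p \<in> {1..4}}"
  have E: "(k, target H k p) \<in> E" if "k \<in> {1..2}" "p \<in> {1..4}" for k p
    unfolding E_def using that by blast
  let ?R = "(E \<union> E\<inverse>)\<^sup>*"
  have sym: "(v, u) \<in> ?R" if "(u, v) \<in> ?R" for u v
    using that sym_Un_converse sym_rtrancl symD by metis
  have "(1, a) \<in> E" "(1, b) \<in> E" "(1, 3) \<in> E" "(1, 5) \<in> E" "(2, 4) \<in> E" "(2, 6) \<in> E"
    using E[of 1 1] E[of 1 2] E[of 1 3] E[of 1 4] E[of 2 3] E[of 2 4] by (simp_all add: H target_def)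
  then have e: "(1, a) \<in> ?R" "(1, b) \<in> ?R" "(1, 3) \<in> ?R" "(1, 5) \<in> ?R" "(2, 4) \<in> ?R" "(2, 6) \<in> ?R"
    by blast+
  \<comment> \<open>Vertex 1 reaches vertex 2 directly or through the Casimir vertex 4, which
    belongs to 2.\<close>
  then have "(1, 2) \<in> ?R \<or> (1, 4) \<in> ?R" using S(11) by blast
  then have 2: "(1, 2) \<in> ?R" using sym[OF e(5)] rtrancl_trans by metis
  have "(1, v) \<in> ?R" if "v \<in> {1..6}" for v
  proof -
    have "v \<in> {1, 2, 3, 4, 5, 6}" using that by auto
    then show ?thesis using e 2 rtrancl_trans[OF 2 e(5)] rtrancl_trans[OF 2 e(6)] by auto
  qed
  then have "weakly_connected {1..6} E" unfolding weakly_connected_def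
    by (meson sym rtrancl_trans)
  moreover have "\<forall>k\<in>{1..2}. length (H ! (k - 1)) = 4 \<and> distinct (H ! (k - 1)) \<and>
      {2 + k, 2 * 2 + k} \<subseteq> set (H ! (k - 1)) \<and> set (H ! (k - 1)) \<subseteq> {0..3 * 2}"
  proof -
    have 12: "{1..2} = {1, 2::nat}" by auto
    show ?thesis unfolding 12 using le ne S(9,10) by (simp add: H)
  qed
  ultimately show "nambu_micrograph 2 H"
    unfolding nambu_micrograph_def ham_graph_props(3)[OF h] E_def[symmetric] by (simp add: H)
qed

text \<open>The swapped half of \<open>phi_plus\<close> is bracketed with the original
  \<open>P\<close>. Writing this \<open>P\<close> as minus its swap turns the sum of the halves into
  the difference that defines \<open>skew_value\<close>.\<close>

lemma schouten_phi_plus: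
  assumes H: "ham_graph H" and smooth: "smooth \<rho>" "smooth a1" "smooth a2"
  shows "has_moments 13 \<mu> \<rho> x \<Longrightarrow> has_moments 13 \<mu>1 a1 x \<Longrightarrow> has_moments 13 \<mu>2 a2 x \<Longrightarrow>
      schouten (nambu \<rho> a1 a2) (phi_plus H \<rho> a1 a2) {j} x =
        1 / 2 * vector_value (skew_value \<mu> \<mu>1 \<mu>2 j) (shifted_ham H)"
    and "(\<And>j. I \<noteq> {j}) \<Longrightarrow> schouten (nambu \<rho> a1 a2) (phi_plus H \<rho> a1 a2) I x = 0"
    and "phi_plus H \<rho> a1 a2 I differentiable (at x)"
proof -
  obtain \<nu> \<nu>1 \<nu>2 where mom: "has_moments 13 \<nu> \<rho> x" "has_moments 13 \<nu>1 a1 x" "has_moments 13 \<nu>2 a2 x"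
    using has_moments_exists smooth by metis
  have zero: "phi H \<rho> a1 a2 J = (\<lambda>x. 0)" "phi H \<rho> a2 a1 J = (\<lambda>x. 0)" if "J \<noteq> {}" for J
    using phi_function_jets(3)[OF H smooth mom that] phi_function_jets(3)[OF H smooth(1,3,2) mom(1,3,2) that] .
  have diff: "phi H \<rho> a1 a2 J differentiable (at x)" "phi H \<rho> a2 a1 J differentiable (at x)" for J
    using phi_function_jets(1)[OF H smooth mom] phi_function_jets(1)[OF H smooth(1,3,2) mom(1,3,2)] zero
    by (cases "J = {}"; simp)+
  then show "phi_plus H \<rho> a1 a2 I differentiable (at x)"
    unfolding phi_plus_def by (intro derivative_intros)
  have split: "schouten (nambu \<rho> a1 a2) (phi_plus H \<rho> a1 a2) J x =
    1 / 2 * (schouten (nambu \<rho> a1 a2) (phi H \<rho> a1 a2) J x + schouten (nambu \<rho> a1 a2) (phi H \<rho> a2 a1) J x)" for J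
  proof -
    have "schouten (nambu \<rho> a1 a2) (phi_plus H \<rho> a1 a2) J x = (\<Sum>s\<in>(UNIV::bool set). 1 / 2 *
        schouten (nambu \<rho> a1 a2) (if s then phi H \<rho> a1 a2 else phi H \<rho> a2 a1) J x)"
      by (rule schouten_sum) (auto simp: fun_eq_iff phi_plus_def UNIV_bool field_simps intro!: diff)
    then show ?thesis by (simp add: UNIV_bool field_simps)
  qed
  have "schouten (nambu \<rho> b1 b2) (phi H \<rho> a2 a1) {j} x =
      (\<Sum>i\<in>UNIV. nambu_coeff \<rho> b1 b2 j i x * pd i (phi H \<rho> a2 a1 {}) x)" for b1 b2
    by (rule schouten_nambu_function(1)) (rule zero(2))
  then have swap: "schouten (nambu \<rho> a1 a2) (phi H \<rho> a2 a1) {j} x = - schouten (nambu \<rho> a2 a1) (phi H \<rho> a2 a1) {j} x"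
    by (simp add: nambu_coeff_swap[of \<rho> a2 a1] sum_negf)
  show "schouten (nambu \<rho> a1 a2) (phi_plus H \<rho> a1 a2) {j} x =
        1 / 2 * vector_value (skew_value \<mu> \<mu>1 \<mu>2 j) (shifted_ham H)"
    if mom: "has_moments 13 \<mu> \<rho> x" "has_moments 13 \<mu>1 a1 x" "has_moments 13 \<mu>2 a2 x"
    unfolding split swap schouten_ham(1)[OF H smooth mom] schouten_ham(1)[OF H smooth(1,3,2) mom(1,3,2)]
    by (simp add: shifted_ham_def skew_value_def)
  show "schouten (nambu \<rho> a1 a2) (phi_plus H \<rho> a1 a2) I x = 0" if I: "\<And>j. I \<noteq> {j}"
  proof -
    have "schouten (nambu \<rho> a1 a2) (phi H \<rho> a1 a2) I x = 0" "schouten (nambu \<rho> a1 a2) (phi H \<rho> a2 a1) I x = 0"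
      by (rule schouten_nambu_function(2)[OF _ I], erule zero)+
    then show ?thesis unfolding split by simp
  qed
qed

lemma ham_cert_value:
  assumes q: "(H, hs, d, nb, rs, f, e) \<in> set ham_certs"
  shows "of_int d * vector_value (skew_value \<mu> \<mu>1 \<mu>2 j) (shifted_ham H) =
      (\<Sum>b<64. of_int (coefficient nb b) * skew_value \<mu> \<mu>1 \<mu>2 j (basis_graphs ! b))"
    and "real_of_int (24 div e) = 24 / of_int e"
proof -
  let ?w = "skew_value \<mu> \<mu>1 \<mu>2 j"
  have "ham_cert_valid (H, hs, d, nb, rs, f, e)"
    using ham_certs q unfolding list_all_iff by (rule bspec)
  then have C: "e * (24 div e) = 24" "list_all (\<lambda>(c, b). b < 64) nb"
    "case (hint_vectors (shifted_ham H) hs, relation_vectors rs) of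
        (Some v, Some u) \<Rightarrow> cancels (scale_vector d v @ scale_vector (- 1) (map (\<lambda>(c, b). (c, basis_graphs ! b)) nb @ u))
      | _ \<Rightarrow> False"
    unfolding ham_cert_valid.simps by blast+
  have "real_of_int e * real_of_int (24 div e) = 24" unfolding of_int_mult[symmetric] C(1) by simp
  then show "real_of_int (24 div e) = 24 / of_int e" by (cases "e = 0") (simp_all add: field_simps)
  obtain v u where vu: "hint_vectors (shifted_ham H) hs = Some v" "relation_vectors rs = Some u"
    "cancels (scale_vector d v @ scale_vector (- 1) (map (\<lambda>(c, b). (c, basis_graphs ! b)) nb @ u))"
    using C(3) by (auto split: option.splits)
  have "is_ham_graph (fst (H, hs, d, nb, rs, f, e))"
    using ham_certs_wf q unfolding list_all_iff by (rule bspec)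
  then have "is_ham_graph H" by simp
  note B = is_ham_graph(2)[OF this]
  have "vector_value ?w (shifted_ham H) = vector_value ?w v"
  proof (rule hint_vectors[OF vu(1)])
    fix c g assume "(c, g) \<in> set (shifted_ham H)"
    then obtain v where "v \<in> set [1, 2, 4, 5, 7, 8]" "g = [0, v, 6, 9] # map (map shift_vertex) H"
      by (auto simp: shifted_ham_def)
    then show "bounded_graph g" using B by (auto simp: bounded_graph_def)
  qed
  moreover have "vector_value ?w (map (\<lambda>(c, b). (c, basis_graphs ! b)) nb) = vector_value (\<lambda>b. ?w (basis_graphs ! b)) nb"
    by (induction nb) auto
  ultimately show "of_int d * vector_value ?w (shifted_ham H) = (\<Sum>b<64. of_int (coefficient nb b) * ?w (basis_graphs ! b))"
    using cancels[OF vu(3), of ?w] relation_vectors[OF vu(2), of \<mu> \<mu>1 \<mu>2 j] vector_value_coefficient[OF C(2)]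
    by (simp add: scale_vector)
qed

text \<open>The pivot coordinates of the field prescribe the combination of the seven Hamiltonians;
  \<open>solution_certs\<close> then makes all other coordinates agree.\<close>

lemma commuting_field_hamiltonian:
  fixes u :: "nat \<Rightarrow> real"
  assumes u: "\<And>\<rho> a1 a2 I x. smooth \<rho> \<Longrightarrow> smooth a1 \<Longrightarrow> smooth a2 \<Longrightarrow>
     (\<Sum>b<64. u b * schouten (nambu \<rho> a1 a2) (phi_minus (basis_graphs ! b) \<rho> a1 a2) I x) = 0"
  shows "\<exists>H\<in>H_plus. \<forall>\<rho> a1 a2. smooth \<rho> \<and> smooth a1 \<and> smooth a2 \<longrightarrow>
    (\<lambda>I x. \<Sum>b<64. u b * phi_minus (basis_graphs ! b) \<rho> a1 a2 I x) = schouten (nambu \<rho> a1 a2) (H \<rho> a1 a2)"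
proof -
  \<comment> \<open>The kernel vector of a certificate has the entry \<open>e\<close> at its pivot
    and describes \<open>d\<close> times a bracket; this gives the weight \<open>u f / e\<close>,
    multiplied by \<open>d\<close>.\<close>
  define k :: "ham_cert \<Rightarrow> real" where "k = (\<lambda>(H, hs, d, nb, rs, f, e). u f * of_int d / of_int e)"
  define Hop :: nambu_operator where
    "Hop = (\<lambda>\<rho> a1 a2 I x. \<Sum>q\<in>set ham_certs. k q * phi_plus (fst q) \<rho> a1 a2 I x)"
  have inj: "inj_on fst (set ham_certs)" and dist: "distinct ham_certs"
    using distinct_ham_certs by (simp_all add: distinct_map)
  have ham: "is_ham_graph (fst q)" if "q \<in> set ham_certs" for q
    using ham_certs_wf that by (simp add: list_all_iff)
  have "Hop \<in> H_plus"
    unfolding H_plus_def real_span_def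
  proof (intro CollectI exI conjI allI impI)
    show "finite (fst ` set ham_certs)" by simp
    show "fst ` set ham_certs \<subseteq> {\<Gamma>. nambu_micrograph 2 \<Gamma> \<and> edges_into \<Gamma> 0 = []}"
      using is_ham_graph[OF ham] ham_graph_props(3) by blast
    \<comment> \<open>\<open>real_span\<close> indexes coefficients by graphs; since the graphs of
      the certificates are distinct, each of them determines its certificate.\<close>
    show "Hop \<rho> a1 a2 = (\<lambda>I x. \<Sum>\<Gamma>\<in>fst ` set ham_certs.
        k (inv_into (set ham_certs) fst \<Gamma>) * phi_plus \<Gamma> \<rho> a1 a2 I x)" for \<rho> a1 a2
      unfolding Hop_def sum.reindex[OF inj] by (simp add: inv_into_f_f[OF inj])
  qed
  moreover have "(\<Sum>b<64. u b * phi_minus (basis_graphs ! b) \<rho> a1 a2 I x) = schouten (nambu \<rho> a1 a2) (Hop \<rho> a1 a2) I x"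
    if s: "smooth \<rho>" "smooth a1" "smooth a2" for \<rho> a1 a2 I x
  proof -
    have S: "schouten (nambu \<rho> a1 a2) (Hop \<rho> a1 a2) I x =
        (\<Sum>q\<in>set ham_certs. k q * schouten (nambu \<rho> a1 a2) (phi_plus (fst q) \<rho> a1 a2) I x)"
      by (rule schouten_sum) (auto simp: Hop_def intro: schouten_phi_plus(3)[OF is_ham_graph(1)[OF ham] s])
    show ?thesis
    proof (cases "\<exists>j. I = {j}")
      case True
      then obtain j where I: "I = {j}" by blast
      obtain \<mu> \<mu>1 \<mu>2 where mom: "has_moments 13 \<mu> \<rho> x" "has_moments 13 \<mu>1 a1 x" "has_moments 13 \<mu>2 a2 x"
        using has_moments_exists s by metis
      let ?w = "skew_value \<mu> \<mu>1 \<mu>2 j"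
      \<comment> \<open>The share of one kernel vector in coordinate \<open>b\<close>, with the
        weight read off at its pivot.\<close>
      define l :: "nat \<Rightarrow> ham_cert \<Rightarrow> real" where
        "l b = (\<lambda>(H, hs, d, nb, rs, f, e). of_int (coefficient nb b) * u f / of_int e)" for b
      have coord: "u b = (\<Sum>q\<in>set ham_certs. l b q)" if "b < 64" for b
      proof -
        have "24 * u b = (\<Sum>(H, hs, d, nb, rs, f, e)\<leftarrow>ham_certs. of_int ((24 div e) * coefficient nb b) * u f)"
          by (rule commuting_field_coordinates[OF commuting_field_tests[OF u] that])
        also have "\<dots> = (\<Sum>q\<leftarrow>ham_certs. 24 * l b q)"
          by (intro arg_cong[where f = sum_list] map_cong refl)
            (auto simp: l_def ham_cert_value(2))
        finally show ?thesis
          unfolding sum_list_const_mult sum_list_distinct_conv_sum_set[OF dist] by simp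
      qed
      have "(\<Sum>b<64. u b * phi_minus (basis_graphs ! b) \<rho> a1 a2 I x) = (\<Sum>b<64. \<Sum>q\<in>set ham_certs. l b q * (1 / 2 * ?w (basis_graphs ! b)))"
        unfolding I sum_distrib_right[symmetric]
        by (rule sum.cong[OF refl])
          (use coord phi_minus_skew_value[OF basis_field_graph s mom] in simp)
      also have "\<dots> = (\<Sum>q\<in>set ham_certs. \<Sum>b<64. l b q * (1 / 2 * ?w (basis_graphs ! b)))"
        by (rule sum.swap)
      also have "\<dots> = (\<Sum>q\<in>set ham_certs. k q * schouten (nambu \<rho> a1 a2) (phi_plus (fst q) \<rho> a1 a2) I x)"
      proof (rule sum.cong[OF refl])
        fix q assume q: "q \<in> set ham_certs"
        obtain H hs d nb rs f e where Q: "q = (H, hs, d, nb, rs, f, e)" by (cases q)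
        have "(\<Sum>b<64. l b q * (1 / 2 * ?w (basis_graphs ! b))) =
            u f / (2 * of_int e) * (\<Sum>b<64. of_int (coefficient nb b) * ?w (basis_graphs ! b))"
          unfolding sum_distrib_left by (rule sum.cong[OF refl]) (simp add: Q l_def mult_ac)
        also have "\<dots> = k q * (1 / 2 * vector_value ?w (shifted_ham H))"
          unfolding ham_cert_value(1)[OF q[unfolded Q], symmetric] by (simp add: Q k_def)
        also have "\<dots> = k q * schouten (nambu \<rho> a1 a2) (phi_plus (fst q) \<rho> a1 a2) I x"
          unfolding I schouten_phi_plus(1)[OF is_ham_graph(1)[OF ham[OF q]] s mom] by (simp add: Q)
        finally show "(\<Sum>b<64. l b q * (1 / 2 * ?w (basis_graphs ! b))) =
          k q * schouten (nambu \<rho> a1 a2) (phi_plus (fst q) \<rho> a1 a2) I x" .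
      qed
      finally show ?thesis unfolding S .
    next
      case False
      then have "phi_minus (basis_graphs ! b) \<rho> a1 a2 I x = 0" if "b < 64" for b
        using phi_field(2)[OF basis_field_graph[OF that]] s by (simp add: phi_minus_def)
      moreover have "schouten (nambu \<rho> a1 a2) (phi_plus (fst q) \<rho> a1 a2) I x = 0" if "q \<in> set ham_certs" for q
        using schouten_phi_plus(2)[OF is_ham_graph(1)[OF ham[OF that]] s] False by blast
      ultimately show ?thesis unfolding S by simp
    qed
  qed
  ultimately show ?thesis by (intro bexI[of _ Hop]) (auto simp: fun_eq_iff)
qed

theorem corollary18:
  fixes c :: real and X0 X :: nambu_operator
  assumes "c \<noteq> 0"
    and "X0 \<in> W_minus" and "trivializes_flow c X0"
    and "X \<in> W_minus" and "trivializes_flow c X"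
  shows "\<exists>H\<in>H_plus. \<forall>\<rho> a1 a2. smooth \<rho> \<and> smooth a1 \<and> smooth a2 \<longrightarrow>
    X \<rho> a1 a2 - X0 \<rho> a1 a2 = schouten (nambu \<rho> a1 a2) (H \<rho> a1 a2)"
proof -
  let ?B = "\<lambda>b. phi_minus (basis_graphs ! b)"
  obtain v :: "nat \<Rightarrow> real" where v: "\<And>\<rho> a1 a2. smooth \<rho> \<and> smooth a1 \<and> smooth a2 \<Longrightarrow>
      X \<rho> a1 a2 = (\<lambda>I x. \<Sum>b<64. v b * ?B b \<rho> a1 a2 I x)"
    using W_minus_coordinates[OF assms(4)] by blast
  obtain v0 :: "nat \<Rightarrow> real" where v0: "\<And>\<rho> a1 a2. smooth \<rho> \<and> smooth a1 \<and> smooth a2 \<Longrightarrow>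
      X0 \<rho> a1 a2 = (\<lambda>I x. \<Sum>b<64. v0 b * ?B b \<rho> a1 a2 I x)"
    using W_minus_coordinates[OF assms(2)] by blast
  have "(\<Sum>b<64. (v b - v0 b) * schouten (nambu \<rho> a1 a2) (?B b \<rho> a1 a2) I x) = 0"
    if s: "smooth \<rho>" "smooth a1" "smooth a2" for \<rho> a1 a2 I x
  proof -
    have *: "schouten (nambu \<rho> a1 a2) (Y \<rho> a1 a2) I x = (\<Sum>b<64. w b * schouten (nambu \<rho> a1 a2) (?B b \<rho> a1 a2) I x)"
      if "Y \<rho> a1 a2 = (\<lambda>I x. \<Sum>b<64. w b * ?B b \<rho> a1 a2 I x)" for Y :: nambu_operator and w
      by (rule schouten_sum[OF _ _ that])
        (use phi_minus_differentiable[OF basis_field_graph s] in auto)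
    \<comment> \<open>Both brackets equal the same normalized flow, so the difference of the two
      fields commutes with \<open>P\<close>.\<close>
    have "schouten (nambu \<rho> a1 a2) (X \<rho> a1 a2) = schouten (nambu \<rho> a1 a2) (X0 \<rho> a1 a2)"
      using assms(3,5) s unfolding trivializes_flow_def by metis
    then show ?thesis
      using *[where Y = X and w = v, OF v] *[where Y = X0 and w = v0, OF v0] s by (simp add: left_diff_distrib sum_subtractf)
  qed
  from commuting_field_hamiltonian[of "\<lambda>b. v b - v0 b", OF this] obtain H where H: "H \<in> H_plus"
    "\<And>\<rho> a1 a2. smooth \<rho> \<and> smooth a1 \<and> smooth a2 \<Longrightarrow>
      (\<lambda>I x. \<Sum>b<64. (v b - v0 b) * ?B b \<rho> a1 a2 I x) = schouten (nambu \<rho> a1 a2) (H \<rho> a1 a2)"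
    by blast
  show ?thesis
  proof (intro bexI[OF _ H(1)] allI impI)
    fix \<rho> a1 a2 assume s: "smooth \<rho> \<and> smooth a1 \<and> smooth a2"
    show "X \<rho> a1 a2 - X0 \<rho> a1 a2 = schouten (nambu \<rho> a1 a2) (H \<rho> a1 a2)"
      unfolding H(2)[OF s, symmetric] v[OF s] v0[OF s]
      by (simp add: fun_eq_iff left_diff_distrib sum_subtractf)
  qed
qed

end
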